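(* Let $G_1,G_2$ be finitely generated groups with Cayley graphs $\Gamma_1,\Gamma_2$ (with respect to finite generating sets), word metrics $d_1,d_2$, and stable subgroups $H_1\le G_1$, $H_2\le G_2$. Let $\Lambda_1,\Lambda_2$ be the limit sets of $H_1,H_2$ in the Morse boundaries $\partial_M G_1,\partial_M G_2$ respectively. For $i=1,2$ let $\mathcal{J}_i$ be the collection of translates (by elements of $G_i$) of the weak hull of $\Lambda_i$ in $\Gamma_i$. Let $\phi\colon\mathcal{J}_1\to\mathcal{J}_2$ be uniformly proper. Then there exists a quasi-isometry $q$ from $\Gamma_1$ to $\Gamma_2$ which pairs the sets $\mathcal{J}_1$ and $\mathcal{J}_2$ as $\phi$ does (in particular, $\Gamma_1$ and $\Gamma_2$ are quasi-isometric).
   Context: Stability. Let $X$ be a geodesic metric space and $f\colon \mathbb{R}_{\ge 1}\times\mathbb{R}_{\ge 0}\to\mathbb{R}_{\ge 0}$. A quasigeodesic $\gamma$ in $X$ is $f$-stable if every $(K,\epsilon)$-quasigeodesic with endpoints on $\gamma$ is contained in the $f(K,\epsilon)$-neighborhood of $\gamma$. If $H\le G$ are finitely generated groups (viewed via Cayley graphs with respect to finite generating sets), $H$ is a stable subgroup of $G$ if the inclusion is a quasi-isometric embedding and there is a single $f$ such that the image of every geodesic of $H$ is an $f$-stable quasigeodesic in $G$. Morse boundary and limit sets. Let $X$ be a proper geodesic metric space with basepoint $o$ (for a finitely generated group $G$, take $X$ a Cayley graph for a finite generating set; write $\partial_M G$ for $\partial_M X$). $\partial_M X$ is the set of geodesic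 rays from $o$ that are $f$-stable for some $f$, modulo finite Hausdorff distance. For a function $f$ let $X_o^{(f)}$ be the set of points $y\in X$ that can be joined to $o$ by an $f$-stable geodesic. A sequence $(x_n)$ in $X$ represents the point $[\alpha]\in\partial_M X$ if there is $f$ with all $x_n\in X_o^{(f)}$ and the Gromov products $(x_n|\alpha(m))_o\to\infty$ as $n,m\to\infty$. If a finitely generated group $H$ acts by isometries on $X$, its limit set $\Lambda_H\subseteq\partial_M X$ is the set of points represented by sequences in the orbit $H\cdot o$. The weak hull of $\Lambda_H$ in $X$ is the union of all bi-infinite geodesics with distinct endpoints in $\Lambda_H$ (a bi-infinite geodesic has endpoint $[\alpha]$ if one of its half-rays is at finite Hausdorff distance from $\alpha$). Each $d_i$ induces a pseudo-metric on $\mathcal{J}_i$, also denoted $d_i$, by letting $d_i(J,K)$ be the minimum distance between $J$ and $K$ as closed subsets of $\Gamma_i$. A bijective set map $\phi\colon\mathcal{J}_1\to\mathcal{J}_2$ is uniformly proper if there is $f\colon\mathbb{N}\to\mathbb{N}$ such that for all $J,K\in\mathcal{J}_1$, $d_1(J,K)\le n\Rightarrow d_2(\phi(J),\phi(K))\le f(n)$, and for all $J,K\in\mathcal{J}_2$, $d_2(J,K)\le n\Rightarrow d_1(\phi^{-1}(J),\phi^{-1}(K))\le f(n)$. (So a uniformly proper map is in particular a bijection.) A map $q\colon\Gamma_1\to\Gamma_2$ pairs the sets $\mathcal{J}_1$ and $\mathcal{J}_2$ as $\phi$ does if there is $h\colon\mathbb{N}\to\mathbb{N}$ such that for all $p\in\Gamma_1$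 and $J\in\mathcal{J}_1$, $d_1(p,J)\le n\Rightarrow d_2(q(p),\phi(J))\le h(n)$.
   Formalization: Added assumption: the collection of translates of the weak hull for H_1 has at least two elements (H_1 infinite of infinite index). Without it the claim fails: H_1=G_1=Z and H_2=G_2=F_2 give one-element collections, but Z and F_2 are not quasi-isometric. *)

theory Defs
  imports "HOL-Analysis.Analysis" "HOL-Algebra.Generated_Groups"
begin

section \<open>Coarse geometry\<close>

text \<open>
  Metric spaces are given by a carrier \<open>M\<close> and a distance function \<open>d\<close>, as in
  \<^locale>\<open>Metric_space\<close>. Paths are functions on the real line restricted to an interval.
\<close>

definition qi_embedding ::
  "real \<Rightarrow> real \<Rightarrow> 'p set \<Rightarrow> ('p \<Rightarrow> 'p \<Rightarrow> real) \<Rightarrow> 'q set \<Rightarrow> ('q \<Rightarrow> 'q \<Rightarrow> real) \<Rightarrow> ('p \<Rightarrow> 'q) \<Rightarrow> bool"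
  where "qi_embedding K e A dA B dB f \<longleftrightarrow>
    1 \<le> K \<and> 0 \<le> e \<and> f \<in> A \<rightarrow> B \<and>
    (\<forall>x\<in>A. \<forall>y\<in>A. dA x y / K - e \<le> dB (f x) (f y) \<and> dB (f x) (f y) \<le> K * dA x y + e)"

definition quasi_isometry ::
  "'p set \<Rightarrow> ('p \<Rightarrow> 'p \<Rightarrow> real) \<Rightarrow> 'q set \<Rightarrow> ('q \<Rightarrow> 'q \<Rightarrow> real) \<Rightarrow> ('p \<Rightarrow> 'q) \<Rightarrow> bool"
  where "quasi_isometry A dA B dB f \<longleftrightarrow>
    (\<exists>K e. qi_embedding K e A dA B dB f) \<and> (\<exists>C. \<forall>y\<in>B. \<exists>x\<in>A. dB (f x) y \<le> C)"

definition geodesic :: "'p set \<Rightarrow> ('p \<Rightarrow> 'p \<Rightarrow> real) \<Rightarrow> real set \<Rightarrow> (real \<Rightarrow> 'p) \<Rightarrow> bool"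
  where "geodesic M d I c \<longleftrightarrow>
    is_interval I \<and> I \<noteq> {} \<and> c \<in> I \<rightarrow> M \<and> (\<forall>s\<in>I. \<forall>t\<in>I. d (c s) (c t) = \<bar>s - t\<bar>)"

definition quasigeodesic ::
  "real \<Rightarrow> real \<Rightarrow> 'p set \<Rightarrow> ('p \<Rightarrow> 'p \<Rightarrow> real) \<Rightarrow> real set \<Rightarrow> (real \<Rightarrow> 'p) \<Rightarrow> bool"
  where "quasigeodesic K e M d I c \<longleftrightarrow>
    is_interval I \<and> I \<noteq> {} \<and> qi_embedding K e I dist M d c"

section \<open>Stability\<close>

text \<open>The functions from \<open>[1, \<infinity>) \<times> [0, \<infinity>)\<close> to \<open>[0, \<infinity>)\<close>, curried.\<close>

definition stability_functions :: "(real \<Rightarrow> real \<Rightarrow> real) set"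
  where "stability_functions = ({1..} \<rightarrow> {0..} \<rightarrow> {0..})"

definition stable ::
  "(real \<Rightarrow> real \<Rightarrow> real) \<Rightarrow> 'p set \<Rightarrow> ('p \<Rightarrow> 'p \<Rightarrow> real) \<Rightarrow> real set \<Rightarrow> (real \<Rightarrow> 'p) \<Rightarrow> bool"
  where "stable f M d I c \<longleftrightarrow>
    (\<exists>K e. quasigeodesic K e M d I c) \<and>
    (\<forall>K\<ge>1. \<forall>e\<ge>0. \<forall>a b \<sigma>.
       a \<le> b \<and> quasigeodesic K e M d {a..b} \<sigma> \<and> \<sigma> a \<in> c ` I \<and> \<sigma> b \<in> c ` I \<longrightarrow>
       (\<forall>t\<in>{a..b}. \<exists>s\<in>I. d (\<sigma> t) (c s) \<le> f K e))"

section \<open>Morse boundary, limit sets and weak hulls\<close>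

definition finite_Hausdorff_distance :: "('p \<Rightarrow> 'p \<Rightarrow> real) \<Rightarrow> 'p set \<Rightarrow> 'p set \<Rightarrow> bool"
  where "finite_Hausdorff_distance d A B \<longleftrightarrow>
    (\<exists>D. (\<forall>x\<in>A. \<exists>y\<in>B. d x y \<le> D) \<and> (\<forall>y\<in>B. \<exists>x\<in>A. d x y \<le> D))"

text \<open>In the following, \<open>z\<close> is the basepoint.\<close>

definition morse_rays :: "'p set \<Rightarrow> ('p \<Rightarrow> 'p \<Rightarrow> real) \<Rightarrow> 'p \<Rightarrow> (real \<Rightarrow> 'p) set"
  where "morse_rays M d z =
    {\<alpha>. geodesic M d {0..} \<alpha> \<and> \<alpha> 0 = z \<and> (\<exists>f\<in>stability_functions. stable f M d {0..} \<alpha>)}"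

definition morse_boundary :: "'p set \<Rightarrow> ('p \<Rightarrow> 'p \<Rightarrow> real) \<Rightarrow> 'p \<Rightarrow> (real \<Rightarrow> 'p) set set"
  where "morse_boundary M d z = morse_rays M d z //
    {(\<alpha>, \<beta>). \<alpha> \<in> morse_rays M d z \<and> \<beta> \<in> morse_rays M d z \<and>
            finite_Hausdorff_distance d (\<alpha> ` {0..}) (\<beta> ` {0..})}"

definition stable_stratum ::
  "(real \<Rightarrow> real \<Rightarrow> real) \<Rightarrow> 'p set \<Rightarrow> ('p \<Rightarrow> 'p \<Rightarrow> real) \<Rightarrow> 'p \<Rightarrow> 'p set"
  where "stable_stratum f M d z =
    {y\<in>M. \<exists>l\<ge>0. \<exists>c. geodesic M d {0..l} c \<and> c 0 = z \<and> c l = y \<and> stable f M d {0..l} c}"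

definition gromov_product :: "('p \<Rightarrow> 'p \<Rightarrow> real) \<Rightarrow> 'p \<Rightarrow> 'p \<Rightarrow> 'p \<Rightarrow> real"
  where "gromov_product d z x y = (d x z + d y z - d x y) / 2"

definition represents ::
  "'p set \<Rightarrow> ('p \<Rightarrow> 'p \<Rightarrow> real) \<Rightarrow> 'p \<Rightarrow> (nat \<Rightarrow> 'p) \<Rightarrow> (real \<Rightarrow> 'p) set \<Rightarrow> bool"
  where "represents M d z x \<xi> \<longleftrightarrow>
    (\<exists>f\<in>stability_functions. range x \<subseteq> stable_stratum f M d z) \<and>
    (\<exists>\<alpha>\<in>\<xi>. filterlim (\<lambda>(n, m). gromov_product d z (x n) (\<alpha> (real m))) at_top
       (sequentially \<times>\<^sub>F sequentially))"

text \<open>The limit set is defined for a set \<open>Y\<close> of points, to be used with the orbit of \<open>z\<close>.\<close>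

definition limit_set :: "'p set \<Rightarrow> ('p \<Rightarrow> 'p \<Rightarrow> real) \<Rightarrow> 'p \<Rightarrow> 'p set \<Rightarrow> (real \<Rightarrow> 'p) set set"
  where "limit_set M d z Y =
    {\<xi> \<in> morse_boundary M d z. \<exists>x. range x \<subseteq> Y \<and> represents M d z x \<xi>}"

definition has_endpoint :: "('p \<Rightarrow> 'p \<Rightarrow> real) \<Rightarrow> (real \<Rightarrow> 'p) \<Rightarrow> (real \<Rightarrow> 'p) set \<Rightarrow> bool"
  where "has_endpoint d c \<xi> \<longleftrightarrow> (\<exists>\<alpha>\<in>\<xi>.
    finite_Hausdorff_distance d (c ` {0..}) (\<alpha> ` {0..}) \<or>
    finite_Hausdorff_distance d (c ` {..0}) (\<alpha> ` {0..}))"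

definition weak_hull :: "'p set \<Rightarrow> ('p \<Rightarrow> 'p \<Rightarrow> real) \<Rightarrow> (real \<Rightarrow> 'p) set set \<Rightarrow> 'p set"
  where "weak_hull M d \<Lambda> =
    \<Union> {range c | c. geodesic M d UNIV c \<and>
          (\<exists>\<xi>\<in>\<Lambda>. \<exists>\<eta>\<in>\<Lambda>. \<xi> \<noteq> \<eta> \<and> has_endpoint d c \<xi> \<and> has_endpoint d c \<eta>)}"

section \<open>Cayley graphs\<close>

text \<open>
  A connected simple graph is given by its vertex set \<open>V\<close> and a symmetric irreflexive edge
  relation \<open>E\<close>. A point of its geometric realization is given by its barycentric coordinates: a
  function on the vertices whose support is a vertex or an edge. All edges have length one.
\<close>

definition supp :: "('a \<Rightarrow> real) \<Rightarrow> 'a set"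
  where "supp x = {v. x v \<noteq> 0}"

definition simplices :: "'a set \<Rightarrow> ('a \<times> 'a) set \<Rightarrow> 'a set set"
  where "simplices V E = {{v} | v. v \<in> V} \<union> {{u, v} | u v. (u, v) \<in> E}"

definition realization :: "'a set \<Rightarrow> ('a \<times> 'a) set \<Rightarrow> ('a \<Rightarrow> real) set"
  where "realization V E =
    {x. (\<forall>v. 0 \<le> x v) \<and> supp x \<in> simplices V E \<and> (\<Sum>v\<in>supp x. x v) = 1}"

definition edge_distance :: "('a \<times> 'a) set \<Rightarrow> 'a \<Rightarrow> 'a \<Rightarrow> nat"
  where "edge_distance E u v = (LEAST n. (u, v) \<in> E ^^ n)"

text \<open>
  The path metric. Two points on a common edge are joined by the part of that edge between them;
  otherwise a shortest path leaves \<open>x\<close> through a vertex \<open>u\<close> of its support, which is at distance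
  \<open>1 - x u\<close>, and likewise for \<open>y\<close>.
\<close>

definition path_metric :: "'a set \<Rightarrow> ('a \<times> 'a) set \<Rightarrow> ('a \<Rightarrow> real) \<Rightarrow> ('a \<Rightarrow> real) \<Rightarrow> real"
  where "path_metric V E x y =
    (if supp x \<union> supp y \<in> simplices V E
     then (\<Sum>v\<in>supp x \<union> supp y. \<bar>x v - y v\<bar>) / 2
     else Min ((\<lambda>(u, v). (1 - x u) + real (edge_distance E u v) + (1 - y v)) `
            (supp x \<times> supp y)))"

text \<open>The Cayley graph is taken to be simple: no loops, no multiple edges.\<close>

definition cayley_edges :: "('a, 'm) monoid_scheme \<Rightarrow> 'a set \<Rightarrow> ('a \<times> 'a) set"
  where "cayley_edges G S =
    {(g, h). g \<in> carrier G \<and> h \<in> carrier G \<and> g \<noteq> h \<and>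
       (\<exists>s\<in>S. h = g \<otimes>\<^bsub>G\<^esub> s \<or> g = h \<otimes>\<^bsub>G\<^esub> s)}"

definition cayley_graph :: "('a, 'm) monoid_scheme \<Rightarrow> 'a set \<Rightarrow> ('a \<Rightarrow> real) set"
  where "cayley_graph G S = realization (carrier G) (cayley_edges G S)"

definition cayley_dist ::
  "('a, 'm) monoid_scheme \<Rightarrow> 'a set \<Rightarrow> ('a \<Rightarrow> real) \<Rightarrow> ('a \<Rightarrow> real) \<Rightarrow> real"
  where "cayley_dist G S = path_metric (carrier G) (cayley_edges G S)"

definition vertex :: "'a \<Rightarrow> 'a \<Rightarrow> real"
  where "vertex g = (\<lambda>v. if v = g then 1 else 0)"

definition translate :: "('a, 'm) monoid_scheme \<Rightarrow> 'a \<Rightarrow> ('a \<Rightarrow> real) \<Rightarrow> ('a \<Rightarrow> real)"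
  where "translate G g x = (\<lambda>v. if v \<in> carrier G then x (inv\<^bsub>G\<^esub> g \<otimes>\<^bsub>G\<^esub> v) else 0)"

definition finite_generating_set :: "('a, 'm) monoid_scheme \<Rightarrow> 'a set \<Rightarrow> bool"
  where "finite_generating_set G S \<longleftrightarrow> finite S \<and> S \<subseteq> carrier G \<and> generate G S = carrier G"

section \<open>Stable subgroups and their hulls\<close>

text \<open>
  The inclusion of \<open>H\<close> into \<open>G\<close> is a map between vertex sets of Cayley graphs; \<open>\<iota>\<close> is an
  extension to all points. Any two extensions that are quasi-isometric embeddings are at bounded
  distance, so the choice of \<open>\<iota>\<close> only affects \<open>f\<close>; the same holds for \<open>T\<close>.
\<close>

definition stable_subgroup :: "('a, 'm) monoid_scheme \<Rightarrow> 'a set \<Rightarrow> 'a set \<Rightarrow> bool"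
  where "stable_subgroup G S H \<longleftrightarrow> subgroup H G \<and>
    (\<exists>T. finite_generating_set (G\<lparr>carrier := H\<rparr>) T \<and>
      (let Y = cayley_graph (G\<lparr>carrier := H\<rparr>) T; dY = cayley_dist (G\<lparr>carrier := H\<rparr>) T;
           M = cayley_graph G S; d = cayley_dist G S
       in \<exists>\<iota>. (\<forall>h\<in>H. \<iota> (vertex h) = vertex h) \<and>
              (\<exists>K e. qi_embedding K e Y dY M d \<iota>) \<and>
              (\<exists>f\<in>stability_functions. \<forall>I c. geodesic Y dY I c \<longrightarrow> stable f M d I (\<iota> \<circ> c))))"

definition subgroup_limit_set ::
  "('a, 'm) monoid_scheme \<Rightarrow> 'a set \<Rightarrow> 'a set \<Rightarrow> (real \<Rightarrow> 'a \<Rightarrow> real) set set"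
  where "subgroup_limit_set G S H =
    limit_set (cayley_graph G S) (cayley_dist G S) (vertex \<one>\<^bsub>G\<^esub>)
      ((\<lambda>h. translate G h (vertex \<one>\<^bsub>G\<^esub>)) ` H)"

definition hull_translates ::
  "('a, 'm) monoid_scheme \<Rightarrow> 'a set \<Rightarrow> 'a set \<Rightarrow> ('a \<Rightarrow> real) set set"
  where "hull_translates G S H =
    (\<lambda>g. translate G g ` weak_hull (cayley_graph G S) (cayley_dist G S) (subgroup_limit_set G S H))
      ` carrier G"

section \<open>Uniformly proper maps and pairings\<close>

definition set_distance :: "('p \<Rightarrow> 'p \<Rightarrow> real) \<Rightarrow> 'p set \<Rightarrow> 'p set \<Rightarrow> real"
  where "set_distance d J K = Inf {d x y | x y. x \<in> J \<and> y \<in> K}"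

definition uniformly_proper ::
  "('p \<Rightarrow> 'p \<Rightarrow> real) \<Rightarrow> 'p set set \<Rightarrow> ('q \<Rightarrow> 'q \<Rightarrow> real) \<Rightarrow> 'q set set \<Rightarrow> ('p set \<Rightarrow> 'q set) \<Rightarrow> bool"
  where "uniformly_proper d1 \<J>1 d2 \<J>2 \<phi> \<longleftrightarrow> bij_betw \<phi> \<J>1 \<J>2 \<and>
    (\<exists>f :: nat \<Rightarrow> nat. \<forall>n.
      (\<forall>J\<in>\<J>1. \<forall>K\<in>\<J>1. set_distance d1 J K \<le> real n \<longrightarrow>
         set_distance d2 (\<phi> J) (\<phi> K) \<le> real (f n)) \<and>
      (\<forall>J\<in>\<J>2. \<forall>K\<in>\<J>2. set_distance d2 J K \<le> real n \<longrightarrow>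
         set_distance d1 (inv_into \<J>1 \<phi> J) (inv_into \<J>1 \<phi> K) \<le> real (f n)))"

definition pairs_as ::
  "'p set \<Rightarrow> ('p \<Rightarrow> 'p \<Rightarrow> real) \<Rightarrow> 'p set set \<Rightarrow> ('q \<Rightarrow> 'q \<Rightarrow> real) \<Rightarrow> ('p set \<Rightarrow> 'q set) \<Rightarrow> ('p \<Rightarrow> 'q) \<Rightarrow> bool"
  where "pairs_as M1 d1 \<J>1 d2 \<phi> q \<longleftrightarrow>
    (\<exists>h :: nat \<Rightarrow> nat. \<forall>n. \<forall>p\<in>M1. \<forall>J\<in>\<J>1.
      set_distance d1 {p} J \<le> real n \<longrightarrow> set_distance d2 {q p} (\<phi> J) \<le> real (h n))"

end

theory Submission
  imports Defs
begin

text \<open>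
  A bi-infinite geodesic belongs to the weak hull of the limit set of \<open>H\<close> if and only if it stays
  within bounded distance of \<open>H\<close>, and then the distance is bounded uniformly. Hence the translates
  of the hull are, up to uniformly bounded Hausdorff distance, the cosets of \<open>H\<close>, only boundedly
  many of them meet a given ball, and there are infinitely many of them unless all coincide.

  Two properties of the translates follow from stability. Coarse Helly property: finitely
  many translates that are pairwise close have a point close to all of them. Separation: there is
  \<open>N\<close> such that, if a point \<open>y\<close> is \<open>D\<close>-close to all translates in the \<open>N\<close>-neighbourhood of
  \<open>x\<close>, then the distance of \<open>x\<close> and \<open>y\<close> is bounded in terms of \<open>D\<close>. The quasi-isometry sends \<open>p\<close> to a point close to all
  \<open>\<phi> J\<close>, where \<open>J\<close> runs through the translates in the \<open>N\<close>-neighbourhood of \<open>p\<close>. Separation shows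
  that it pairs the translates as \<open>\<phi>\<close> does, and that two such maps for \<open>\<phi>\<close> and for its inverse are
  coarsely Lipschitz and coarsely inverse to each other.
\<close>

section \<open>Quasigeodesics in pseudometric spaces\<close>

text \<open>The substitute is elementary: a geodesic up to its nearest point to \<open>y\<close>,
  continued by a geodesic to \<open>y\<close>, is a quasigeodesic with uniform constants in every
  geodesic space (\<open>qg_append_nearest\<close>). Whenever the ends of such a path are near one
  translate, the Morse property controls it; Helly and separation are reduced to this situation. The
  Morse property is therefore stated for sets instead of geodesics, and for finite sequences of
  points, because quasigeodesics need not be continuous. A map built from one radius has to pair
  translates at every radius. What makes this possible is a converse estimate: if
  \<open>\<phi> J\<close> is near the image of \<open>p\<close>, then \<open>J\<close> is near
  \<open>p\<close>. It limits the translates seen from the image, so enlarging the radius in the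
  construction moves the image only boundedly. If all translates coincide, \<open>\<phi>\<close>
  carries no information about the groups, which is why two different translates are
  assumed.\<close>

locale pmetric =
  fixes d :: "'p \<Rightarrow> 'p \<Rightarrow> real"
  assumes d_refl [simp]: "d x x = 0"
    and d_sym: "d x y = d y x"
    and d_tri: "d x z \<le> d x y + d y z"
begin

lemma d_nonneg [simp]: "0 \<le> d x y"
  using d_tri[of x x y] d_sym[of x y] by simp

definition near :: "real \<Rightarrow> 'p \<Rightarrow> 'p set \<Rightarrow> bool"
  where "near r x A \<longleftrightarrow> (\<exists>y\<in>A. d x y \<le> r)"

lemma near_mono: "near r x A \<Longrightarrow> r \<le> s \<Longrightarrow> near s x A"
  unfolding near_def by force

lemma near_trans: "near r y A \<Longrightarrow> d x y \<le> s \<Longrightarrow> near (r + s) x A"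
  proof -
  assume "near r y A" "d x y \<le> s"
  then obtain z where "z \<in> A" "d y z \<le> r" unfolding near_def by blast
  then show ?thesis unfolding near_def using d_tri[of x z y] \<open>d x y \<le> s\<close> by (intro bexI[of _ z]) auto
qed

lemma near_self: "x \<in> A \<Longrightarrow> 0 \<le> r \<Longrightarrow> near r x A"
  unfolding near_def using d_refl by force

text \<open>A single \<open>C\<close> is both multiplicative and additive constant, so that
  constants are adjusted by \<open>qg_mono\<close> alone.\<close>

definition qg :: "real \<Rightarrow> nat \<Rightarrow> (nat \<Rightarrow> 'p) \<Rightarrow> bool"
  where "qg C n x \<longleftrightarrow> 1 \<le> C \<and> (\<forall>i j. i \<le> j \<and> j \<le> n \<longrightarrow>
     (real j - real i) / C - C \<le> d (x i) (x j) \<and> d (x i) (x j) \<le> C * (real j - real i) + C)"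

text \<open>The error \<open>3\<close> is what arbitrary points of a graph allow: two for moving the
  ends to vertices, one for the shift of indices.\<close>

definition rgeo :: "nat \<Rightarrow> (nat \<Rightarrow> 'p) \<Rightarrow> bool"
  where "rgeo n p \<longleftrightarrow> (\<forall>i j. i \<le> j \<and> j \<le> n \<longrightarrow> \<bar>d (p i) (p j) - (real j - real i)\<bar> \<le> 3)"

lemma rgeoD: "rgeo n p \<Longrightarrow> i \<le> j \<Longrightarrow> j \<le> n \<Longrightarrow> \<bar>d (p i) (p j) - (real j - real i)\<bar> \<le> 3"
  unfolding rgeo_def by blast

lemma qg_lower: "qg C n x \<Longrightarrow> i \<le> j \<Longrightarrow> j \<le> n \<Longrightarrow> real j - real i \<le> C * (d (x i) (x j) + C)"
proof -
  assume q: "qg C n x" and ij: "i \<le> j" "j \<le> n"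
  then have C: "1 \<le> C" and "(real j - real i) / C \<le> d (x i) (x j) + C"
    unfolding qg_def by (auto simp: algebra_simps)
  then show ?thesis by (simp add: divide_le_eq mult.commute)
qed

lemma qg_upper: "qg C n x \<Longrightarrow> i \<le> j \<Longrightarrow> j \<le> n \<Longrightarrow> d (x i) (x j) \<le> C * (real j - real i) + C"
  unfolding qg_def by blast

lemma qgI:
  assumes "1 \<le> C"
    and "\<And>i j. i \<le> j \<Longrightarrow> j \<le> n \<Longrightarrow> real j - real i \<le> C * (d (x i) (x j) + C)"
    and "\<And>i j. i \<le> j \<Longrightarrow> j \<le> n \<Longrightarrow> d (x i) (x j) \<le> C * (real j - real i) + C"
  shows "qg C n x"
proof -
  have "(real j - real i) / C - C \<le> d (x i) (x j)" if "i \<le> j" "j \<le> n" for i j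
  proof -
    have "(real j - real i) / C \<le> d (x i) (x j) + C"
      using assms(2)[OF that] assms(1) by (simp add: divide_le_eq mult.commute)
    then show ?thesis by simp
  qed
  then show ?thesis unfolding qg_def using assms by blast
qed

lemma qg_ge1: "qg C n x \<Longrightarrow> 1 \<le> C"
  unfolding qg_def by blast

lemma qg_mono: assumes "qg C n x" "C \<le> C'" shows "qg C' n x"
proof (rule qgI)
  have C: "1 \<le> C" using qg_ge1[OF assms(1)] .
  show "1 \<le> C'" using C assms(2) by simp
  fix i j :: nat assume ij: "i \<le> j" "j \<le> n"
  have "C * (d (x i) (x j) + C) \<le> C' * (d (x i) (x j) + C')"
    using C assms(2) by (intro mult_mono) auto
  then show "real j - real i \<le> C' * (d (x i) (x j) + C')"
    using qg_lower[OF assms(1) ij] by simp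
  have "C * (real j - real i) \<le> C' * (real j - real i)"
    using C assms(2) ij by (intro mult_right_mono) auto
  then show "d (x i) (x j) \<le> C' * (real j - real i) + C'"
    using qg_upper[OF assms(1) ij] assms(2) by simp
qed

lemma rgeo_qg: assumes "rgeo n p" shows "qg 3 n p"
proof (rule qgI)
  fix i j :: nat assume ij: "i \<le> j" "j \<le> n"
  show "real j - real i \<le> 3 * (d (p i) (p j) + 3)" and "d (p i) (p j) \<le> 3 * (real j - real i) + 3"
    using rgeoD[OF assms ij] ij d_nonneg[of "p i" "p j"] by (simp_all add: abs_le_iff)
qed simp

lemma qg_rev: assumes "qg C n x" shows "qg C n (\<lambda>i. x (n - i))"
proof (rule qgI)
  fix i j :: nat assume ij: "i \<le> j" "j \<le> n"
  then have *: "n - j \<le> n - i" "n - i \<le> n" "real (n - i) - real (n - j) = real j - real i" by auto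
  show "real j - real i \<le> C * (d (x (n - i)) (x (n - j)) + C)"
    using qg_lower[OF assms *(1,2)] *(3) by (simp add: d_sym[of "x (n - i)" "x (n - j)"])
  show "d (x (n - i)) (x (n - j)) \<le> C * (real j - real i) + C"
    using qg_upper[OF assms *(1,2)] *(3) by (simp add: d_sym[of "x (n - i)" "x (n - j)"])
qed (use assms qg_ge1 in blast)

lemma qg_shift: assumes "qg C n x" "a + m \<le> n" shows "qg C m (\<lambda>i. x (a + i))"
proof (rule qgI)
  fix i j :: nat assume ij: "i \<le> j" "j \<le> m"
  then have *: "a + i \<le> a + j" "a + j \<le> n" "real (a + j) - real (a + i) = real j - real i"
    using assms(2) by auto
  show "real j - real i \<le> C * (d (x (a + i)) (x (a + j)) + C)"
    using qg_lower[OF assms(1) *(1,2)] *(3) by simp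
  show "d (x (a + i)) (x (a + j)) \<le> C * (real j - real i) + C"
    using qg_upper[OF assms(1) *(1,2)] *(3) by simp
qed (use assms qg_ge1 in blast)

text \<open>If \<open>x i0\<close> is almost nearest to \<open>y\<close> among the points of the path, the estimates
  \<open>d (x i) (p s) \<ge> s - 3C\<close> and \<open>d (x i) (p s) \<ge> (i0 - i) / C - s - 2C\<close> combine to the lower bound.\<close>

lemma qg_append_nearest:
  assumes q: "qg C n x" and i0: "i0 \<le> n" and C3: "3 \<le> C"
    and nst: "\<And>i. i \<le> n \<Longrightarrow> d y (x i0) \<le> d y (x i) + C"
    and p: "rgeo m p" "p 0 = x i0" "p m = y"
  shows "qg (3 * C) (i0 + m) (\<lambda>i. if i \<le> i0 then x i else p (i - i0))" (is "qg _ _ ?z")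
proof (rule qgI)
  show "1 \<le> 3 * C" using C3 by simp
  fix i j :: nat assume ij: "i \<le> j" "j \<le> i0 + m"
  have "(real j - real i \<le> 3 * C * (d (?z i) (?z j) + 3 * C)) \<and> d (?z i) (?z j) \<le> 3 * C * (real j - real i) + 3 * C"
  proof -
    consider "j \<le> i0" | "i \<le> i0" "i0 < j" | "i0 < i" by linarith
    then show ?thesis
    proof cases
      case 1
      have "qg (3 * C) n x" using qg_mono[OF q] C3 by simp
      then show ?thesis using 1 ij i0 qg_lower[of "3 * C" n x i j] qg_upper[of "3 * C" n x i j] by auto
    next
      case 2
      define r where "r = real i0 - real i"
      define s where "s = real (j - i0)"
      define \<delta> where "\<delta> = d (x i) (p (j - i0))"
      have r0: "0 \<le> r" and s0: "0 \<le> s" using 2 by (auto simp: r_def s_def)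
      have jm: "j - i0 \<le> m" using ij by auto
      have e1: "\<bar>d (x i0) (p (j - i0)) - s\<bar> \<le> 3"
        using rgeoD[OF p(1), of 0 "j - i0"] jm p(2) by (simp add: s_def)
      have e2: "\<bar>d (p (j - i0)) y - (real m - s)\<bar> \<le> 3"
        using rgeoD[OF p(1), of "j - i0" m] jm p(3) by (simp add: s_def)
      have e3: "\<bar>d (x i0) y - real m\<bar> \<le> 3"
        using rgeoD[OF p(1), of 0 m] p by simp
      have e4: "d y (x i0) \<le> d y (x i) + C" using nst[of i] 2 i0 by auto
      have e5: "d y (x i) \<le> d y (p (j - i0)) + \<delta>"
        using d_tri[of y "x i" "p (j - i0)"] d_sym[of "x i" "p (j - i0)"] by (simp add: \<delta>_def)
      have A: "s \<le> \<delta> + 3 * C"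
        using e1 e2 e3 e4 e5 d_sym[of y "x i0"] d_sym[of y "p (j - i0)"] C3 by linarith
      have e6: "d (x i) (x i0) \<le> \<delta> + (s + 3)"
        using d_tri[of "x i" "x i0" "p (j - i0)"] d_sym[of "x i0" "p (j - i0)"] e1
        unfolding \<delta>_def by linarith
      have "r \<le> C * (d (x i) (x i0) + C)"
        using qg_lower[OF q, of i i0] 2 i0 by (simp add: r_def)
      also have "\<dots> \<le> C * (2 * \<delta> + 5 * C)"
        using e6 A C3 by (intro mult_left_mono) auto
      finally have B: "r \<le> C * (2 * \<delta> + 5 * C)" .
      have d0: "0 \<le> \<delta>" by (simp add: \<delta>_def)
      have CC: "C \<le> C * C" using C3 by (simp add: mult_left_le)
      have Cd: "3 * \<delta> \<le> C * \<delta>" using d0 C3 by (intro mult_right_mono) auto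
      have "r + s \<le> C * (2 * \<delta> + 5 * C) + \<delta> + 3 * C" using A B by linarith
      also have "\<dots> \<le> 3 * C * (\<delta> + 3 * C)"
      proof -
        have "C * (2 * \<delta> + 5 * C) + \<delta> + 3 * C = 2 * (C * \<delta>) + 5 * (C * C) + \<delta> + 3 * C"
          "3 * C * (\<delta> + 3 * C) = 3 * (C * \<delta>) + 9 * (C * C)" by (simp_all add: algebra_simps)
        then show ?thesis using CC Cd d0 C3 by linarith
      qed
      finally have lo: "r + s \<le> 3 * C * (\<delta> + 3 * C)" .
      have "d (x i) (x i0) \<le> C * r + C" using qg_upper[OF q, of i i0] 2 i0 by (simp add: r_def)
      then have "\<delta> \<le> C * r + C + s + 3"
        using d_tri[of "x i" "p (j - i0)" "x i0"] e1 unfolding \<delta>_def by linarith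
      also have "\<dots> \<le> 3 * C * (r + s) + 3 * C"
      proof -
        have "1 * s \<le> C * s" using s0 C3 by (intro mult_right_mono) auto
        moreover have "0 \<le> C * r" "0 \<le> C * s" using r0 s0 C3 by auto
        ultimately show ?thesis using C3 by (simp add: algebra_simps)
      qed
      finally have up: "\<delta> \<le> 3 * C * (r + s) + 3 * C" .
      have z: "?z i = x i" "?z j = p (j - i0)" using 2 by auto
      have rs: "real j - real i = r + s" using 2 by (simp add: r_def s_def of_nat_diff)
      show ?thesis using lo up unfolding z rs \<delta>_def by blast
    next
      case 3
      have z: "?z i = p (i - i0)" "?z j = p (j - i0)" using 3 ij by auto
      have "qg (3 * C) m p" using qg_mono[OF rgeo_qg[OF p(1)]] C3 by simp
      moreover have "i - i0 \<le> j - i0" "j - i0 \<le> m" "real (j - i0) - real (i - i0) = real j - real i"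
        using 3 ij by auto
      ultimately show ?thesis using qg_lower[of "3 * C" m p "i - i0" "j - i0"]
          qg_upper[of "3 * C" m p "i - i0" "j - i0"] unfolding z by simp
    qed
  qed
  then show "real j - real i \<le> 3 * C * (d (?z i) (?z j) + 3 * C)"
    and "d (?z i) (?z j) \<le> 3 * C * (real j - real i) + 3 * C" by blast+
qed

text \<open>A discrete intermediate value argument. At the first index where \<open>x\<close> is
  near some \<open>k j'\<close> with \<open>j \<le> j'\<close>, the preceding point is near some
  \<open>k j''\<close> with \<open>j'' \<le> j\<close>. These two points of \<open>k\<close> are
  close, hence so are their parameters, and \<open>j\<close> lies between them.\<close>

lemma fellow_travel_converse:
  assumes k: "qg C l k" and x: "qg C n x" and ends: "x 0 = k 0" "x n = k l" and D: "0 \<le> D"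
    and cl: "\<And>i. i \<le> n \<Longrightarrow> \<exists>j\<le>l. d (x i) (k j) \<le> D" and j: "j \<le> l"
  shows "\<exists>i\<le>n. d (k j) (x i) \<le> C * (C * (2 * D + 3 * C)) + C + D"
proof -
  have C: "1 \<le> C" using qg_ge1[OF k] .
  define P where "P i \<longleftrightarrow> i \<le> n \<and> (\<exists>j'\<le>l. j \<le> j' \<and> d (x i) (k j') \<le> D)" for i
  have "P n" unfolding P_def using ends(2) j D by auto
  define i where "i = (LEAST i. P i)"
  have Pi: "P i" unfolding i_def using \<open>P n\<close> by (rule LeastI)
  then obtain j' where j': "j' \<le> l" "j \<le> j'" "d (x i) (k j') \<le> D" and i_n: "i \<le> n"
    unfolding P_def by blast
  have "\<exists>j''\<le>j. d (k j'') (k j') \<le> 2 * D + 2 * C"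
  proof (cases i)
    case 0
    then show ?thesis using j' ends(1) D C by (intro exI[of _ 0]) auto
  next
    case (Suc i')
    then have "\<not> P i'" using not_less_Least[of i' P] i_def by simp
    have i'n: "i' \<le> n" using Suc i_n by simp
    obtain j'' where j'': "j'' \<le> l" "d (x i') (k j'') \<le> D" using cl[OF i'n] by blast
    have "j'' \<le> j" using \<open>\<not> P i'\<close> j'' i'n nat_le_linear[of j'' j] unfolding P_def by blast
    have "d (x i') (x i) \<le> 2 * C" using qg_upper[OF x, of i' i] Suc i_n by simp
    then have "d (k j'') (k j') \<le> 2 * D + 2 * C"
      using d_tri[of "k j''" "k j'" "x i'"] d_tri[of "x i'" "k j'" "x i"] j' j'' d_sym[of "x i'" "k j''"]
      by linarith
    then show ?thesis using \<open>j'' \<le> j\<close> by blast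
  qed
  then obtain j'' where j'': "j'' \<le> j" "d (k j'') (k j') \<le> 2 * D + 2 * C" by blast
  have "real j' - real j'' \<le> C * (d (k j'') (k j') + C)"
    using qg_lower[OF k, of j'' j'] j' j'' by auto
  also have "\<dots> \<le> C * (2 * D + 3 * C)" using j'' C by (intro mult_left_mono) auto
  finally have len: "real j' - real j'' \<le> C * (2 * D + 3 * C)" .
  have "d (k j) (k j') \<le> C * (real j' - real j) + C" using qg_upper[OF k] j' by blast
  also have "\<dots> \<le> C * (C * (2 * D + 3 * C)) + C"
    using len j'' C by (intro add_right_mono mult_left_mono) auto
  finally have "d (k j) (x i) \<le> C * (C * (2 * D + 3 * C)) + C + D"
    using d_tri[of "k j" "x i" "k j'"] j'(3) d_sym[of "x i" "k j'"] by linarith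
  then show ?thesis using i_n by blast
qed

lemma ex_nearest_index: "\<exists>i0\<le>n. \<forall>i\<le>n. d y (x i0) \<le> d y (x (i::nat))"
proof -
  have "finite ((\<lambda>i. d y (x i)) ` {..n})" "((\<lambda>i. d y (x i)) ` {..n}) \<noteq> {}" by auto
  from Min_in[OF this] obtain i0 where i0: "i0 \<le> n" "Min ((\<lambda>i. d y (x i)) ` {..n}) = d y (x i0)"
    by (elim imageE) auto
  show ?thesis
  proof (intro exI[of _ i0] conjI allI impI i0(1))
    fix i assume "i \<le> n"
    then have "Min ((\<lambda>i. d y (x i)) ` {..n}) \<le> d y (x i)" by (intro Min_le) auto
    then show "d y (x i0) \<le> d y (x i)" using i0 by simp
  qed
qed

text \<open>The first conclusion is quasiconvexity. The second, fellow-travelling, does not follow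
  from it if \<open>A\<close> is large, say a whole plane; it is needed for the gates in
  \<open>morse_helly\<close> and for the stability of geodesics near \<open>A\<close>.\<close>

definition morse_bound :: "real \<Rightarrow> real \<Rightarrow> 'p set \<Rightarrow> bool"
  where "morse_bound C D A \<longleftrightarrow> (\<forall>n x m y i. qg C n x \<longrightarrow> qg C m y \<longrightarrow> x 0 = y 0 \<longrightarrow> x n = y m \<longrightarrow>
     near C (x 0) A \<longrightarrow> near C (x n) A \<longrightarrow> i \<le> n \<longrightarrow> near D (x i) A \<and> (\<exists>j\<le>m. d (x i) (y j) \<le> D))"

definition morse_family :: "'p set set \<Rightarrow> bool"
  where "morse_family \<A> \<longleftrightarrow> (\<forall>C. \<exists>D\<ge>0. \<forall>A\<in>\<A>. morse_bound C D A)"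

lemma morse_bound_travel:
  "morse_bound C D A \<Longrightarrow> qg C n x \<Longrightarrow> qg C m y \<Longrightarrow> x 0 = y 0 \<Longrightarrow> x n = y m \<Longrightarrow>
   near C (x 0) A \<Longrightarrow> near C (x n) A \<Longrightarrow> i \<le> n \<Longrightarrow> \<exists>j\<le>m. d (x i) (y j) \<le> D"
  unfolding morse_bound_def by simp

lemma morse_bound_near:
  "morse_bound C D A \<Longrightarrow> qg C n x \<Longrightarrow> near C (x 0) A \<Longrightarrow> near C (x n) A \<Longrightarrow> i \<le> n \<Longrightarrow> near D (x i) A"
  unfolding morse_bound_def by blast

lemma morse_familyE:
  assumes "morse_family \<A>"
  obtains D where "0 \<le> D" "\<And>A. A \<in> \<A> \<Longrightarrow> morse_bound C D A"
  using assms unfolding morse_family_def by blast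

definition close :: "real \<Rightarrow> 'p set \<Rightarrow> 'p set \<Rightarrow> bool"
  where "close r A B \<longleftrightarrow> (\<exists>x\<in>A. \<exists>y\<in>B. d x y \<le> r)"

lemma close_sym: "close r A B \<Longrightarrow> close r B A"
  unfolding close_def by (metis d_sym)

lemma near_near_close: assumes "near r x A" "near s x B" shows "close (r + s) A B"
proof -
  obtain a b where "a \<in> A" "d x a \<le> r" "b \<in> B" "d x b \<le> s" using assms unfolding near_def by blast
  then show ?thesis unfolding close_def using d_tri[of a b x] d_sym[of a x] by force
qed

lemma near_subset_dist: assumes "near r x A" "\<And>a. a \<in> A \<Longrightarrow> near s a B" shows "near (r + s) x B"
proof -
  obtain a where "a \<in> A" "d x a \<le> r" using assms(1) unfolding near_def by blast
  then show ?thesis using near_trans[OF assms(2)[of a], of x r] by (simp add: add.commute)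
qed

end

section \<open>Morse families of subsets\<close>

locale rough_geodesic = pmetric +
  assumes rough: "\<exists>n p. p 0 = x \<and> p n = y \<and> rgeo n p"
begin

lemma roughE: obtains n p where "p 0 = x" "p n = y" "rgeo n p" "\<bar>d x y - real n\<bar> \<le> 3"
proof -
  obtain n p where *: "p 0 = x" "p n = y" "rgeo n p" using rough by blast
  show ?thesis using that[OF *] rgeoD[OF *(3), of 0 n] * by simp
qed

text \<open>The nearest point to \<open>a\<close> on a geodesic \<open>[b, c]\<close> lies near all three sides.\<close>

lemma morse_three_helly:
  assumes mf: "morse_family \<A>"
  shows "\<exists>D\<ge>0. \<forall>J\<in>\<A>. \<forall>K\<in>\<A>. \<forall>L\<in>\<A>. close r J K \<and> close r K L \<and> close r J L \<longrightarrow>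
     (\<exists>m. near D m J \<and> near D m K \<and> near D m L)"
proof -
  \<comment> \<open>\<open>9 = 3 * 3\<close> is the constant of \<open>qg_append_nearest\<close> for
    rough geodesics; \<open>r\<close> admits ends that are only \<open>r\<close>-near a set.\<close>
  define C where "C = max 9 r"
  have C9: "9 \<le> C" and rC: "r \<le> C" by (auto simp: C_def)
  obtain D where D: "0 \<le> D" and mbN: "\<And>A. A \<in> \<A> \<Longrightarrow> morse_bound C D A"
    by (rule morse_familyE[OF mf]) blast
  note N = morse_bound_near[OF mbN]
  show ?thesis
  proof (intro exI[of _ D] conjI D ballI impI)
    fix J K L assume fam: "J \<in> \<A>" "K \<in> \<A>" "L \<in> \<A>" and "close r J K \<and> close r K L \<and> close r J L"
    \<comment> \<open>The points \<open>b\<close> and \<open>c\<close> are near \<open>L\<close>,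
      \<open>b\<close> and \<open>a\<close> near \<open>K\<close>, \<open>c\<close> and
      \<open>a\<close> near \<open>J\<close>, so each side of the triangle is controlled by one of
      the three sets.\<close>
    then obtain a b c where a: "a \<in> J" "near r a K" and b: "b \<in> K" "near r b L"
      and c: "c \<in> L" "near r c J"
      using close_sym[of r J L] unfolding close_def near_def by blast
    note nC = near_mono[OF _ rC]
    obtain n \<gamma> where \<gamma>: "\<gamma> 0 = b" "\<gamma> n = c" "rgeo n \<gamma>" by (rule roughE)
    obtain i0 where i0: "i0 \<le> n" "\<forall>i\<le>n. d a (\<gamma> i0) \<le> d a (\<gamma> i)" using ex_nearest_index by blast
    obtain m p where p: "p 0 = \<gamma> i0" "p m = a" "rgeo m p" by (rule roughE)
    have q3: "qg 3 n \<gamma>" by (rule rgeo_qg[OF \<gamma>(3)])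
    have "near D (\<gamma> i0) L"
      using N[OF fam(3) qg_mono[OF q3], of i0] C9 \<gamma> i0 b c near_self[of c L C] nC by auto
    moreover have "near D (\<gamma> i0) K"
    proof -
      let ?z = "\<lambda>i. if i \<le> i0 then \<gamma> i else p (i - i0)"
      have "qg (3 * 3) (i0 + m) ?z"
        using i0 by (intro qg_append_nearest[OF q3 _ _ _ p(3,1,2)]) auto
      then have "qg C (i0 + m) ?z" using qg_mono C9 by simp
      moreover have "near C (?z 0) K" using \<gamma> b near_self[of b K C] C9 by simp
      moreover have "near C (?z (i0 + m)) K" using p a nC by (cases m) auto
      ultimately show ?thesis using N[OF fam(2), of "i0 + m" ?z i0] by simp
    qed
    moreover have "near D (\<gamma> i0) J"
    proof -
      let ?x = "\<lambda>i. \<gamma> (n - i)"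
      let ?z = "\<lambda>i. if i \<le> n - i0 then ?x i else p (i - (n - i0))"
      have "qg (3 * 3) (n - i0 + m) ?z"
      proof (intro qg_append_nearest[OF qg_rev[OF q3] _ _ _ p(3)])
        show "d a (\<gamma> (n - (n - i0))) \<le> d a (\<gamma> (n - i)) + 3" for i
          using i0(2)[rule_format, of "n - i"] i0(1) by simp
      qed (use i0 p in auto)
      then have "qg C (n - i0 + m) ?z" using qg_mono C9 by simp
      moreover have "near C (?z 0) J" using \<gamma> c nC by simp
      moreover have "near C (?z (n - i0 + m)) J" using p a near_self[of a J C] C9 i0 by (cases m) auto
      ultimately show ?thesis using N[OF fam(1), of "n - i0 + m" ?z "n - i0"] i0 by simp
    qed
    ultimately show "\<exists>m. near D m J \<and> near D m K \<and> near D m L" by blast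
  qed
qed

text \<open>A nearest point need not exist in an arbitrary set. Taking the least natural number that
  bounds some distance from \<open>a\<close> leaves a slack of at most one.\<close>

lemma ex_almost_nearest: assumes "K \<noteq> {}" shows "\<exists>x\<in>K. \<forall>y\<in>K. d a x \<le> d a y + 1"
proof -
  define N where "N = (LEAST n::nat. \<exists>x\<in>K. d a x \<le> real n)"
  obtain x0 where "x0 \<in> K" using assms by blast
  then have "\<exists>n::nat. \<exists>x\<in>K. d a x \<le> real n" using real_arch_simple by blast
  then have "\<exists>x\<in>K. d a x \<le> real N" unfolding N_def by (rule LeastI_ex)
  then obtain x where x: "x \<in> K" "d a x \<le> real N" by blast
  have "d a x \<le> d a y + 1" if "y \<in> K" for y
  proof (rule ccontr)
    assume "\<not> d a x \<le> d a y + 1"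
    then have *: "d a y + 1 < real N" using x by simp
    then have "0 < N" using d_nonneg[of a y] by linarith
    then have "d a y \<le> real (N - 1)" using * by (simp add: of_nat_diff)
    then have "N \<le> N - 1" unfolding N_def using that by (intro Least_le) blast
    then show False using \<open>0 < N\<close> by simp
  qed
  then show ?thesis using x by blast
qed

text \<open>As for subtrees of a tree, the gate to the member of the family that
  is farthest from a fixed point \<open>o'\<close> lies near all members.\<close>

lemma morse_helly:
  assumes mf: "morse_family \<A>" and ne: "\<And>A. A \<in> \<A> \<Longrightarrow> A \<noteq> {}"
  shows "\<exists>D\<ge>0. \<forall>\<F>\<subseteq>\<A>. finite \<F> \<and> (\<forall>A\<in>\<F>. \<forall>B\<in>\<F>. close r A B) \<longrightarrow> (\<exists>p. \<forall>A\<in>\<F>. near D p A)"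
proof -
  obtain D1 where D1: "0 \<le> D1"
    and H3: "\<And>J K L. J \<in> \<A> \<Longrightarrow> K \<in> \<A> \<Longrightarrow> L \<in> \<A> \<Longrightarrow> close r J K \<Longrightarrow> close r K L \<Longrightarrow> close r J L \<Longrightarrow>
       \<exists>m. near D1 m J \<and> near D1 m K \<and> near D1 m L"
    using morse_three_helly[OF mf] by meson
  define C2 where "C2 = max 3 D1"
  obtain D2 where D2: "0 \<le> D2" and mbN2: "\<And>A. A \<in> \<A> \<Longrightarrow> morse_bound C2 D2 A"
    by (rule morse_familyE[OF mf]) blast
  note N2 = morse_bound_near[OF mbN2]
  \<comment> \<open>\<open>D2 + 1\<close> is how far a gate may fail to be nearest to
    \<open>o'\<close> on a geodesic from the gate to \<open>m\<close>: \<open>D2\<close> since the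
    geodesic may leave the set, one from \<open>ex_almost_nearest\<close>.\<close>
  define C3 where "C3 = max 3 (max D1 (D2 + 1))"
  have "3 \<le> C3" "D1 \<le> C3" by (simp_all add: C3_def)
  then have C3: "D1 \<le> 3 * C3" by linarith
  obtain D3 where D3: "0 \<le> D3" and mbN3: "\<And>A. A \<in> \<A> \<Longrightarrow> morse_bound (3 * C3) D3 A"
    by (rule morse_familyE[OF mf]) blast
  note N3 = morse_bound_travel[OF mbN3]
  define C4 where "C4 = max 3 (max D1 D3)"
  obtain D4 where D4: "0 \<le> D4" and mbN4: "\<And>A. A \<in> \<A> \<Longrightarrow> morse_bound C4 D4 A"
    by (rule morse_familyE[OF mf]) blast
  note N4 = morse_bound_near[OF mbN4]
  define D5 where "D5 = max (D4 + D3) (4 * D3 + 11)"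
  have D5: "0 \<le> D5" using D3 by (simp add: D5_def)
  show ?thesis
  proof (intro exI[of _ D5] conjI D5 allI impI)
    fix \<F> assume sub: "\<F> \<subseteq> \<A>" and F: "finite \<F> \<and> (\<forall>A\<in>\<F>. \<forall>B\<in>\<F>. close r A B)"
    show "\<exists>p. \<forall>A\<in>\<F>. near D5 p A"
    proof (cases "\<F> = {}")
      case False
      then obtain J where J: "J \<in> \<F>" by blast
      then obtain o' where o': "o' \<in> J" using ne sub by blast
      have "\<forall>K\<in>\<F>. \<exists>x. x \<in> K \<and> (\<forall>y\<in>K. d o' x \<le> d o' y + 1)"
      proof
        fix K assume "K \<in> \<F>"
        then have "K \<noteq> {}" using ne sub by blast
        from ex_almost_nearest[OF this, of o'] show "\<exists>x. x \<in> K \<and> (\<forall>y\<in>K. d o' x \<le> d o' y + 1)" by blast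
      qed
      from bchoice[OF this] obtain \<pi> where "\<forall>K\<in>\<F>. \<pi> K \<in> K \<and> (\<forall>y\<in>K. d o' (\<pi> K) \<le> d o' y + 1)"
        by blast
      then have \<pi>: "\<And>K. K \<in> \<F> \<Longrightarrow> \<pi> K \<in> K" "\<And>K y. K \<in> \<F> \<Longrightarrow> y \<in> K \<Longrightarrow> d o' (\<pi> K) \<le> d o' y + 1"
        by blast+
      define S where "S = (\<lambda>K. d o' (\<pi> K)) ` \<F>"
      have "finite S" "S \<noteq> {}" using F False by (auto simp: S_def)
      from Max_in[OF this] obtain K where K: "K \<in> \<F>" "Max S = d o' (\<pi> K)" unfolding S_def by (elim imageE)
      have mx: "d o' (\<pi> K') \<le> d o' (\<pi> K)" if "K' \<in> \<F>" for K'
        using Max_ge[OF \<open>finite S\<close>] K(2) that by (simp add: S_def)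
      have "near D5 (\<pi> K) K'" if K': "K' \<in> \<F>" for K'
      proof -
        obtain m where m: "near D1 m J" "near D1 m K" "near D1 m K'"
          using H3[of J K K'] F sub J K(1) K' by blast
        obtain n \<gamma> where \<gamma>: "\<gamma> 0 = o'" "\<gamma> n = m" "rgeo n \<gamma>" by (rule roughE)
        \<comment> \<open>The geodesic from \<open>m\<close> to the gate of \<open>L\<close> stays
          near \<open>L\<close>, so the gate is almost its nearest point to \<open>o'\<close>, and
          continuing to \<open>o'\<close> gives a quasigeodesic. Its ends are near \<open>J\<close>
          and are those of \<open>\<gamma>\<close>, so \<open>\<gamma>\<close> passes near the
          gate.\<close>
        have gate: "\<exists>j\<le>n. d (\<pi> L) (\<gamma> j) \<le> D3" if L: "L \<in> \<F>" and mL: "near D1 m L" for L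
        proof -
          obtain l \<tau> where \<tau>: "\<tau> 0 = \<pi> L" "\<tau> l = m" "rgeo l \<tau>" by (rule roughE)
          have nst: "d o' (\<pi> L) \<le> d o' (\<tau> i) + (D2 + 1)" if "i \<le> l" for i
          proof -
            have "near D2 (\<tau> i) L"
              using \<pi>(1)[OF L] D1 near_mono[OF mL] L sub that \<tau> near_self[of "\<pi> L" L C2]
              by (intro N2[of L l \<tau> i] qg_mono[OF rgeo_qg]) (auto simp: C2_def)
            then obtain y where "y \<in> L" "d (\<tau> i) y \<le> D2" unfolding near_def by blast
            then show ?thesis using \<pi>(2)[OF L, of y] d_tri[of o' y "\<tau> i"] by simp
          qed
          obtain k p where p: "p 0 = \<pi> L" "p k = o'" "rgeo k p" by (rule roughE)
          let ?x = "\<lambda>i. \<tau> (l - i)"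
          let ?z = "\<lambda>i. if i \<le> l then ?x i else p (i - l)"
          have "qg C3 l ?x" by (intro qg_rev qg_mono[OF rgeo_qg[OF \<tau>(3)]]) (simp add: C3_def)
          then have qz: "qg (3 * C3) (l + k) ?z"
          proof (rule qg_append_nearest[OF _ _ _ _ p(3)])
            show "d o' (\<tau> (l - l)) \<le> d o' (\<tau> (l - i)) + C3" for i
              using nst[of "l - i"] \<tau>(1) by (simp add: C3_def)
          qed (use p \<tau> in \<open>auto simp: C3_def\<close>)
          have q\<gamma>: "qg (3 * C3) n (\<lambda>i. \<gamma> (n - i))" by (intro qg_rev qg_mono[OF rgeo_qg[OF \<gamma>(3)]]) (simp add: C3_def)
          have zk: "?z (l + k) = o'" using p \<tau> by (cases k) auto
          have "\<exists>j\<le>n. d (?z l) (\<gamma> (n - j)) \<le> D3"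
          proof (rule N3[OF _ qz q\<gamma>])
            show "J \<in> \<A>" using J sub by blast
            show "near (3 * C3) (?z 0) J" using \<tau>(2) near_mono[OF m(1) C3] by simp
            show "near (3 * C3) (?z (l + k)) J" unfolding zk using near_self[OF o'] by (simp add: C3_def)
            show "?z (l + k) = \<gamma> (n - n)" unfolding zk using \<gamma> by simp
          qed (use \<tau> \<gamma> in auto)
          then obtain j where "j \<le> n" "d (\<tau> 0) (\<gamma> (n - j)) \<le> D3" by auto
          then show ?thesis using \<tau>(1) by (intro exI[of _ "n - j"]) simp
        qed
        obtain i where i: "i \<le> n" "d (\<pi> K) (\<gamma> i) \<le> D3" using gate[OF K(1) m(2)] by blast
        obtain i' where i': "i' \<le> n" "d (\<pi> K') (\<gamma> i') \<le> D3" using gate[OF K' m(3)] by blast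
        have g0: "\<bar>d o' (\<gamma> j) - real j\<bar> \<le> 3" if "j \<le> n" for j using rgeoD[OF \<gamma>(3), of 0 j] \<gamma>(1) that by simp
        \<comment> \<open>Gates appear along \<open>\<gamma>\<close> roughly in the order of their
          distance from \<open>o'\<close>; the gate of \<open>K\<close> is the farthest, so
          \<open>i'\<close> exceeds \<open>i\<close> by a bounded amount at most.\<close>
        have ii: "real i' \<le> real i + 2 * D3 + 6"
          using g0[OF i(1)] g0[OF i'(1)] mx[OF K'] i(2) i'(2) d_tri[of o' "\<gamma> i'" "\<pi> K'"]
            d_tri[of o' "\<pi> K" "\<gamma> i"] d_sym[of "\<gamma> i" "\<pi> K"] by linarith
        have nK': "near D3 (\<gamma> i') K'" using \<pi>(1)[OF K'] i'(2) d_sym[of "\<gamma> i'"] unfolding near_def by auto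
        show ?thesis
        proof (cases "i' \<le> i")
          case True
          \<comment> \<open>From \<open>i'\<close> on, \<open>\<gamma>\<close> runs between two
            points near \<open>K'\<close>, and on its way it passes \<open>\<gamma> i\<close>, which
            is near the gate of \<open>K\<close>.\<close>
          have "near D4 (\<gamma> (i' + (i - i'))) K'"
          proof (rule N4[of K' "n - i'" "\<lambda>j. \<gamma> (i' + j)"])
            show "K' \<in> \<A>" using K' sub by blast
            show "qg C4 (n - i') (\<lambda>j. \<gamma> (i' + j))"
              using i' by (intro qg_shift[OF qg_mono[OF rgeo_qg[OF \<gamma>(3)]]]) (auto simp: C4_def)
            show "near C4 (\<gamma> (i' + 0)) K'" using near_mono[OF nK'] by (simp add: C4_def)
            show "near C4 (\<gamma> (i' + (n - i'))) K'" using near_mono[OF m(3)] i' \<gamma>(2) by (simp add: C4_def)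
            show "i - i' \<le> n - i'" using i by simp
          qed
          then have "near (D4 + D3) (\<pi> K) K'" using near_trans i(2) True by simp
          then show ?thesis by (rule near_mono) (simp add: D5_def)
        next
          case False
          then have "d (\<gamma> i) (\<gamma> i') \<le> real i' - real i + 3" using rgeoD[OF \<gamma>(3), of i i'] i' by simp
          then have "d (\<gamma> i) (\<gamma> i') \<le> 2 * D3 + 9" using ii by simp
          then have "d (\<pi> K) (\<gamma> i') \<le> 3 * D3 + 9" using d_tri[of "\<pi> K" "\<gamma> i'" "\<gamma> i"] i(2) by simp
          then have "near (D3 + (3 * D3 + 9)) (\<pi> K) K'" by (rule near_trans[OF nK'])
          then show ?thesis by (rule near_mono) (simp add: D5_def)
        qed
      qed
      then show ?thesis by blast
    qed auto
  qed
qed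

text \<open>The constant \<open>R\<close> does not depend on \<open>D\<close>: shortest paths from the geodesic to \<open>A\<close> near its ends
  turn it into a quasigeodesic with ends in \<open>A\<close> and with uniform constants.\<close>

lemma morse_middle:
  assumes mf: "morse_family \<A>"
  shows "\<exists>R\<ge>0. \<forall>D\<ge>0. \<exists>L. \<forall>A\<in>\<A>. \<forall>n \<gamma> i. rgeo n \<gamma> \<and> near D (\<gamma> 0) A \<and> near D (\<gamma> n) A \<and>
     L \<le> i \<and> i + L \<le> n \<longrightarrow> near R (\<gamma> i) A"
proof -
  \<comment> \<open>\<open>27 = 3 * 3 * 3\<close>, because \<open>qg_append_nearest\<close> is
    applied once at each end of a rough geodesic.\<close>
  obtain R where R: "0 \<le> R" and mbN: "\<And>A. A \<in> \<A> \<Longrightarrow> morse_bound 27 R A"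
    by (rule morse_familyE[OF mf]) blast
  note N = morse_bound_near[OF mbN]
  show ?thesis
  proof (rule exI[of _ R], rule conjI[OF R], rule allI, rule impI)
    fix D :: real assume D: "0 \<le> D"
    \<comment> \<open>A bound for what is cut off at either end. The second end is decisive, since
      the path is then only a \<open>9\<close>-quasigeodesic.\<close>
    obtain L :: nat where L: "9 * (2 * D + 9) \<le> real L" using real_arch_simple by blast
    have "near R (\<gamma> i) A" if A: "A \<in> \<A>" and g: "rgeo n \<gamma>"
      and nr: "near D (\<gamma> 0) A" "near D (\<gamma> n) A" and iL: "L \<le> i" "i + L \<le> n" for A n \<gamma> i
    proof -
      obtain a where a: "a \<in> A" "d (\<gamma> 0) a \<le> D" using nr unfolding near_def by blast
      obtain b where b: "b \<in> A" "d (\<gamma> n) b \<le> D" using nr unfolding near_def by blast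
      obtain i1 where i1: "i1 \<le> n" "\<forall>j\<le>n. d a (\<gamma> i1) \<le> d a (\<gamma> j)" using ex_nearest_index by blast
      have "d a (\<gamma> i1) \<le> D" using i1(2)[rule_format, of 0] a d_sym[of a] by simp
      then have "d (\<gamma> 0) (\<gamma> i1) \<le> 2 * D" using d_tri[of "\<gamma> 0" "\<gamma> i1" a] a by simp
      then have i1D: "real i1 \<le> 2 * D + 3" using rgeoD[OF g, of 0 i1] i1 by simp
      obtain m p where p: "p 0 = \<gamma> i1" "p m = a" "rgeo m p" by (rule roughE)
      let ?x = "\<lambda>j. \<gamma> (n - j)"
      let ?z = "\<lambda>j. if j \<le> n - i1 then ?x j else p (j - (n - i1))"
      have qz: "qg (3 * 3) (n - i1 + m) ?z"
      proof (intro qg_append_nearest[OF qg_rev[OF rgeo_qg[OF g]] _ _ _ p(3)])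
        show "d a (\<gamma> (n - (n - i1))) \<le> d a (\<gamma> (n - i)) + 3" for i
          using i1(2)[rule_format, of "n - i"] i1(1) by simp
      qed (use i1 p in auto)
      \<comment> \<open>\<open>w\<close> runs from \<open>a\<close> to \<open>\<gamma> i1\<close>
        and along \<open>\<gamma>\<close> to \<open>\<gamma> n\<close>; after this reversal the
        second end can be treated by the same lemma. The point \<open>\<gamma> j\<close> has index
        \<open>m + (j - i1)\<close> on \<open>w\<close>.\<close>
      define N' where "N' = n - i1 + m"
      define w where "w j = ?z (N' - j)" for j
      have qw: "qg 9 N' w" using qg_rev[OF qz] unfolding w_def N'_def by simp
      have w0: "w 0 = a" using p i1 by (cases m) (auto simp: w_def N'_def)
      have wN: "w N' = \<gamma> n" by (simp add: w_def)
      have w\<gamma>: "w (m + (j - i1)) = \<gamma> j" if "i1 \<le> j" "j \<le> n" for j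
      proof -
        have "N' - (m + (j - i1)) = n - j" using that i1 by (simp add: N'_def)
        then show ?thesis using that diff_le_mono2[of i1 j n] by (simp add: w_def)
      qed
      obtain i2 where i2: "i2 \<le> N'" "\<forall>j\<le>N'. d b (w i2) \<le> d b (w j)" using ex_nearest_index by blast
      have "d b (w i2) \<le> D" using i2(2)[rule_format, of N'] b d_sym[of b] wN by simp
      then have "d (w i2) (w N') \<le> 2 * D" using d_tri[of "w i2" "w N'" b] b wN d_sym[of b] by simp
      then have "real N' - real i2 \<le> 9 * (2 * D + 9)"
        using qg_lower[OF qw i2(1), of] by simp
      then have "N' \<le> i2 + L" using L by linarith
      obtain k q where q: "q 0 = w i2" "q k = b" "rgeo k q" by (rule roughE)
      let ?v = "\<lambda>j. if j \<le> i2 then w j else q (j - i2)"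
      have qv: "qg (3 * 9) (i2 + k) ?v"
        using i2 by (intro qg_append_nearest[OF qw _ _ _ q(3,1,2)]) auto
      have "real L \<le> real i" using iL(1) by simp
      then have "real i1 \<le> real i" using i1D L D by argo
      then have "i1 \<le> i" by simp
      then have le: "m + (i - i1) \<le> i2" using \<open>N' \<le> i2 + L\<close> iL i1 \<open>i1 \<le> i\<close> by (simp add: N'_def)
      then have "?v (m + (i - i1)) = \<gamma> i" using w\<gamma>[of i] iL \<open>i1 \<le> i\<close> by simp
      moreover have "near R (?v (m + (i - i1))) A"
      proof (rule N[OF A, where n = "i2 + k" and x = ?v])
        show "qg 27 (i2 + k) ?v" using qv by simp
        show "near 27 (?v 0) A" using near_self[OF a(1)] w0 by simp
        show "near 27 (?v (i2 + k)) A" using near_self[OF b(1)] q by (cases k) auto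
      qed (use le in simp)
      ultimately show ?thesis by simp
    qed
    then show "\<exists>L. \<forall>A\<in>\<A>. \<forall>n \<gamma> i. rgeo n \<gamma> \<and> near D (\<gamma> 0) A \<and> near D (\<gamma> n) A \<and>
     L \<le> i \<and> i + L \<le> n \<longrightarrow> near R (\<gamma> i) A" by blast
  qed
qed

text \<open>If all the many members near \<open>x\<close> were also near a far point \<open>y\<close>, they would all be near a
  midpoint of \<open>x\<close> and \<open>y\<close> with a uniform constant, contradicting local finiteness.\<close>

lemma morse_family_separates:
  assumes mf: "morse_family \<A>"
    and fin: "\<And>R. \<exists>m. \<forall>x. finite {A\<in>\<A>. near R x A} \<and> card {A\<in>\<A>. near R x A} \<le> m"
    and rich: "\<And>m. \<exists>N. \<forall>x. m \<le> card {A\<in>\<A>. near N x A}"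
  shows "\<exists>N. \<forall>D. \<exists>B. \<forall>x y. (\<forall>A\<in>\<A>. near N x A \<longrightarrow> near D y A) \<longrightarrow> d x y \<le> B"
proof -
  obtain R where R: "0 \<le> R" and mid: "\<And>D. 0 \<le> D \<Longrightarrow> \<exists>L. \<forall>A\<in>\<A>. \<forall>n \<gamma> i. rgeo n \<gamma> \<and> near D (\<gamma> 0) A \<and> near D (\<gamma> n) A \<and>
     L \<le> i \<and> i + L \<le> n \<longrightarrow> near R (\<gamma> i) A" using morse_middle[OF mf] by blast
  obtain m where m: "\<And>x. finite {A\<in>\<A>. near R x A}" "\<And>x. card {A\<in>\<A>. near R x A} \<le> m" using fin[of R] by blast
  obtain N where N: "\<And>x. Suc m \<le> card {A\<in>\<A>. near N x A}" using rich[of "Suc m"] by blast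
  show ?thesis
  proof (rule exI[of _ N], rule allI)
    fix D :: real
    define D' where "D' = max 0 (max D N)"
    have "0 \<le> D'" by (simp add: D'_def)
    from mid[OF this] obtain L where L': "\<forall>A\<in>\<A>. \<forall>n \<gamma> i. rgeo n \<gamma> \<and> near D' (\<gamma> 0) A \<and> near D' (\<gamma> n) A \<and>
      L \<le> i \<and> i + L \<le> n \<longrightarrow> near R (\<gamma> i) A" by blast
    then have L: "near R (\<gamma> i) A" if "A \<in> \<A>" "rgeo n \<gamma>" "near D' (\<gamma> 0) A" "near D' (\<gamma> n) A" "L \<le> i" "i + L \<le> n"
      for A n \<gamma> i using that by blast
    show "\<exists>B. \<forall>x y. (\<forall>A\<in>\<A>. near N x A \<longrightarrow> near D y A) \<longrightarrow> d x y \<le> B"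
    \<comment> \<open>If \<open>x\<close> and \<open>y\<close> are farther apart than this, a rough
      geodesic between them has at least \<open>2 * L\<close> steps, and its index \<open>L\<close>
      is far enough from both ends.\<close>
    proof (intro exI[of _ "2 * real L + 3"] allI impI, rule ccontr)
      fix x y assume h: "\<forall>A\<in>\<A>. near N x A \<longrightarrow> near D y A" and far: "\<not> d x y \<le> 2 * real L + 3"
      obtain n \<gamma> where \<gamma>: "\<gamma> 0 = x" "\<gamma> n = y" "rgeo n \<gamma>" "\<bar>d x y - real n\<bar> \<le> 3" by (rule roughE)
      have nL: "L + L \<le> n" using \<gamma>(4) far by linarith
      have "near R (\<gamma> L) A" if "A \<in> \<A>" "near N x A" for A
        using L[OF that(1) \<gamma>(3), of L] near_mono[OF that(2), of D'] near_mono[of D y A D'] h that nL \<gamma>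
        by (simp add: D'_def)
      then have "{A\<in>\<A>. near N x A} \<subseteq> {A\<in>\<A>. near R (\<gamma> L) A}" by blast
      then have "card {A\<in>\<A>. near N x A} \<le> card {A\<in>\<A>. near R (\<gamma> L) A}" using m(1) by (rule card_mono[rotated])
      then show False using N[of x] m(2)[of "\<gamma> L"] by simp
    qed
  qed
qed

end

section \<open>Pattern spaces\<close>

text \<open>What the construction of the quasi-isometry uses, without any group action. Members near
  a given point are finitely many, as Helly requires, and sufficiently many for separation.\<close>

locale pattern_space = rough_geodesic +
  fixes \<A> :: "'a set set"
  assumes morse: "morse_family \<A>"
    and nonempty: "A \<in> \<A> \<Longrightarrow> A \<noteq> {}"
    and locally_finite: "\<exists>m. \<forall>x. finite {A\<in>\<A>. near R x A} \<and> card {A\<in>\<A>. near R x A} \<le> m"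
    and rich: "\<exists>N. \<forall>x. m \<le> card {A\<in>\<A>. near N x A}"
begin

lemma hellyE:
  obtains D where "\<forall>\<F>\<subseteq>\<A>. finite \<F> \<longrightarrow> (\<forall>A\<in>\<F>. \<forall>B\<in>\<F>. close r A B) \<longrightarrow> (\<exists>p. \<forall>A\<in>\<F>. near D p A)"
proof -
  have "\<exists>D\<ge>0. \<forall>\<F>\<subseteq>\<A>. finite \<F> \<and> (\<forall>A\<in>\<F>. \<forall>B\<in>\<F>. close r A B) \<longrightarrow> (\<exists>p. \<forall>A\<in>\<F>. near D p A)"
    by (rule morse_helly[OF morse nonempty])
  then obtain D where D: "\<forall>\<F>\<subseteq>\<A>. finite \<F> \<and> (\<forall>A\<in>\<F>. \<forall>B\<in>\<F>. close r A B) \<longrightarrow> (\<exists>p. \<forall>A\<in>\<F>. near D p A)"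
    by (elim exE conjE)
  show ?thesis
    by (rule that[of D]) (use D in simp)
qed

lemma separates: "\<exists>N. \<forall>D. \<exists>B. \<forall>x y. (\<forall>A\<in>\<A>. near N x A \<longrightarrow> near D y A) \<longrightarrow> d x y \<le> B"
  using morse_family_separates[OF morse locally_finite rich] .

end

text \<open>Consecutive points of a rough geodesic are at distance at most \<open>1 + 3 = 4\<close>;
  summing over the steps turns a bound at scale \<open>4\<close> into a linear one.\<close>

lemma (in rough_geodesic) coarse_Lipschitz_linear:
  assumes "pmetric d'" and step: "\<And>x y. d x y \<le> 4 \<Longrightarrow> d' (f x) (f y) \<le> C"
  shows "d' (f x) (f y) \<le> C * (d x y + 3)"
proof -
  interpret d': pmetric d' by fact
  have C: "0 \<le> C" using step[of x x] d'.d_nonneg[of "f x" "f x"] by simp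
  obtain n p where p: "p 0 = x" "p n = y" "rgeo n p" "\<bar>d x y - real n\<bar> \<le> 3" by (rule roughE)
  have "d' (f (p 0)) (f (p i)) \<le> C * real i" if "i \<le> n" for i
    using that
  proof (induction i)
    case (Suc i)
    have "d' (f (p i)) (f (p (Suc i))) \<le> C"
      using rgeoD[OF p(3), of i "Suc i"] Suc.prems by (intro step) auto
    then show ?case using Suc d'.d_tri[of "f (p 0)" "f (p (Suc i))" "f (p i)"] by (simp add: algebra_simps)
  qed simp
  from this[of n] have "d' (f x) (f y) \<le> C * real n" using p by simp
  also have "\<dots> \<le> C * (d x y + 3)" using p(4) C by (intro mult_left_mono) auto
  finally show ?thesis .
qed

locale pattern_pair = P1: pattern_space d1 \<A>1 + P2: pattern_space d2 \<A>2
  for d1 :: "'p \<Rightarrow> 'p \<Rightarrow> real" and \<A>1 and d2 :: "'q \<Rightarrow> 'q \<Rightarrow> real" and \<A>2 +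
  fixes \<phi> :: "'p set \<Rightarrow> 'q set"
  assumes bij: "bij_betw \<phi> \<A>1 \<A>2"
    and proper: "\<exists>m. \<forall>J\<in>\<A>1. \<forall>K\<in>\<A>1. P1.close n J K \<longrightarrow> P2.close m (\<phi> J) (\<phi> K)"
    and proper_inv: "\<exists>m. \<forall>J\<in>\<A>1. \<forall>K\<in>\<A>1. P2.close n (\<phi> J) (\<phi> K) \<longrightarrow> P1.close m J K"
begin

definition pairing :: "('p \<Rightarrow> 'q) \<Rightarrow> bool"
  where "pairing q \<longleftrightarrow> (\<forall>n. \<exists>h. \<forall>p. \<forall>J\<in>\<A>1. P1.near n p J \<longrightarrow> P2.near h (q p) (\<phi> J))"

text \<open>Members near \<open>p\<close> are pairwise close through \<open>p\<close>, hence so are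
  their images, and Helly in the target applies to these finitely many sets. The map still depends
  on the radius \<open>n\<close>.\<close>

lemma ex_common_point:
  "\<exists>D q. \<forall>p. \<forall>J\<in>\<A>1. P1.near n p J \<longrightarrow> P2.near D (q p) (\<phi> J)"
proof -
  obtain m where m: "\<And>J K. J \<in> \<A>1 \<Longrightarrow> K \<in> \<A>1 \<Longrightarrow> P1.close (n + n) J K \<Longrightarrow> P2.close m (\<phi> J) (\<phi> K)"
    using proper[of "n + n"] by blast
  obtain D where D: "\<forall>\<F>\<subseteq>\<A>2. finite \<F> \<longrightarrow> (\<forall>A\<in>\<F>. \<forall>B\<in>\<F>. P2.close m A B) \<longrightarrow>
      (\<exists>p. \<forall>A\<in>\<F>. P2.near D p A)"
    by (rule P2.hellyE[where r = m])
  have "\<exists>y. \<forall>J\<in>\<A>1. P1.near n p J \<longrightarrow> P2.near D y (\<phi> J)" for p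
  proof -
    have "finite {A\<in>\<A>1. P1.near n p A}" using P1.locally_finite[of n] by blast
    moreover have "\<phi> ` {A\<in>\<A>1. P1.near n p A} \<subseteq> \<A>2" using bij unfolding bij_betw_def by blast
    moreover have "P2.close m A B" if "A \<in> \<phi> ` {A\<in>\<A>1. P1.near n p A}" "B \<in> \<phi> ` {A\<in>\<A>1. P1.near n p A}" for A B
      using that m P1.near_near_close by blast
    ultimately obtain y where "\<forall>A\<in>\<phi> ` {A\<in>\<A>1. P1.near n p A}. P2.near D y A"
      using D[rule_format, of "\<phi> ` {A\<in>\<A>1. P1.near n p A}"] by (meson finite_imageI)
    then show ?thesis by blast
  qed
  then show ?thesis by meson
qed

text \<open>The map for the separation radius \<open>N1\<close> serves all radii: a map for a larger
  radius stays near all sets seen from \<open>q p\<close>, so separation in the target puts the two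
  maps at bounded distance.\<close>

lemma ex_pairing: "\<exists>q. pairing q"
proof -
  obtain N1 where N1: "\<And>D. \<exists>B. \<forall>x y. (\<forall>A\<in>\<A>1. P1.near N1 x A \<longrightarrow> P1.near D y A) \<longrightarrow> d1 x y \<le> B"
    using P1.separates by blast
  obtain N2 where N2: "\<And>D. \<exists>B. \<forall>x y. (\<forall>A\<in>\<A>2. P2.near N2 x A \<longrightarrow> P2.near D y A) \<longrightarrow> d2 x y \<le> B"
    using P2.separates by blast
  obtain D0 q where q: "\<And>p J. J \<in> \<A>1 \<Longrightarrow> P1.near N1 p J \<Longrightarrow> P2.near D0 (q p) (\<phi> J)"
    using ex_common_point[of N1] by blast
  \<comment> \<open>The converse estimate. A set \<open>J\<close> whose image is near
    \<open>q p\<close> is close to all members near \<open>p\<close>; Helly gives a point near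
    \<open>J\<close> and near these members, and separation puts this point near
    \<open>p\<close>.\<close>
  have "\<exists>N3. \<forall>p. \<forall>J\<in>\<A>1. P2.near N2 (q p) (\<phi> J) \<longrightarrow> P1.near N3 p J"
  proof -
    obtain m where m: "\<And>J K. J \<in> \<A>1 \<Longrightarrow> K \<in> \<A>1 \<Longrightarrow> P2.close (N2 + D0) (\<phi> J) (\<phi> K) \<Longrightarrow> P1.close m J K"
      using proper_inv[of "N2 + D0"] by blast
    \<comment> \<open>\<open>m\<close> is for pairs that contain \<open>J\<close>,
      \<open>N1 + N1\<close> for two members near \<open>p\<close>, and \<open>0\<close> for
      \<open>J\<close> with itself.\<close>
    define r where "r = max 0 (max m (N1 + N1))"
    have mono: "P1.close s A B \<Longrightarrow> s \<le> r \<Longrightarrow> P1.close r A B" for s A B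
      unfolding P1.close_def using order_trans by blast
    obtain D1 where D1: "\<forall>\<F>\<subseteq>\<A>1. finite \<F> \<longrightarrow> (\<forall>A\<in>\<F>. \<forall>B\<in>\<F>. P1.close r A B) \<longrightarrow>
        (\<exists>p. \<forall>A\<in>\<F>. P1.near D1 p A)"
      by (rule P1.hellyE[where r = r])
    obtain B where B: "\<And>x y. (\<forall>A\<in>\<A>1. P1.near N1 x A \<longrightarrow> P1.near D1 y A) \<Longrightarrow> d1 x y \<le> B"
      using N1[of D1] by blast
    have "P1.near (D1 + B) p J" if J: "J \<in> \<A>1" and n: "P2.near N2 (q p) (\<phi> J)" for p J
    proof -
      define \<F> where "\<F> = insert J {A\<in>\<A>1. P1.near N1 p A}"
      have JA: "P1.close r J A" if "A \<in> \<A>1" "P1.near N1 p A" for A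
      proof (rule mono)
        show "P1.close m J A" using m[OF J that(1)] P2.near_near_close[OF n q[OF that]] by blast
      qed (simp add: r_def)
      have "P1.close r A B" if AB: "A \<in> \<F>" "B \<in> \<F>" for A B
      proof -
        from AB consider "A = J" "B = J" | "A = J" "B \<in> \<A>1" "P1.near N1 p B"
          | "B = J" "A \<in> \<A>1" "P1.near N1 p A" | "P1.near N1 p A" "P1.near N1 p B"
          unfolding \<F>_def by blast
        then show "P1.close r A B"
        proof cases
          case 1
          obtain x where "x \<in> J" using P1.nonempty[OF J] by blast
          then have "P1.close 0 J J" unfolding P1.close_def using P1.d_refl[of x] by (intro bexI[of _ x]) simp_all
          then show ?thesis using mono 1 by (simp add: r_def)
        next
          case 2
          then show ?thesis using JA by simp
        next
          case 3
          then show ?thesis using P1.close_sym[OF JA] by simp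
        next
          case 4
          from P1.near_near_close[OF this] show ?thesis by (rule mono) (simp add: r_def)
        qed
      qed
      moreover have "finite \<F>" "\<F> \<subseteq> \<A>1" using P1.locally_finite[of N1] J by (auto simp: \<F>_def)
      ultimately obtain p' where p': "\<forall>A\<in>\<F>. P1.near D1 p' A" using D1[rule_format, of \<F>] by meson
      then have "d1 p p' \<le> B" by (intro B) (auto simp: \<F>_def)
      moreover have "P1.near D1 p' J" using p' by (simp add: \<F>_def)
      ultimately show ?thesis using P1.near_trans by blast
    qed
    then show ?thesis by blast
  qed
  then obtain N3 where N3: "\<And>p J. J \<in> \<A>1 \<Longrightarrow> P2.near N2 (q p) (\<phi> J) \<Longrightarrow> P1.near N3 p J" by blast
  have "\<exists>h. \<forall>p. \<forall>J\<in>\<A>1. P1.near n p J \<longrightarrow> P2.near h (q p) (\<phi> J)" for n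
  proof -
    \<comment> \<open>\<open>N3\<close> is included so that every set within \<open>N2\<close> of
      \<open>q p\<close> is among those that the comparison map \<open>y\<close> respects.\<close>
    define n' where "n' = max n N3"
    obtain D y where y: "\<And>p J. J \<in> \<A>1 \<Longrightarrow> P1.near n' p J \<Longrightarrow> P2.near D (y p) (\<phi> J)"
      using ex_common_point[of n'] by blast
    obtain B where B: "\<And>x y. (\<forall>A\<in>\<A>2. P2.near N2 x A \<longrightarrow> P2.near D y A) \<Longrightarrow> d2 x y \<le> B"
      using N2[of D] by blast
    have "d2 (q p) (y p) \<le> B" for p
    proof (rule B, intro ballI impI)
      fix K assume K: "K \<in> \<A>2" "P2.near N2 (q p) K"
      then obtain J where J: "J \<in> \<A>1" "K = \<phi> J" using bij unfolding bij_betw_def by blast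
      then have "P1.near n' p J" using N3[of J p] K P1.near_mono by (auto simp: n'_def)
      then show "P2.near D (y p) K" using y J by simp
    qed
    moreover have "P2.near D (y p) (\<phi> J)" if "J \<in> \<A>1" "P1.near n p J" for p J
      using y[OF that(1)] P1.near_mono[OF that(2)] by (simp add: n'_def)
    ultimately have "P2.near (D + B) (q p) (\<phi> J)" if "J \<in> \<A>1" "P1.near n p J" for p J
      using that P2.near_trans by blast
    then show ?thesis by blast
  qed
  then show ?thesis unfolding pairing_def by blast
qed

lemma inverse: "pattern_pair d2 \<A>2 d1 \<A>1 (inv_into \<A>1 \<phi>)"
proof
  have 1: "inv_into \<A>1 \<phi> J \<in> \<A>1" "\<phi> (inv_into \<A>1 \<phi> J) = J" if "J \<in> \<A>2" for J
    using that bij unfolding bij_betw_def by (auto intro: inv_into_into f_inv_into_f)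
  show "bij_betw (inv_into \<A>1 \<phi>) \<A>2 \<A>1" by (rule bij_betw_inv_into[OF bij])
  fix n
  show "\<exists>m. \<forall>J\<in>\<A>2. \<forall>K\<in>\<A>2. P2.close n J K \<longrightarrow> P1.close m (inv_into \<A>1 \<phi> J) (inv_into \<A>1 \<phi> K)"
    using proper_inv[of n] 1 by metis
  show "\<exists>m. \<forall>J\<in>\<A>2. \<forall>K\<in>\<A>2. P1.close n (inv_into \<A>1 \<phi> J) (inv_into \<A>1 \<phi> K) \<longrightarrow> P2.close m J K"
    using proper[of n] 1 by metis
qed

text \<open>Every member near \<open>p\<close> is also near \<open>q' (q p)\<close>, as
  \<open>q\<close> and \<open>q'\<close> follow it to its image and back; separation then bounds the
  distance.\<close>

lemma pairing_quasi_inverse: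
  assumes q: "pairing q" and q': "pattern_pair.pairing d2 \<A>2 d1 (inv_into \<A>1 \<phi>) q'"
  shows "\<exists>B. \<forall>p. d1 p (q' (q p)) \<le> B"
proof -
  interpret I: pattern_pair d2 \<A>2 d1 \<A>1 "inv_into \<A>1 \<phi>" by (rule inverse)
  obtain N1 where N1: "\<And>D. \<exists>B. \<forall>x y. (\<forall>A\<in>\<A>1. P1.near N1 x A \<longrightarrow> P1.near D y A) \<longrightarrow> d1 x y \<le> B"
    using P1.separates by blast
  obtain h where h: "\<And>p J. J \<in> \<A>1 \<Longrightarrow> P1.near N1 p J \<Longrightarrow> P2.near h (q p) (\<phi> J)"
    using q unfolding pairing_def by blast
  obtain h' where h': "\<And>p J. J \<in> \<A>2 \<Longrightarrow> P2.near h p J \<Longrightarrow> P1.near h' (q' p) (inv_into \<A>1 \<phi> J)"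
    using q' unfolding I.pairing_def by blast
  obtain B where B: "\<And>x y. (\<forall>A\<in>\<A>1. P1.near N1 x A \<longrightarrow> P1.near h' y A) \<Longrightarrow> d1 x y \<le> B"
    using N1[of h'] by blast
  have "d1 p (q' (q p)) \<le> B" for p
  proof (rule B, intro ballI impI)
    fix A assume A: "A \<in> \<A>1" "P1.near N1 p A"
    have "\<phi> A \<in> \<A>2" "inv_into \<A>1 \<phi> (\<phi> A) = A" using A bij unfolding bij_betw_def by auto
    then show "P1.near h' (q' (q p)) A" using h'[OF _ h[OF A]] by simp
  qed
  then show ?thesis by blast
qed

text \<open>A set near \<open>q x\<close> comes, through \<open>q'\<close>, from a member near
  \<open>q' (q x)\<close>, hence near \<open>x\<close> and \<open>y\<close>. So the set is near
  \<open>q y\<close> as well, and separation in the target applies.\<close>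

lemma pairing_coarse_Lipschitz:
  assumes q: "pairing q" and q': "pattern_pair.pairing d2 \<A>2 d1 (inv_into \<A>1 \<phi>) q'"
  shows "\<exists>C. \<forall>x y. d1 x y \<le> n \<longrightarrow> d2 (q x) (q y) \<le> C"
proof -
  interpret I: pattern_pair d2 \<A>2 d1 \<A>1 "inv_into \<A>1 \<phi>" by (rule inverse)
  obtain N2 where N2: "\<And>D. \<exists>B. \<forall>x y. (\<forall>A\<in>\<A>2. P2.near N2 x A \<longrightarrow> P2.near D y A) \<longrightarrow> d2 x y \<le> B"
    using P2.separates by blast
  obtain B where B: "\<And>p. d1 p (q' (q p)) \<le> B" using pairing_quasi_inverse[OF q q'] by blast
  obtain h' where h': "\<And>p J. J \<in> \<A>2 \<Longrightarrow> P2.near N2 p J \<Longrightarrow> P1.near h' (q' p) (inv_into \<A>1 \<phi> J)"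
    using q' unfolding I.pairing_def by blast
  obtain h where h: "\<And>p J. J \<in> \<A>1 \<Longrightarrow> P1.near (h' + B + n) p J \<Longrightarrow> P2.near h (q p) (\<phi> J)"
    using q unfolding pairing_def by blast
  obtain C where C: "\<And>x y. (\<forall>A\<in>\<A>2. P2.near N2 x A \<longrightarrow> P2.near h y A) \<Longrightarrow> d2 x y \<le> C"
    using N2[of h] by blast
  have "d2 (q x) (q y) \<le> C" if xy: "d1 x y \<le> n" for x y
  proof (rule C, intro ballI impI)
    fix A assume A: "A \<in> \<A>2" "P2.near N2 (q x) A"
    define J where "J = inv_into \<A>1 \<phi> A"
    have J: "J \<in> \<A>1" "\<phi> J = A" using A bij unfolding J_def bij_betw_def
      by (auto intro: inv_into_into f_inv_into_f)
    have "P1.near h' (q' (q x)) J" using h'[OF A] by (simp add: J_def)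
    then have "P1.near (h' + B) x J" using P1.near_trans B by blast
    then have "P1.near (h' + B + n) y J" using P1.near_trans xy P1.d_sym[of x y] by metis
    then show "P2.near h (q y) A" using h[OF J(1)] J(2) by simp
  qed
  then show ?thesis by blast
qed

theorem ex_pairing_quasi_isometry:
  "\<exists>q K e C. pairing q \<and> 1 \<le> K \<and> 0 \<le> e \<and>
     (\<forall>x y. d1 x y / K - e \<le> d2 (q x) (q y) \<and> d2 (q x) (q y) \<le> K * d1 x y + e) \<and>
     (\<forall>y. \<exists>x. d2 (q x) y \<le> C)"
proof -
  interpret I: pattern_pair d2 \<A>2 d1 \<A>1 "inv_into \<A>1 \<phi>" by (rule inverse)
  obtain q where q: "pairing q" using ex_pairing by blast
  obtain q' where q': "I.pairing q'" using I.ex_pairing by blast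
  \<comment> \<open>The inverse of the inverse agrees with \<open>\<phi>\<close> on
    \<open>\<A>1\<close>, which is where \<open>pairing\<close> evaluates it; this makes the roles
    of \<open>q\<close> and \<open>q'\<close> symmetric.\<close>
  have "inv_into \<A>2 (inv_into \<A>1 \<phi>) J = \<phi> J" if "J \<in> \<A>1" for J
    using inv_into_inv_into_eq[OF bij that] .
  then have q2: "pattern_pair.pairing d1 \<A>1 d2 (inv_into \<A>2 (inv_into \<A>1 \<phi>)) q"
    using q unfolding pairing_def pattern_pair.pairing_def[OF I.inverse] by simp
  obtain B where B: "\<And>p. d1 p (q' (q p)) \<le> B" using pairing_quasi_inverse[OF q q'] by blast
  obtain C where C: "\<And>p. d2 p (q (q' p)) \<le> C" using I.pairing_quasi_inverse[OF q' q2] by blast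
  obtain L where L: "\<And>x y. d1 x y \<le> 4 \<Longrightarrow> d2 (q x) (q y) \<le> L"
    using pairing_coarse_Lipschitz[OF q q', of 4] by blast
  obtain L' where L': "\<And>x y. d2 x y \<le> 4 \<Longrightarrow> d1 (q' x) (q' y) \<le> L'"
    using I.pairing_coarse_Lipschitz[OF q' q2, of 4] by blast
  define K where "K = max 1 (max L L')"
  have K: "1 \<le> K" "L \<le> K" "L' \<le> K" by (auto simp: K_def)
  have B0: "0 \<le> B" using B[of undefined] P1.d_nonneg[of undefined "q' (q undefined)"] by linarith
  \<comment> \<open>\<open>3 * K\<close> is the error in \<open>coarse_Lipschitz_linear\<close>,
    \<open>2 * B\<close> that of replacing \<open>x\<close> and \<open>y\<close> by
    \<open>q' (q x)\<close> and \<open>q' (q y)\<close>.\<close>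
  define e where "e = 3 * K + 2 * B"
  have e: "0 \<le> e" using K B0 by (simp add: e_def)
  have up: "d2 (q x) (q y) \<le> K * d1 x y + e" for x y
  proof -
    have "d2 (q x) (q y) \<le> K * (d1 x y + 3)"
      using P1.coarse_Lipschitz_linear[OF P2.pmetric_axioms, of q K x y] L K by force
    then show ?thesis using B0 by (simp add: e_def algebra_simps)
  qed
  have lo: "d1 x y / K - e \<le> d2 (q x) (q y)" for x y
  proof -
    have "d1 (q' (q x)) (q' (q y)) \<le> K * (d2 (q x) (q y) + 3)"
      using P2.coarse_Lipschitz_linear[OF P1.pmetric_axioms, of q' K "q x" "q y"] L' K by force
    moreover have "d1 x y \<le> d1 (q' (q x)) (q' (q y)) + 2 * B"
      using P1.d_tri[of x y "q' (q x)"] P1.d_tri[of "q' (q x)" y "q' (q y)"] B[of x] B[of y]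
        P1.d_sym[of y "q' (q y)"] by linarith
    ultimately have *: "d1 x y \<le> K * (d2 (q x) (q y) + 3) + 2 * B" by linarith
    also have "\<dots> \<le> K * (d2 (q x) (q y) + 3) + K * (2 * B)"
      using mult_right_mono[of 1 K "2 * B"] K B0 by simp
    also have "\<dots> \<le> K * (d2 (q x) (q y) + e)"
      unfolding distrib_left[symmetric] using K by (intro mult_left_mono) (auto simp: e_def)
    finally have "d1 x y / K \<le> d2 (q x) (q y) + e" using K by (simp add: divide_le_eq mult.commute)
    then show ?thesis by simp
  qed
  have "\<exists>x. d2 (q x) y \<le> C" for y using C[of y] P2.d_sym by metis
  then show ?thesis using q K(1) e up lo by blast
qed

end

section \<open>The geometric realization of a graph\<close>

lemma nat_floor_bounds: "0 \<le> t \<Longrightarrow> real (nat \<lfloor>t\<rfloor>) \<le> t \<and> t < real (nat \<lfloor>t\<rfloor>) + 1"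
  by linarith

locale connected_graph =
  fixes V :: "'a set" and E :: "('a \<times> 'a) set" and b :: 'a
  assumes base [simp]: "b \<in> V"
    and edge_vertices: "(u, v) \<in> E \<Longrightarrow> u \<in> V \<and> v \<in> V"
    and edge_sym: "(u, v) \<in> E \<Longrightarrow> (v, u) \<in> E"
    and edge_irrefl: "(u, u) \<notin> E"
    and connected: "u \<in> V \<Longrightarrow> v \<in> V \<Longrightarrow> \<exists>n. (u, v) \<in> E ^^ n"
begin

abbreviation "ed \<equiv> edge_distance E"
abbreviation "M \<equiv> realization V E"
abbreviation "pm \<equiv> path_metric V E"

lemma ed_relpow: "u \<in> V \<Longrightarrow> v \<in> V \<Longrightarrow> (u, v) \<in> E ^^ ed u v"
  unfolding edge_distance_def using connected by (rule LeastI_ex)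

lemma ed_le: "(u, v) \<in> E ^^ n \<Longrightarrow> ed u v \<le> n"
  unfolding edge_distance_def by (rule Least_le)

lemma ed_refl [simp]: "ed u u = 0"
  using ed_le[of u u 0] by simp

lemma ed_tri: "u \<in> V \<Longrightarrow> v \<in> V \<Longrightarrow> w \<in> V \<Longrightarrow> ed u w \<le> ed u v + ed v w"
  using ed_relpow by (intro ed_le) (auto simp: relpow_add)

lemma ed_sym: assumes "u \<in> V" "v \<in> V" shows "ed u v = ed v u"
proof -
  have rev: "(y, x) \<in> E ^^ n" if "(x, y) \<in> E ^^ n" for x y n
    using that
  proof (induction n arbitrary: y)
    case (Suc n)
    from Suc.prems obtain z where "(x, z) \<in> E ^^ n" "(z, y) \<in> E" by (rule relpow_Suc_E)
    then show ?case using Suc.IH edge_sym relpow_Suc_I2 by metis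
  qed simp
  then have conv: "(x, y) \<in> E ^^ n \<longleftrightarrow> (y, x) \<in> E ^^ n" for x y n by blast
  show ?thesis unfolding edge_distance_def using conv by simp
qed

lemma ed_zero: "u \<in> V \<Longrightarrow> v \<in> V \<Longrightarrow> ed u v = 0 \<Longrightarrow> u = v"
  using ed_relpow[of u v] by simp

lemma ed_edge: assumes "(u, v) \<in> E" shows "ed u v = 1"
proof -
  have "ed u v \<le> 1" using ed_le[of u v 1] assms by simp
  moreover have "ed u v \<noteq> 0" using ed_zero[of u v] edge_vertices[OF assms] edge_irrefl assms by auto
  ultimately show ?thesis by simp
qed

lemma ed_one: "u \<in> V \<Longrightarrow> v \<in> V \<Longrightarrow> ed u v = 1 \<Longrightarrow> (u, v) \<in> E"
  using ed_relpow[of u v] by simp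

section \<open>Shortest paths between vertices\<close>

definition vgeo :: "nat \<Rightarrow> (nat \<Rightarrow> 'a) \<Rightarrow> bool"
  where "vgeo n p \<longleftrightarrow> (\<forall>i\<le>n. p i \<in> V) \<and> (\<forall>i j. i \<le> j \<and> j \<le> n \<longrightarrow> ed (p i) (p j) = j - i)"

text \<open>A shortcut between two vertices of the path would bring its ends closer than
  \<open>n\<close>.\<close>

lemma vgeoI:
  assumes e: "\<And>i. i < n \<Longrightarrow> (p i, p (Suc i)) \<in> E" and p0: "p 0 \<in> V" and n: "ed (p 0) (p n) = n"
  shows "vgeo n p"
proof -
  have V: "p i \<in> V" if "i \<le> n" for i using that e edge_vertices p0 by (cases i) (auto simp: less_eq_Suc_le)
  have up: "ed (p i) (p (i + k)) \<le> k" if "i + k \<le> n" for i k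
  proof -
    have "(p i, p (i + k)) \<in> E ^^ k"
      unfolding relpow_fun_conv using that e by (intro exI[of _ "\<lambda>j. p (i + j)"]) auto
    then show ?thesis by (rule ed_le)
  qed
  have "ed (p i) (p j) = j - i" if ij: "i \<le> j" "j \<le> n" for i j
  proof -
    have "n \<le> ed (p 0) (p i) + (ed (p i) (p j) + ed (p j) (p n))"
      using n ed_tri[of "p 0" "p i" "p n"] ed_tri[of "p i" "p j" "p n"] V ij by fastforce
    then show ?thesis using up[of 0 i] up[of i "j - i"] up[of j "n - j"] ij by simp
  qed
  then show ?thesis unfolding vgeo_def using V by blast
qed

lemma ex_vgeo: assumes "u \<in> V" "v \<in> V" shows "\<exists>p. p 0 = u \<and> p (ed u v) = v \<and> vgeo (ed u v) p"
proof -
  obtain p where p: "p 0 = u" "p (ed u v) = v" "\<forall>i<ed u v. (p i, p (Suc i)) \<in> E"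
    using ed_relpow[OF assms] unfolding relpow_fun_conv by blast
  then show ?thesis using assms by (intro exI[of _ p] conjI vgeoI) auto
qed

section \<open>The path metric on the realization\<close>

lemma in_simplices: "A \<in> simplices V E \<longleftrightarrow> (\<exists>u v. A = {u, v} \<and> (u, v) \<in> E) \<or> (\<exists>v\<in>V. A = {v})"
  unfolding simplices_def by blast

lemma supp_cases:
  assumes "x \<in> M"
  obtains v where "v \<in> V" "supp x = {v}" "x v = 1" "\<And>w. w \<noteq> v \<Longrightarrow> x w = 0"
  | u v where "(u, v) \<in> E" "u \<noteq> v" "supp x = {u, v}" "x u + x v = 1" "0 < x u" "0 < x v"
proof -
  have nn: "\<And>v. 0 \<le> x v" and s: "supp x \<in> simplices V E" and sum: "(\<Sum>v\<in>supp x. x v) = 1"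
    using assms unfolding realization_def by auto
  from s consider u v where "supp x = {u, v}" "(u, v) \<in> E" | v where "v \<in> V" "supp x = {v}"
    unfolding in_simplices by blast
  then show ?thesis
  proof cases
    case 1
    have "u \<noteq> v" using 1 edge_irrefl by auto
    moreover have "0 < x u" "0 < x v" using nn[of u] nn[of v] 1(1) unfolding supp_def by (force simp: less_le)+
    ultimately show ?thesis using 1 sum that(2)[of u v] by simp
  next
    case 2
    then have "w \<noteq> v \<Longrightarrow> x w = 0" for w unfolding supp_def by blast
    then show ?thesis using 2 sum that(1)[of v] by simp
  qed
qed

lemma supp_props:
  assumes "x \<in> M"
  shows "finite (supp x)" "supp x \<noteq> {}" "supp x \<subseteq> V" "0 \<le> x v" "x v \<le> 1"
proof -
  show "0 \<le> x v" using assms unfolding realization_def by auto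
  have "finite (supp x) \<and> supp x \<noteq> {} \<and> supp x \<subseteq> V \<and> x v \<le> 1"
    using assms
  proof (cases rule: supp_cases)
    case (1 u)
    then show ?thesis by (cases "v = u") auto
  next
    case (2 u w)
    have "v \<noteq> u \<Longrightarrow> v \<noteq> w \<Longrightarrow> x v = 0" using 2(3) unfolding supp_def by blast
    then show ?thesis
      using 2 edge_vertices by (cases "v = u"; cases "v = w") auto
  qed
  then show "finite (supp x)" "supp x \<noteq> {}" "supp x \<subseteq> V" "x v \<le> 1" by blast+
qed

text \<open>The coordinates of either point on the edge sum to one, so the two differences agree in
  absolute value and the halved sum equals one of them.\<close>

lemma pm_edge:
  assumes x: "x \<in> M" and y: "y \<in> M" and e: "(u, v) \<in> E" and s: "supp x \<union> supp y \<subseteq> {u, v}"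
  shows "pm x y = \<bar>x u - y u\<bar>"
proof -
  have uv: "u \<noteq> v" using e edge_irrefl by auto
  have sum: "z u + z v = 1" if "z \<in> M" "supp z \<subseteq> {u, v}" for z
    using that(1)
  proof (cases rule: supp_cases)
    case (1 w)
    then show ?thesis using that(2) uv by (cases "w = u") auto
  next
    case (2 w w')
    then have "{w, w'} = {u, v}" using that(2) uv by auto
    then show ?thesis using 2 by (auto simp: doubleton_eq_iff)
  qed
  have "supp x \<union> supp y = {u, v} \<or> supp x \<union> supp y = {u} \<or> supp x \<union> supp y = {v}"
    using s supp_props(2)[OF x] by blast
  then have "supp x \<union> supp y \<in> simplices V E" using e edge_vertices unfolding in_simplices by blast
  then have "pm x y = (\<Sum>w\<in>supp x \<union> supp y. \<bar>x w - y w\<bar>) / 2" unfolding path_metric_def by simp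
  also have "(\<Sum>w\<in>supp x \<union> supp y. \<bar>x w - y w\<bar>) = (\<Sum>w\<in>{u, v}. \<bar>x w - y w\<bar>)"
    using s by (intro sum.mono_neutral_left) (auto simp: supp_def)
  also have "\<dots> = 2 * \<bar>x u - y u\<bar>" using uv sum[OF x] sum[OF y] s by (auto simp: abs_if)
  finally show ?thesis by simp
qed

abbreviation same :: "('a \<Rightarrow> real) \<Rightarrow> ('a \<Rightarrow> real) \<Rightarrow> bool"
  where "same x y \<equiv> supp x \<union> supp y \<in> simplices V E"

lemma same_cases:
  assumes x: "x \<in> M" and y: "y \<in> M" and s: "same x y"
  obtains "x = y" | u v where "(u, v) \<in> E" "supp x \<union> supp y = {u, v}"
proof -
  from s consider u v where "supp x \<union> supp y = {u, v}" "(u, v) \<in> E" | v where "supp x \<union> supp y = {v}"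
    unfolding in_simplices by blast
  then show thesis
  proof cases
    case (2 v)
    have *: "z v = 1 \<and> (\<forall>w. w \<noteq> v \<longrightarrow> z w = 0)" if "z \<in> M" "supp z \<subseteq> {v}" for z
      using that(1) by (cases rule: supp_cases) (use that(2) in auto)
    have "supp x \<subseteq> {v}" "supp y \<subseteq> {v}" using 2 by blast+
    then have "x w = y w" for w using *[OF x] *[OF y] by (cases "w = v") auto
    then show thesis using that(1) by blast
  qed (use that(2) in blast)
qed

lemma pm_refl: assumes "x \<in> M" shows "pm x x = 0"
  using assms unfolding path_metric_def realization_def by simp

lemma pm_same_ge: assumes x: "x \<in> M" and y: "y \<in> M" and s: "same x y" shows "\<bar>x v - y v\<bar> \<le> pm x y"
  using assms
proof (cases rule: same_cases)
  case 1
  then show ?thesis using pm_refl y by simp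
next
  case (2 u w)
  consider "v = u" | "v = w" | "x v = 0" "y v = 0" using 2(2) unfolding supp_def by blast
  then show ?thesis
  proof cases
    case 1
    then show ?thesis using pm_edge[OF x y 2(1)] 2(2) by simp
  next
    case c: 2
    then show ?thesis using pm_edge[OF x y edge_sym[OF 2(1)]] 2(2) by (simp add: insert_commute)
  next
    case 3
    then show ?thesis using pm_edge[OF x y 2(1)] 2(2) by simp
  qed
qed

abbreviation cost :: "('a \<Rightarrow> real) \<Rightarrow> ('a \<Rightarrow> real) \<Rightarrow> 'a \<Rightarrow> 'a \<Rightarrow> real"
  where "cost x y u v \<equiv> (1 - x u) + real (ed u v) + (1 - y v)"

text \<open>For points on a common edge this is not part of the definition of the path metric. It
  reduces upper bounds to exhibiting one exit at each end.\<close>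

lemma pm_le_cost:
  assumes x: "x \<in> M" and y: "y \<in> M" and u: "u \<in> supp x" and v: "v \<in> supp y"
  shows "pm x y \<le> cost x y u v"
proof (cases "same x y")
  case True
  have p01: "0 \<le> x w" "x w \<le> 1" "0 \<le> y w" "y w \<le> 1" for w using supp_props x y by blast+
  show ?thesis using x y True
  proof (cases rule: same_cases)
    case 1
    then show ?thesis using pm_refl[OF y] p01[of u] p01[of v] by simp
  next
    case (2 a c)
    have pa: "pm x y = \<bar>x a - y a\<bar>" using pm_edge[OF x y 2(1)] 2(2) by simp
    have pc: "pm x y = \<bar>x c - y c\<bar>"
      using pm_edge[OF x y edge_sym[OF 2(1)]] 2(2) by (simp add: insert_commute)
    have "u \<in> {a, c}" "v \<in> {a, c}" using u v 2 by blast+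
    show ?thesis
    proof (cases "u = v")
      case True
      have "pm x y = \<bar>x u - y u\<bar>" using \<open>u \<in> {a, c}\<close> pa pc by auto
      then show ?thesis using True p01[of u] by simp
    next
      case False
      have "ed u v = 1" using ed_edge[OF 2(1)] ed_edge[OF edge_sym[OF 2(1)]] False \<open>u \<in> {a, c}\<close> \<open>v \<in> {a, c}\<close> by auto
      moreover have "pm x y \<le> 1" unfolding pa using p01[of a] by simp
      ultimately show ?thesis using p01[of u] p01[of v] by simp
    qed
  qed
next
  case False
  have "finite ((\<lambda>(u, v). cost x y u v) ` (supp x \<times> supp y))" using supp_props(1) x y by blast
  moreover have "cost x y u v \<in> (\<lambda>(u, v). cost x y u v) ` (supp x \<times> supp y)" using u v by force
  ultimately show ?thesis using False unfolding path_metric_def by simp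
qed

lemma pm_eq_cost:
  assumes x: "x \<in> M" and y: "y \<in> M" and ns: "\<not> same x y"
  obtains u v where "u \<in> supp x" "v \<in> supp y" "pm x y = cost x y u v"
proof -
  let ?S = "(\<lambda>(u, v). cost x y u v) ` (supp x \<times> supp y)"
  have "finite ?S" "?S \<noteq> {}" using supp_props(1,2) x y by auto
  then have "Min ?S \<in> ?S" by (rule Min_in)
  then obtain u v where "u \<in> supp x" "v \<in> supp y" "Min ?S = cost x y u v" by auto
  then show ?thesis using that ns unfolding path_metric_def by simp
qed

lemma pm_sym: assumes x: "x \<in> M" and y: "y \<in> M" shows "pm x y = pm y x"
proof -
  have le: "pm y x \<le> pm x y" if x: "x \<in> M" and y: "y \<in> M" for x y
  proof (cases "same x y")
    case True
    then show ?thesis unfolding path_metric_def by (simp add: Un_commute abs_minus_commute)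
  next
    case False
    with x y obtain u v where uv: "u \<in> supp x" "v \<in> supp y" "pm x y = cost x y u v" by (rule pm_eq_cost)
    then have "ed u v = ed v u" using ed_sym supp_props(3) x y by blast
    then show ?thesis using pm_le_cost[OF y x uv(2,1)] uv(3) by simp
  qed
  show ?thesis using le[OF x y] le[OF y x] by simp
qed

text \<open>Either \<open>v\<close> also belongs to the support of \<open>x\<close>, or
  \<open>x\<close> is the opposite end of the edge; so a route leaving \<open>y\<close> through
  \<open>v\<close> can be started at \<open>x\<close> for an extra \<open>pm x y\<close>.\<close>

lemma same_exit:
  assumes x: "x \<in> M" and y: "y \<in> M" and s: "same x y" and v: "v \<in> supp y"
  shows "\<exists>u\<in>supp x. (1 - x u) + real (ed u v) \<le> pm x y + (1 - y v)"
proof (cases "v \<in> supp x")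
  case True
  then show ?thesis using pm_same_ge[OF x y s, of v] by (intro bexI[of _ v]) auto
next
  case False
  from x y s show ?thesis
  proof (cases rule: same_cases)
    case (2 a c)
    have "v = a \<or> v = c" using v 2(2) by blast
    then obtain u where uv: "(u, v) \<in> E" "{u, v} = {a, c}" using 2(1) edge_sym[OF 2(1)] by auto
    have "supp x \<subseteq> {u}" using False 2(2) uv(2) by blast
    then have su: "supp x = {u}" using supp_props(2)[OF x] by blast
    have "x u = 1"
      using x by (cases rule: supp_cases) (use su in \<open>auto simp: doubleton_eq_iff\<close>)
    moreover have "x v = 0" using False unfolding supp_def by blast
    moreover have "0 \<le> y v" using supp_props(4)[OF y] .
    ultimately show ?thesis using pm_same_ge[OF x y s, of v] ed_edge[OF uv(1)] su by simp
  qed (use v False in auto)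
qed

lemma pm_tri: assumes x: "x \<in> M" and y: "y \<in> M" and z: "z \<in> M" shows "pm x z \<le> pm x y + pm y z"
proof -
  have V: "supp x \<subseteq> V" "supp y \<subseteq> V" "supp z \<subseteq> V" using supp_props(3) x y z by blast+
  have link: "pm x z \<le> (1 - x u) + real (ed u v) + real (ed v w) + (1 - z w)"
    if "u \<in> supp x" "v \<in> V" "w \<in> supp z" for u v w
    using pm_le_cost[OF x z that(1,3)] ed_tri[of u v w] that V by force
  have tri': "pm x z \<le> pm x y + pm y z"
    if x: "x \<in> M" and z: "z \<in> M" and s: "same x y" and ns: "\<not> same y z" for x z
  proof -
    obtain v w where vw: "v \<in> supp y" "w \<in> supp z" "pm y z = cost y z v w" using pm_eq_cost[OF y z ns] .
    obtain u where u: "u \<in> supp x" "(1 - x u) + real (ed u v) \<le> pm x y + (1 - y v)"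
      using same_exit[OF x y s vw(1)] by blast
    have "ed u w \<le> ed u v + ed v w" using ed_tri u vw supp_props(3) x y z by blast
    then show ?thesis using pm_le_cost[OF x z u(1) vw(2)] u(2) vw(3) by simp
  qed
  consider "\<not> same x y" "\<not> same y z" | "same x y" "\<not> same y z" | "\<not> same x y" "same y z"
    | "same x y" "same y z" by blast
  then show ?thesis
  proof cases
    case 1
    obtain u v where uv: "u \<in> supp x" "v \<in> supp y" "pm x y = cost x y u v" using pm_eq_cost[OF x y 1(1)] .
    obtain v' w where vw: "v' \<in> supp y" "w \<in> supp z" "pm y z = cost y z v' w" using pm_eq_cost[OF y z 1(2)] .
    \<comment> \<open>If \<open>v\<close> and \<open>v'\<close> differ, they are the two ends of the
      edge of \<open>y\<close>, and the costs of leaving \<open>y\<close> through the one and the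
      other add up to one.\<close>
    have "real (ed v v') \<le> (1 - y v) + (1 - y v')"
      using y
    proof (cases rule: supp_cases)
      case (1 a)
      then show ?thesis using uv vw by simp
    next
      case (2 a c)
      have "ed v v' \<le> 1" if "v \<noteq> v'"
        using ed_edge[OF 2(1)] ed_edge[OF edge_sym[OF 2(1)]] uv(2) vw(1) 2(3) that by auto
      moreover have "y v + y v' = 1" if "v \<noteq> v'" using 2(3,4) uv(2) vw(1) that by auto
      moreover have "y v \<le> 1" using supp_props(5)[OF y] .
      ultimately show ?thesis by (cases "v = v'") (auto simp: of_nat_le_iff[of _ 1, where 'a = real, symmetric] simp del: of_nat_le_iff)
    qed
    moreover have "ed v w \<le> ed v v' + ed v' w" using ed_tri V uv vw by blast
    ultimately show ?thesis using link[OF uv(1) _ vw(2), of v] uv vw V by force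
  next
    case 2
    then show ?thesis using tri' x z by blast
  next
    case 3
    have "pm z x \<le> pm z y + pm y x"
      using 3 by (intro tri'[OF z x]) (simp_all add: Un_commute)
    then show ?thesis using pm_sym x y z by simp
  next
    case 4
    \<comment> \<open>If \<open>y\<close> is a vertex, both routes can be led through it. Otherwise
      \<open>y\<close> is interior to an edge, which then contains \<open>x\<close> and
      \<open>z\<close> as well.\<close>
    from y show ?thesis
    proof (cases rule: supp_cases)
      case (1 a)
      obtain u where u: "u \<in> supp x" "(1 - x u) + real (ed u a) \<le> pm x y + (1 - y a)"
        using same_exit[OF x y 4(1), of a] 1 by auto
      have "same z y" using 4(2) by (simp add: Un_commute)
      then obtain w where w: "w \<in> supp z" "(1 - z w) + real (ed w a) \<le> pm z y + (1 - y a)"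
        using same_exit[OF z y, of a] 1 by auto
      have "ed w a = ed a w" using ed_sym w V 1 by blast
      then show ?thesis using link[OF u(1) 1(1) w(1)] u(2) w(2) 1(3) pm_sym[OF y z] by simp
    next
      case (2 a c)
      have sub: "supp x' \<subseteq> {a, c}" if "same x' y" for x'
      proof -
        obtain p q where "supp x' \<union> supp y = {p, q}" using \<open>same x' y\<close> unfolding in_simplices by blast
        then have "{a, c} \<subseteq> {p, q}" "supp x' \<subseteq> {p, q}" using 2 by blast+
        then show ?thesis using 2(2) by auto
      qed
      have "supp x \<subseteq> {a, c}" "supp z \<subseteq> {a, c}" using sub 4 by (simp_all add: Un_commute)
      then show ?thesis using pm_edge[OF x y 2(1)] pm_edge[OF y z 2(1)] pm_edge[OF x z 2(1)] 2(3) by simp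
    qed
  qed
qed

text \<open>Points outside the realization are sent to the base vertex, so that \<open>tm\<close> is a pseudometric on
  the whole type and agrees with the path metric on the realization.\<close>

definition retr :: "('a \<Rightarrow> real) \<Rightarrow> ('a \<Rightarrow> real)"
  where "retr x = (if x \<in> M then x else vertex b)"

definition tm :: "('a \<Rightarrow> real) \<Rightarrow> ('a \<Rightarrow> real) \<Rightarrow> real"
  where "tm x y = pm (retr x) (retr y)"

lemma supp_vertex [simp]: "supp (vertex u) = {u}"
  by (auto simp: supp_def vertex_def)

lemma vertex_self [simp]: "vertex u u = 1"
  by (simp add: vertex_def)

lemma vertex_in_M [simp]: "u \<in> V \<Longrightarrow> vertex u \<in> M"
  unfolding realization_def by (auto simp: in_simplices) (simp add: vertex_def)

lemma retr_in_M [simp]: "retr x \<in> M"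
  by (simp add: retr_def)

lemma tm_eq: "x \<in> M \<Longrightarrow> y \<in> M \<Longrightarrow> tm x y = pm x y"
  by (simp add: tm_def retr_def)

lemma tm_retr [simp]: "tm x (retr y) = tm x y" "tm (retr x) y = tm x y"
  by (simp_all add: tm_def retr_def)

sublocale pmetric tm
  by unfold_locales (auto simp: tm_def pm_refl intro: pm_sym pm_tri)

lemma pm_vertex: assumes "u \<in> V" "v \<in> V" shows "pm (vertex u) (vertex v) = real (ed u v)"
proof (rule antisym)
  show "pm (vertex u) (vertex v) \<le> real (ed u v)"
    using pm_le_cost[of "vertex u" "vertex v" u v] assms by simp
  show "real (ed u v) \<le> pm (vertex u) (vertex v)"
  proof (cases "same (vertex u) (vertex v)")
    case True
    then consider "u = v" | "(u, v) \<in> E" "u \<noteq> v" using edge_sym unfolding in_simplices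
      by (auto simp: doubleton_eq_iff)
    then show ?thesis
    proof cases
      case 2
      have "pm (vertex u) (vertex v) = \<bar>vertex u u - vertex v u\<bar>"
        using assms 2 by (intro pm_edge) auto
      then show ?thesis using 2 ed_edge[OF 2(1)] by (simp add: vertex_def)
    qed (use pm_refl assms in simp)
  next
    case False
    with assms obtain u' v' where "u' \<in> supp (vertex u)" "v' \<in> supp (vertex v)"
      "pm (vertex u) (vertex v) = cost (vertex u) (vertex v) u' v'" using pm_eq_cost[of "vertex u" "vertex v"] by auto
    then show ?thesis by simp
  qed
qed

lemma tm_vertex: "u \<in> V \<Longrightarrow> v \<in> V \<Longrightarrow> tm (vertex u) (vertex v) = real (ed u v)"
  by (simp add: tm_eq pm_vertex)

lemma ex_near_vertex: "\<exists>u\<in>V. tm x (vertex u) \<le> 1"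
proof -
  obtain u where u: "u \<in> supp (retr x)" using supp_props(2)[OF retr_in_M] by blast
  then have uV: "u \<in> V" using supp_props(3)[OF retr_in_M] by blast
  have "pm (retr x) (vertex u) \<le> 1"
    using pm_le_cost[of "retr x" "vertex u" u u] u uV supp_props(4)[OF retr_in_M, of x u] by simp
  then have "tm x (vertex u) \<le> 1" using uV tm_eq[of "retr x" "vertex u"] by simp
  then show ?thesis using uV by blast
qed

lemma vgeo_tm:
  assumes "vgeo n p" "i \<le> n" "j \<le> n" shows "tm (vertex (p i)) (vertex (p j)) = \<bar>real i - real j\<bar>"
proof (cases "i \<le> j")
  case True
  then show ?thesis using assms tm_vertex[of "p i" "p j"] unfolding vgeo_def by (simp add: of_nat_diff)
next
  case False
  then show ?thesis using assms tm_vertex[of "p j" "p i"] d_sym[of "vertex (p i)" "vertex (p j)"]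
    unfolding vgeo_def by (simp add: of_nat_diff)
qed

sublocale rough_geodesic tm
proof
  fix x y
  obtain u where u: "u \<in> V" "tm x (vertex u) \<le> 1" using ex_near_vertex by blast
  obtain v where v: "v \<in> V" "tm y (vertex v) \<le> 1" using ex_near_vertex by blast
  define k where "k = ed u v"
  obtain w where w: "w 0 = u" "w k = v" "vgeo k w" using ex_vgeo[OF u(1) v(1)] unfolding k_def by blast
  \<comment> \<open>\<open>Suc k\<close> steps for \<open>k\<close> edges, so that \<open>x\<close>
    and \<open>y\<close> get different indices even if \<open>k\<close> is zero.\<close>
  define p where "p i = (if i = 0 then x else if i \<le> k then vertex (w i) else y)" for i
  define s where "s i = vertex (w (min i k))" for i
  have ps: "tm (p i) (s i) \<le> 1" if "i \<le> Suc k" for i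
    using that u(2) v(2) w by (auto simp: p_def s_def)
  have "\<bar>tm (p i) (p j) - (real j - real i)\<bar> \<le> 3" if ij: "i \<le> j" "j \<le> Suc k" for i j
  proof -
    have "\<bar>tm (s i) (s j) - (real j - real i)\<bar> \<le> 1"
      using vgeo_tm[OF w(3), of "min i k" "min j k"] ij unfolding s_def by (auto simp: min_def)
    moreover have "\<bar>tm (p i) (p j) - tm (s i) (s j)\<bar> \<le> 2"
      using ps[of i] ps[of j] ij d_tri[of "p i" "p j" "s i"] d_tri[of "s i" "p j" "s j"]
        d_tri[of "s i" "s j" "p i"] d_tri[of "p i" "s j" "p j"] d_sym[of "s i" "p i"] d_sym[of "s j" "p j"] by linarith
    ultimately show ?thesis by linarith
  qed
  then show "\<exists>n p. p 0 = x \<and> p n = y \<and> rgeo n p"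
    unfolding rgeo_def by (intro exI[of _ "Suc k"] exI[of _ p]) (auto simp: p_def)
qed

section \<open>Geodesics obtained from shortest vertex paths\<close>

definition edge_point :: "'a \<Rightarrow> 'a \<Rightarrow> real \<Rightarrow> 'a \<Rightarrow> real"
  where "edge_point u v t = (\<lambda>w. (1 - t) * vertex u w + t * vertex v w)"

lemma edge_point_0 [simp]: "edge_point u v 0 = vertex u" and edge_point_1 [simp]: "edge_point u v 1 = vertex v"
  by (simp_all add: edge_point_def)

lemma edge_point_in_M:
  assumes e: "(u, v) \<in> E" and t: "0 \<le> t" "t \<le> 1"
  shows "edge_point u v t \<in> M" "supp (edge_point u v t) \<subseteq> {u, v}"
proof -
  have uv: "u \<noteq> v" using e edge_irrefl by auto
  show s: "supp (edge_point u v t) \<subseteq> {u, v}" by (auto simp: edge_point_def supp_def vertex_def)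
  consider "t = 0" | "t = 1" | "0 < t" "t < 1" using t by linarith
  then show "edge_point u v t \<in> M"
  proof cases
    case 3
    have "supp (edge_point u v t) = {u, v}" using 3 uv by (auto simp: edge_point_def supp_def vertex_def)
    then show ?thesis using 3 uv e unfolding realization_def
      by (auto simp: in_simplices edge_point_def vertex_def)
  qed (use edge_vertices[OF e] in auto)
qed

lemma pm_edge_point:
  assumes e: "(u, v) \<in> E" and "0 \<le> s" "s \<le> 1" "0 \<le> t" "t \<le> 1"
  shows "pm (edge_point u v s) (edge_point u v t) = \<bar>s - t\<bar>"
proof -
  have "u \<noteq> v" using e edge_irrefl by auto
  moreover have "pm (edge_point u v s) (edge_point u v t) = \<bar>edge_point u v s u - edge_point u v t u\<bar>"
    using assms edge_point_in_M by (intro pm_edge[OF _ _ e]) auto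
  ultimately show ?thesis by (simp add: edge_point_def vertex_def)
qed

text \<open>At integer times the fractional part vanishes and the next vertex does not enter, so on
  \<open>{0..real n}\<close> nothing is demanded of \<open>p (Suc n)\<close>.\<close>

definition interp :: "(nat \<Rightarrow> 'a) \<Rightarrow> real \<Rightarrow> 'a \<Rightarrow> real"
  where "interp p t = edge_point (p (nat \<lfloor>t\<rfloor>)) (p (Suc (nat \<lfloor>t\<rfloor>))) (frac t)"

lemma interp_nat [simp]: "interp p (real i) = vertex (p i)"
  by (simp add: interp_def frac_def)

lemma vgeo_edge: "vgeo n p \<Longrightarrow> i < n \<Longrightarrow> (p i, p (Suc i)) \<in> E"
  unfolding vgeo_def by (intro ed_one) auto

text \<open>Upper bounds come from following the path. As the ends have distance \<open>n\<close>
  and the outer pieces have length at most \<open>s\<close> and \<open>n - t\<close>, the middle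
  piece cannot be shorter than \<open>t - s\<close>.\<close>

lemma interp_geodesic:
  assumes p: "vgeo n p"
  shows "\<And>t. 0 \<le> t \<Longrightarrow> t \<le> real n \<Longrightarrow> interp p t \<in> M"
    and "\<And>s t. 0 \<le> s \<Longrightarrow> s \<le> real n \<Longrightarrow> 0 \<le> t \<Longrightarrow> t \<le> real n \<Longrightarrow> pm (interp p s) (interp p t) = \<bar>s - t\<bar>"
proof -
  have V: "p i \<in> V" if "i \<le> n" for i
    using p[unfolded vgeo_def] that by (elim conjE) (erule allE, erule mp)
  have cell: "\<exists>i. i < n \<and> real i \<le> t \<and> t < real (Suc i) \<and> (p i, p (Suc i)) \<in> E \<and>
      interp p t = edge_point (p i) (p (Suc i)) (t - real i)" if t: "0 \<le> t" "t < real n" for t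
  proof -
    define i where "i = nat \<lfloor>t\<rfloor>"
    have ri: "real i = of_int \<lfloor>t\<rfloor>" using t by (simp add: i_def)
    then have 1: "real i \<le> t" "t < real (Suc i)" unfolding of_nat_Suc by linarith+
    then have "i < n" using t by simp
    moreover have "interp p t = edge_point (p i) (p (Suc i)) (t - real i)"
      unfolding interp_def i_def[symmetric] by (simp add: frac_def ri)
    ultimately show ?thesis using 1 vgeo_edge[OF p] by blast
  qed
  show M: "interp p t \<in> M" if t: "0 \<le> t" "t \<le> real n" for t
  proof (cases "t = real n")
    case False
    then obtain i where "real i \<le> t" "t < real (Suc i)" "(p i, p (Suc i)) \<in> E"
      "interp p t = edge_point (p i) (p (Suc i)) (t - real i)" using cell[of t] t by auto
    then show ?thesis using edge_point_in_M(1)[of "p i" "p (Suc i)" "t - real i"] by simp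
  qed (simp add: V)
  have step: "pm (interp p t) (vertex (p i)) = t - real i" "pm (interp p t) (vertex (p (Suc i))) = real (Suc i) - t"
    if "i < n" "real i \<le> t" "t < real (Suc i)" "(p i, p (Suc i)) \<in> E"
      "interp p t = edge_point (p i) (p (Suc i)) (t - real i)" for i t
    using pm_edge_point[OF that(4), of "t - real i" 0] pm_edge_point[OF that(4), of "t - real i" 1] that by simp_all
  have vv: "pm (vertex (p i)) (vertex (p j)) = \<bar>real i - real j\<bar>" if "i \<le> n" "j \<le> n" for i j
    using vgeo_tm[OF p that] tm_eq V that by simp
  have up0: "pm (vertex (p 0)) (interp p t) \<le> t" and upn: "pm (interp p t) (vertex (p n)) \<le> real n - t"
    if t: "0 \<le> t" "t \<le> real n" for t
  proof -
    have "pm (vertex (p 0)) (interp p t) \<le> t \<and> pm (interp p t) (vertex (p n)) \<le> real n - t"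
    proof (cases "t = real n")
      case True
      then show ?thesis using vv[of 0 n] pm_refl[of "vertex (p n)"] V by simp
    next
      case False
      then obtain i where i: "i < n" "real i \<le> t" "t < real (Suc i)" "(p i, p (Suc i)) \<in> E"
        "interp p t = edge_point (p i) (p (Suc i)) (t - real i)" using cell[of t] t by auto
      have "pm (vertex (p 0)) (interp p t) \<le> pm (vertex (p 0)) (vertex (p i)) + pm (vertex (p i)) (interp p t)"
        using pm_tri M[OF t] V i(1) by simp
      moreover have "pm (interp p t) (vertex (p n)) \<le> pm (interp p t) (vertex (p (Suc i))) + pm (vertex (p (Suc i))) (vertex (p n))"
        using pm_tri M[OF t] V i(1) by simp
      ultimately show ?thesis using step[OF i] vv[of 0 i] vv[of "Suc i" n] i(1) pm_sym[of "interp p t" "vertex (p i)"] M[OF t] V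
        by simp
    qed
    then show "pm (vertex (p 0)) (interp p t) \<le> t" "pm (interp p t) (vertex (p n)) \<le> real n - t" by blast+
  qed
  have ordered: "pm (interp p s) (interp p t) = t - s" if st: "0 \<le> s" "s \<le> t" "t \<le> real n" for s t
  proof (rule antisym)
    have s': "s \<le> real n" and t': "0 \<le> t" using st by simp_all
    have "real n \<le> pm (vertex (p 0)) (interp p s) + (pm (interp p s) (interp p t) + pm (interp p t) (vertex (p n)))"
      using pm_tri[of "vertex (p 0)" "interp p s" "vertex (p n)"] pm_tri[of "interp p s" "interp p t" "vertex (p n)"]
        M[OF st(1) s'] M[OF t' st(3)] V vv[of 0 n] by simp
    then show "t - s \<le> pm (interp p s) (interp p t)" using up0[OF st(1) s'] upn[OF t' st(3)] by simp
    show "pm (interp p s) (interp p t) \<le> t - s"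
    proof (cases "s = real n")
      case True
      then have "s = t" using st by simp
      then show ?thesis using pm_refl[OF M[OF t' st(3)]] by simp
    next
      case False
      then obtain i where i: "i < n" "real i \<le> s" "s < real (Suc i)" "(p i, p (Suc i)) \<in> E"
        "interp p s = edge_point (p i) (p (Suc i)) (s - real i)" using cell[of s] st by auto
      have is_n: "Suc i \<le> n" using i by simp
      have 1: "pm (interp p s) (vertex (p j)) \<le> real j - s" if j: "Suc i \<le> j" "j \<le> n" for j
        using pm_tri[of "interp p s" "vertex (p (Suc i))" "vertex (p j)"] M[OF st(1) s'] V[OF is_n] V[OF j(2)]
          step(2)[OF i] vv[OF is_n j(2)] j by simp
      show ?thesis
      proof (cases "t = real n")
        case True
        then show ?thesis using 1[of n] is_n by simp
      next
        case False
        then obtain j where j: "j < n" "real j \<le> t" "t < real (Suc j)" "(p j, p (Suc j)) \<in> E"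
          "interp p t = edge_point (p j) (p (Suc j)) (t - real j)" using cell[of t] st t' by auto
        show ?thesis
        proof (cases "i = j")
          case True
          then show ?thesis using pm_edge_point[OF i(4), of "s - real i" "t - real i"] i j st by simp
        next
          case False
          then have "i < j" using i j st by linarith
          then show ?thesis
            using 1[of j] j step(1)[OF j] pm_tri[of "interp p s" "vertex (p j)" "interp p t"]
              pm_sym[of "interp p t" "vertex (p j)"] M[OF st(1) s'] M[OF t' st(3)] V[of j] by simp
        qed
      qed
    qed
  qed
  show "pm (interp p s) (interp p t) = \<bar>s - t\<bar>" if "0 \<le> s" "s \<le> real n" "0 \<le> t" "t \<le> real n" for s t
    using ordered[of s t] ordered[of t s] that pm_sym[OF M M] by (cases "s \<le> t") auto
qed

lemma geodesic_interp: "vgeo n p \<Longrightarrow> geodesic M pm {0..real n} (interp p)"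
  unfolding geodesic_def using interp_geodesic[of n p] by (auto simp: is_interval_cc)

lemma geodesic_interp_ray:
  assumes "\<And>n. vgeo n p" shows "geodesic M pm {0..} (interp p)"
  unfolding geodesic_def
proof (intro conjI ballI)
  have n: "\<exists>n. t \<le> real n" for t by (rule real_arch_simple)
  show "interp p \<in> {0..} \<rightarrow> M" using n interp_geodesic(1)[OF assms] by blast
  fix s t :: real assume st: "s \<in> {0..}" "t \<in> {0..}"
  obtain k where "max s t \<le> real k" using n by blast
  then show "pm (interp p s) (interp p t) = \<bar>s - t\<bar>" using interp_geodesic(2)[OF assms[of k]] st by auto
qed (auto simp: is_interval_ci)

text \<open>Koenig's lemma. The invariant \<open>P\<close> says that the current vertex lies on
  geodesics from \<open>b\<close> to infinitely many \<open>y n\<close>; as it has finitely many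
  neighbours, one of them continues infinitely many of these geodesics.\<close>

lemma ex_limit_ray:
  assumes fin: "\<And>v. v \<in> V \<Longrightarrow> finite {w. (v, w) \<in> E}" and y: "\<And>n. y n \<in> V"
    and div: "\<And>k. finite {n::nat. ed b (y n) \<le> k}"
  shows "\<exists>w. w 0 = b \<and> (\<forall>n. vgeo n w) \<and> (\<forall>k. infinite {n. k + ed (w k) (y n) = ed b (y n)})"
proof -
  define P where "P k v \<longleftrightarrow> v \<in> V \<and> ed b v = k \<and> infinite {n. k + ed v (y n) = ed b (y n)} \<and> (k = 0 \<longrightarrow> v = b)" for k v
  have "\<exists>w. \<forall>k. P k (w k) \<and> (w k, w (Suc k)) \<in> E"
  proof (rule dependent_nat_choice)
    show "\<exists>v. P 0 v" unfolding P_def by (intro exI[of _ b]) (simp add: infinite_UNIV_nat)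
  next
    fix v k assume P: "P k v"
    \<comment> \<open>The dropped indices are finitely many by \<open>div\<close>; for the others
      the geodesic from \<open>v\<close> to \<open>y n\<close> has a next vertex.\<close>
    define I where "I = {n. k + ed v (y n) = ed b (y n)} - {n. ed b (y n) \<le> k}"
    have vV: "v \<in> V" using P unfolding P_def by blast
    have I: "infinite I" unfolding I_def using P div unfolding P_def by (intro Diff_infinite_finite) auto
    have "\<exists>v'. (v, v') \<in> E \<and> Suc (ed v' (y n)) = ed v (y n)" if "n \<in> I" for n
    proof -
      obtain p where p: "p 0 = v" "p (ed v (y n)) = y n" "vgeo (ed v (y n)) p" using ex_vgeo vV y by blast
      have pos: "0 < ed v (y n)" using that unfolding I_def by auto
      then have "ed (p 1) (p (ed v (y n))) = ed v (y n) - 1" using p(3) unfolding vgeo_def by simp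
      then show ?thesis using vgeo_edge[OF p(3) pos] p pos by (intro exI[of _ "p 1"]) simp
    qed
    then obtain g where g: "\<And>n. n \<in> I \<Longrightarrow> (v, g n) \<in> E \<and> Suc (ed (g n) (y n)) = ed v (y n)" by metis
    have "finite (g ` I)" using g by (intro finite_subset[OF _ fin[OF vV]]) auto
    from pigeonhole_infinite[OF I this] obtain m where m: "m \<in> I" "infinite {n \<in> I. g n = g m}" by blast
    define v' where "v' = g m"
    have e: "(v, v') \<in> E" using g m unfolding v'_def by blast
    then have v'V: "v' \<in> V" using edge_vertices by blast
    have bv': "ed b v' \<le> Suc k" using ed_tri[of b v v'] vV v'V P ed_edge[OF e] unfolding P_def by simp
    have *: "Suc k + ed v' (y n) = ed b (y n) \<and> ed b v' = Suc k" if n: "n \<in> I" "g n = g m" for n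
    proof -
      have "Suc (ed v' (y n)) = ed v (y n)" using g[OF n(1)] n(2) by (simp add: v'_def)
      moreover have "k + ed v (y n) = ed b (y n)" using n(1) by (simp add: I_def)
      moreover have "ed b (y n) \<le> ed b v' + ed v' (y n)" using ed_tri v'V y by simp
      ultimately show ?thesis using bv' by linarith
    qed
    have "infinite {n. Suc k + ed v' (y n) = ed b (y n)}"
      by (rule infinite_super[OF _ m(2)]) (use * in auto)
    then have "P (Suc k) v'" unfolding P_def using v'V *[OF m(1)] by simp
    then show "\<exists>v'. P (Suc k) v' \<and> (v, v') \<in> E" using e by blast
  qed
  then obtain w where w: "\<And>k. P k (w k)" "\<And>k. (w k, w (Suc k)) \<in> E" by blast
  have w0: "w 0 = b" using w(1)[of 0] unfolding P_def by simp
  then have "vgeo n w" for n using w(1)[of n] w(2) unfolding P_def by (intro vgeoI) auto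
  then show ?thesis using w(1) w0 unfolding P_def by blast
qed

end

section \<open>Stability and the Morse property\<close>

lemma stableD:
  assumes "stable f M d I c" "1 \<le> K" "0 \<le> e" "a \<le> b" "quasigeodesic K e M d {a..b} \<sigma>"
    "\<sigma> a \<in> c ` I" "\<sigma> b \<in> c ` I" "t \<in> {a..b}"
  shows "\<exists>s\<in>I. d (\<sigma> t) (c s) \<le> f K e"
  using conjunct2[OF assms(1)[unfolded stable_def], rule_format, of K e a b \<sigma> t] assms(2-8) by blast

text \<open>Stability speaks of quasigeodesics with ends on the given path; this supplies such ends
  when they are only near it. Forgetting the added points by \<open>cl\<close> costs
  \<open>2 * C\<close> in distance and \<open>2\<close> in length.\<close>

lemma (in pmetric) qg_extend:
  assumes q: "qg C n x" and u: "d u (x 0) \<le> C" and v: "d (x n) v \<le> C"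
  shows "qg (3 * C + 2) (n + 2) (\<lambda>i. if i = 0 then u else if i \<le> n + 1 then x (i - 1) else v)"
    (is "qg _ _ ?z")
proof (rule qgI)
  have C: "1 \<le> C" using qg_ge1[OF q] .
  then show "1 \<le> 3 * C + 2" by simp
  fix i j :: nat assume ij: "i \<le> j" "j \<le> n + 2"
  define cl where "cl k = min (k - 1) n" for k :: nat
  have near: "d (?z k) (x (cl k)) \<le> C" for k
    using u v C d_sym[of v] by (auto simp: cl_def min_def)
  have c: "cl i \<le> cl j" "cl j \<le> n" "real (cl j) - real (cl i) \<le> real j - real i"
    "real j - real i \<le> real (cl j) - real (cl i) + 2"
    using ij by (auto simp: cl_def min_def)
  have d1: "d (x (cl i)) (x (cl j)) \<le> d (?z i) (?z j) + 2 * C"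
    using near[of i] near[of j] d_tri[of "x (cl i)" "x (cl j)" "?z i"] d_tri[of "?z i" "x (cl j)" "?z j"]
      d_sym[of "x (cl i)" "?z i"] by linarith
  have d2: "d (?z i) (?z j) \<le> d (x (cl i)) (x (cl j)) + 2 * C"
    using near[of i] near[of j] d_tri[of "?z i" "?z j" "x (cl i)"] d_tri[of "x (cl i)" "?z j" "x (cl j)"]
      d_sym[of "x (cl j)" "?z j"] by linarith
  have "real j - real i \<le> C * (d (x (cl i)) (x (cl j)) + C) + 2"
    using qg_lower[OF q c(1,2)] c(4) by simp
  also have "\<dots> \<le> C * (d (?z i) (?z j) + 3 * C) + 2"
    using d1 C by (intro add_right_mono mult_left_mono) auto
  also have "\<dots> \<le> C * (d (?z i) (?z j) + (3 * C + 2)) + 2 * (d (?z i) (?z j) + (3 * C + 2))"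
    using C by (intro add_mono mult_left_mono) (auto intro: add_increasing)
  also have "\<dots> \<le> (3 * C + 2) * (d (?z i) (?z j) + (3 * C + 2))"
    unfolding distrib_right[symmetric] using C by (intro mult_right_mono) auto
  finally show "real j - real i \<le> (3 * C + 2) * (d (?z i) (?z j) + (3 * C + 2))" .
  have "d (?z i) (?z j) \<le> C * (real (cl j) - real (cl i)) + 3 * C"
    using qg_upper[OF q c(1,2)] d2 by simp
  also have "\<dots> \<le> (3 * C + 2) * (real j - real i) + (3 * C + 2)"
    using C c by (intro add_mono mult_mono) auto
  finally show "d (?z i) (?z j) \<le> (3 * C + 2) * (real j - real i) + (3 * C + 2)" .
qed

context connected_graph
begin

lemma qg_retr: "qg C n x \<Longrightarrow> qg C n (\<lambda>i. retr (x i))"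
  unfolding qg_def by simp

lemma near_retr [simp]: "near r (retr x) A = near r x A"
  unfolding near_def by simp

lemma vgeo_rgeo: "vgeo n p \<Longrightarrow> rgeo n (\<lambda>i. vertex (p i))"
  unfolding rgeo_def using vgeo_tm by auto

text \<open>A step function is enough, since quasigeodesics may be discontinuous. Rounding the
  parameter accounts for the second \<open>C\<close>.\<close>

lemma qg_quasigeodesic:
  assumes q: "qg C n x" and M: "\<And>i. i \<le> n \<Longrightarrow> x i \<in> M"
  shows "quasigeodesic C (2 * C) M pm {0..real n} (\<lambda>t. x (nat \<lfloor>t\<rfloor>))"
proof -
  have C: "1 \<le> C" using qg_ge1[OF q] .
  have fl: "nat \<lfloor>t\<rfloor> \<le> n" if "t \<in> {0..real n}" for t
  proof -
    have "\<lfloor>t\<rfloor> \<le> \<lfloor>real n\<rfloor>" using that by (intro floor_mono) auto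
    then show ?thesis by simp
  qed
  have ord: "dist s t / C - 2 * C \<le> pm (x (nat \<lfloor>s\<rfloor>)) (x (nat \<lfloor>t\<rfloor>)) \<and>
      pm (x (nat \<lfloor>s\<rfloor>)) (x (nat \<lfloor>t\<rfloor>)) \<le> C * dist s t + 2 * C" (is "?P s t")
    if s: "s \<in> {0..real n}" and t: "t \<in> {0..real n}" and st: "s \<le> t" for s t
  proof -
    define i where "i = nat \<lfloor>s\<rfloor>"
    define j where "j = nat \<lfloor>t\<rfloor>"
    have ri: "real i = of_int \<lfloor>s\<rfloor>" "real j = of_int \<lfloor>t\<rfloor>" using s t by (simp_all add: i_def j_def)
    have ij: "i \<le> j" "j \<le> n" using st fl[OF t] by (auto simp: i_def j_def intro: nat_mono floor_mono)
    have dist: "dist s t = t - s" using st by (simp add: dist_real_def)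
    have gap: "t - s \<le> real j - real i + 1" "real j - real i \<le> t - s + 1" using ri by linarith+
    have pm: "pm (x i) (x j) = tm (x i) (x j)" using M ij tm_eq by simp
    have "t - s \<le> C * (tm (x i) (x j) + C) + 1" using qg_lower[OF q ij] gap by simp
    also have "\<dots> \<le> C * (tm (x i) (x j) + C) + C * C" using mult_mono[of 1 C 1 C] C by simp
    also have "\<dots> = C * (tm (x i) (x j) + 2 * C)" by (simp add: algebra_simps)
    finally have "(t - s) / C \<le> tm (x i) (x j) + 2 * C" using C by (simp add: divide_le_eq mult.commute)
    moreover have "tm (x i) (x j) \<le> C * (t - s + 1) + C"
    proof -
      have "C * (real j - real i) \<le> C * (t - s + 1)" using C gap by (intro mult_left_mono) auto
      then show ?thesis using qg_upper[OF q ij] by simp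
    qed
    ultimately show ?thesis unfolding i_def[symmetric] j_def[symmetric] pm dist by (simp add: algebra_simps)
  qed
  have "?P s t"
    if s: "s \<in> {0..real n}" and t: "t \<in> {0..real n}" for s t
    using ord[of s t] ord[of t s] s t pm_sym[OF M[OF fl[OF s]] M[OF fl[OF t]]] dist_commute[of s t]
    by (cases "s \<le> t") auto
  then show ?thesis unfolding quasigeodesic_def qi_embedding_def using C M fl by (auto simp: is_interval_cc)
qed

lemma quasigeodesic_sample:
  assumes q: "quasigeodesic K e M pm {s1..s2} \<sigma>" and ab: "s1 \<le> s2"
  shows "\<exists>n x. x 0 = \<sigma> s1 \<and> x n = \<sigma> s2 \<and> qg (K + e + 1) n x \<and> (\<forall>i\<le>n. x i \<in> \<sigma> ` {s1..s2}) \<and>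
    (\<forall>t\<in>{s1..s2}. \<exists>i\<le>n. tm (\<sigma> t) (x i) \<le> K + e)"
proof -
  have K: "1 \<le> K" and e: "0 \<le> e" and M: "\<And>t. t \<in> {s1..s2} \<Longrightarrow> \<sigma> t \<in> M"
    and qe: "\<And>s t. s \<in> {s1..s2} \<Longrightarrow> t \<in> {s1..s2} \<Longrightarrow> dist s t / K - e \<le> pm (\<sigma> s) (\<sigma> t) \<and> pm (\<sigma> s) (\<sigma> t) \<le> K * dist s t + e"
    using q unfolding quasigeodesic_def qi_embedding_def by blast+
  define n where "n = nat \<lceil>s2 - s1\<rceil>"
  have n: "s2 - s1 \<le> real n" "real n < s2 - s1 + 1" using ab by (simp_all add: n_def) linarith+
  \<comment> \<open>Unit steps from \<open>s1\<close>, truncated at \<open>s2\<close> so that the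
    last sample is the end point; the last step may be shorter.\<close>
  define \<tau> where "\<tau> i = min (s1 + real i) s2" for i
  have \<tau>: "\<tau> i \<in> {s1..s2}" for i using ab by (simp add: \<tau>_def min_def)
  define x where "x i = \<sigma> (\<tau> i)" for i
  have tm: "tm (\<sigma> s) (\<sigma> t) = pm (\<sigma> s) (\<sigma> t)" if "s \<in> {s1..s2}" "t \<in> {s1..s2}" for s t
    using tm_eq M that by blast
  have "qg (K + e + 1) n x"
  proof (rule qgI)
    show "1 \<le> K + e + 1" using K e by simp
    fix i j assume ij: "i \<le> j" "j \<le> n"
    have g: "\<tau> j - \<tau> i \<le> real j - real i" "real j - real i \<le> \<tau> j - \<tau> i + 1" "\<tau> i \<le> \<tau> j"
      using ij n ab by (auto simp: \<tau>_def min_def)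
    then have d: "dist (\<tau> i) (\<tau> j) = \<tau> j - \<tau> i" by (simp add: dist_real_def)
    have "(\<tau> j - \<tau> i) / K \<le> tm (x i) (x j) + e" using qe[OF \<tau> \<tau>, of i j] d tm[OF \<tau> \<tau>] by (simp add: x_def)
    then have "\<tau> j - \<tau> i \<le> K * (tm (x i) (x j) + e)" using K by (simp add: divide_le_eq mult.commute)
    then have "real j - real i \<le> K * (tm (x i) (x j) + e) + 1" using g by simp
    also have "\<dots> \<le> K * (tm (x i) (x j) + (K + e + 1)) + (e + 1) * (tm (x i) (x j) + (K + e + 1))"
    proof (intro add_mono mult_left_mono)
      have "1 * 1 \<le> (e + 1) * (tm (x i) (x j) + (K + e + 1))" using K e by (intro mult_mono) auto
      then show "1 \<le> (e + 1) * (tm (x i) (x j) + (K + e + 1))" by simp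
    qed (use K in auto)
    also have "\<dots> = (K + e + 1) * (tm (x i) (x j) + (K + e + 1))" by (simp add: algebra_simps)
    finally show "real j - real i \<le> (K + e + 1) * (tm (x i) (x j) + (K + e + 1))" .
    have "tm (x i) (x j) \<le> K * (\<tau> j - \<tau> i) + e" using qe[OF \<tau> \<tau>, of i j] d tm[OF \<tau> \<tau>] by (simp add: x_def)
    also have "\<dots> \<le> (K + e + 1) * (real j - real i) + (K + e + 1)"
      using K e g by (intro add_mono mult_mono) auto
    finally show "tm (x i) (x j) \<le> (K + e + 1) * (real j - real i) + (K + e + 1)" .
  qed
  moreover have "\<exists>i\<le>n. tm (\<sigma> t) (x i) \<le> K + e" if t: "t \<in> {s1..s2}" for t
  proof -
    define i where "i = nat \<lfloor>t - s1\<rfloor>"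
    have ri: "real i = of_int \<lfloor>t - s1\<rfloor>" using t by (simp add: i_def)
    then have "real i \<le> t - s1" "t - s1 < real i + 1" by linarith+
    moreover from this have "i \<le> n" using t n by auto
    moreover have "\<bar>t - \<tau> i\<bar> \<le> 1" using calculation t by (auto simp: \<tau>_def min_def)
    then have "K * dist t (\<tau> i) + e \<le> K * 1 + e" using K by (intro add_mono mult_left_mono) (auto simp: dist_real_def)
    then have "tm (\<sigma> t) (x i) \<le> K + e" using qe[OF t \<tau>[of i]] tm[OF t \<tau>[of i]] by (simp add: x_def)
    ultimately show ?thesis by blast
  qed
  moreover have "\<tau> 0 = s1" "\<tau> n = s2" using ab n by (auto simp: \<tau>_def min_def)
  then have "x 0 = \<sigma> s1" "x n = \<sigma> s2" by (simp_all add: x_def)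
  moreover have "\<forall>i\<le>n. x i \<in> \<sigma> ` {s1..s2}" using \<tau> by (auto simp: x_def)
  ultimately show ?thesis by blast
qed

text \<open>Two quasigeodesics with common ends near \<open>H\<close> are extended to end at
  \<open>h\<close> and \<open>h'\<close> and compared with the image \<open>k\<close> of a geodesic
  of the subgroup. Stability puts both near \<open>k\<close>, and
  \<open>fellow_travel_converse\<close> leads from \<open>k\<close> back to the second one.\<close>

lemma morse_vertex_set:
  assumes Y: "connected_graph H F b'" and HV: "H \<subseteq> V" and \<iota>: "\<And>h. h \<in> H \<Longrightarrow> \<iota> (vertex h) = vertex h"
    and qi: "qi_embedding K e (realization H F) (path_metric H F) M pm \<iota>"
    and st: "\<And>I c. geodesic (realization H F) (path_metric H F) I c \<Longrightarrow> stable f M pm I (\<iota> \<circ> c)"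
  shows "morse_family {vertex ` H}"
  unfolding morse_family_def
proof
  fix C0 :: real
  interpret Y: connected_graph H F b' by fact
  have K: "1 \<le> K" and e: "0 \<le> e" and \<iota>M: "\<And>y. y \<in> Y.M \<Longrightarrow> \<iota> y \<in> M"
    and qe: "\<And>x y. x \<in> Y.M \<Longrightarrow> y \<in> Y.M \<Longrightarrow> Y.pm x y / K - e \<le> pm (\<iota> x) (\<iota> y) \<and> pm (\<iota> x) (\<iota> y) \<le> K * Y.pm x y + e"
    using qi unfolding qi_embedding_def by blast+
  define C where "C = max 1 C0"
  have C: "1 \<le> C" "C0 \<le> C" by (simp_all add: C_def)
  define C1 where "C1 = 3 * C + 2"
  define C2 where "C2 = max C1 (K + e)"
  have C1: "1 \<le> C1" using C by (simp add: C1_def)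
  \<comment> \<open>\<open>K + e\<close> pays for rounding the parameter of the subgroup geodesic to
    an integer, where its image is a vertex of \<open>H\<close>.\<close>
  define F1 where "F1 = max 0 (f C1 (2 * C1)) + (K + e)"
  have F1: "0 \<le> F1" using K e by (simp add: F1_def)
  \<comment> \<open>The summands lead from \<open>x i\<close> to \<open>k\<close>, from
    \<open>k\<close> to the extended second path, and from an added end back to
    \<open>y\<close>.\<close>
  define D where "D = F1 + (C2 * (C2 * (2 * F1 + 3 * C2)) + C2 + F1) + C"
  have C2: "1 \<le> C2" using C1 by (simp add: C2_def)
  have D: "0 \<le> D" "F1 \<le> D" using F1 C2 C by (simp_all add: D_def)
  show "\<exists>D\<ge>0. \<forall>A\<in>{vertex ` H}. morse_bound C0 D A"
    unfolding morse_bound_def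
  proof (rule exI[of _ D], rule conjI[OF D(1)], intro ballI allI impI)
    fix A n x m y i
    assume A: "A \<in> {vertex ` H}" and i: "i \<le> n" and "qg C0 n x" "qg C0 m y" and xy: "x 0 = y 0" "x n = y m"
      and "near C0 (x 0) A" "near C0 (x n) A"
    then have x: "qg C n x" and y: "qg C m y"
      and nA: "near C (x 0) A" "near C (x n) A"
      using qg_mono[OF _ C(2)] near_mono[OF _ C(2)] by blast+
    obtain h where h: "h \<in> H" "tm (x 0) (vertex h) \<le> C" using nA(1) A unfolding near_def by blast
    obtain h' where h': "h' \<in> H" "tm (x n) (vertex h') \<le> C" using nA(2) A unfolding near_def by blast
    define l where "l = Y.ed h h'"
    obtain p where p: "p 0 = h" "p l = h'" "Y.vgeo l p" using Y.ex_vgeo[OF h(1) h'(1)] unfolding l_def by blast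
    have pH: "p j \<in> H" if "j \<le> l" for j using p(3) that by (simp add: Y.vgeo_def)
    note geo = Y.geodesic_interp[OF p(3)]
    define k where "k j = vertex (p j)" for j
    have k: "k j = \<iota> (Y.interp p (real j))" if "j \<le> l" for j using \<iota>[OF pH[OF that]] by (simp add: k_def)
    have MY: "Y.interp p (real i) \<in> Y.M" if "i \<le> l" for i
      using Y.interp_geodesic(1)[OF p(3), of "real i"] that by simp
    have qk: "qg C2 l k"
    proof (rule qg_mono[OF qgI])
      show "1 \<le> K + e" using K e by simp
      show "K + e \<le> C2" by (simp add: C2_def)
      fix i j assume ij: "i \<le> j" "j \<le> l"
      have "Y.pm (Y.interp p (real i)) (Y.interp p (real j)) = real j - real i"
        using Y.interp_geodesic(2)[OF p(3), of "real i" "real j"] ij by simp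
      moreover have "tm (k i) (k j) = pm (\<iota> (Y.interp p (real i))) (\<iota> (Y.interp p (real j)))"
        using k[of i] k[of j] ij tm_eq[OF \<iota>M[OF MY[of i]] \<iota>M[OF MY[of j]]] by simp
      ultimately have q1: "(real j - real i) / K - e \<le> tm (k i) (k j)" and q2: "tm (k i) (k j) \<le> K * (real j - real i) + e"
        using qe[OF MY[of i] MY[of j]] ij by auto
      have "(real j - real i) / K \<le> tm (k i) (k j) + e" using q1 by simp
      then have "real j - real i \<le> K * (tm (k i) (k j) + e)" using K by (simp add: divide_le_eq mult.commute)
      also have "\<dots> \<le> (K + e) * (tm (k i) (k j) + (K + e))" using K e by (intro mult_mono) auto
      finally show "real j - real i \<le> (K + e) * (tm (k i) (k j) + (K + e))" .
      have "K * (real j - real i) + e \<le> (K + e) * (real j - real i) + (K + e)"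
        using K e ij by (intro add_mono mult_right_mono) auto
      then show "tm (k i) (k j) \<le> (K + e) * (real j - real i) + (K + e)" using q2 by simp
    qed
    have close: "\<exists>j\<le>l. tm (z i) (k j) \<le> F1"
      if z: "qg C1 N z" "z 0 = vertex h" "z N = vertex h'" and i: "i \<le> N" for z N i
    proof -
      define \<sigma> where "\<sigma> t = retr (z (nat \<lfloor>t\<rfloor>))" for t :: real
      have "quasigeodesic C1 (2 * C1) M pm {0..real N} \<sigma>"
        unfolding \<sigma>_def using qg_quasigeodesic[OF qg_retr[OF z(1)]] by simp
      moreover have hM: "vertex h \<in> M" "vertex h' \<in> M" using h(1) h'(1) HV by auto
      have "\<sigma> 0 = vertex h" "\<sigma> (real N) = vertex h'" using z hM by (simp_all add: \<sigma>_def retr_def)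
      then have "\<sigma> 0 = (\<iota> \<circ> Y.interp p) 0" "\<sigma> (real N) = (\<iota> \<circ> Y.interp p) (real l)"
        using k[of 0] k[of l] p(1,2) by (simp_all add: k_def)
      then have "\<sigma> 0 \<in> (\<iota> \<circ> Y.interp p) ` {0..real l}" "\<sigma> (real N) \<in> (\<iota> \<circ> Y.interp p) ` {0..real l}"
        by (simp_all only:) (rule imageI, simp)+
      ultimately have "\<exists>s\<in>{0..real l}. pm (\<sigma> (real i)) ((\<iota> \<circ> Y.interp p) s) \<le> f C1 (2 * C1)"
        using C1 i by (intro stableD[OF st[OF geo], where a = 0 and b = "real N"]) auto
      then obtain s where s: "s \<in> {0..real l}" "pm (\<sigma> (real i)) (\<iota> (Y.interp p s)) \<le> f C1 (2 * C1)"
        by auto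
      have Ms: "Y.interp p s \<in> Y.M" using Y.interp_geodesic(1)[OF p(3)] s(1) by simp
      define j where "j = nat \<lfloor>s\<rfloor>"
      have js: "real j \<le> s" "s \<le> real j + 1"
        using nat_floor_bounds[of s] s(1) by (auto simp: j_def)
      then have jl: "j \<le> l" using s(1) by simp
      have Mj: "Y.interp p (real j) \<in> Y.M" using Y.interp_geodesic(1)[OF p(3), of "real j"] jl by simp
      have "Y.pm (Y.interp p s) (Y.interp p (real j)) \<le> 1"
        using Y.interp_geodesic(2)[OF p(3), of s "real j"] s(1) jl js by simp
      then have "K * Y.pm (Y.interp p s) (Y.interp p (real j)) + e \<le> K * 1 + e"
        using K by (intro add_right_mono mult_left_mono) auto
      then have "pm (\<iota> (Y.interp p s)) (\<iota> (Y.interp p (real j))) \<le> K + e" using qe[OF Ms Mj] by simp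
      then have "tm (\<iota> (Y.interp p s)) (k j) \<le> K + e" using k[OF jl] tm_eq \<iota>M Ms Mj by simp
      moreover have "tm (z i) (\<iota> (Y.interp p s)) \<le> f C1 (2 * C1)"
        using s(2) tm_eq[of "retr (z i)" "\<iota> (Y.interp p s)"] \<iota>M[OF Ms] by (simp add: \<sigma>_def)
      ultimately have "tm (z i) (k j) \<le> F1" using d_tri[of "z i" "k j" "\<iota> (Y.interp p s)"] by (simp add: F1_def)
      then show ?thesis using jl by blast
    qed
    let ?x = "\<lambda>i. if i = 0 then vertex h else if i \<le> n + 1 then x (i - 1) else vertex h'"
    let ?y = "\<lambda>i. if i = 0 then vertex h else if i \<le> m + 1 then y (i - 1) else vertex h'"
    have qx: "qg C1 (n + 2) ?x" unfolding C1_def using h h' d_sym by (intro qg_extend[OF x]) auto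
    have qy: "qg C1 (m + 2) ?y" unfolding C1_def using h h' xy d_sym by (intro qg_extend[OF y]) auto
    obtain j where j: "j \<le> l" "tm (x i) (k j) \<le> F1" using close[OF qx, of "Suc i"] i by auto
    have "\<exists>i'\<le>m + 2. tm (k j) (?y i') \<le> C2 * (C2 * (2 * F1 + 3 * C2)) + C2 + F1"
    proof (rule fellow_travel_converse[OF qk _ _ _ F1 _ j(1)])
      show "qg C2 (m + 2) ?y" by (rule qg_mono[OF qy]) (simp add: C2_def)
      show "\<exists>j\<le>l. tm (?y i) (k j) \<le> F1" if "i \<le> m + 2" for i using close[OF qy _ _ that] by simp
    qed (use p in \<open>auto simp: k_def\<close>)
    then obtain i' where i': "i' \<le> m + 2" "tm (k j) (?y i') \<le> C2 * (C2 * (2 * F1 + 3 * C2)) + C2 + F1" by blast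
    have "\<exists>j'\<le>m. tm (?y i') (y j') \<le> C"
    proof -
      consider "i' = 0" | "i' \<noteq> 0" "i' \<le> m + 1" | "i' = m + 2" using i'(1) by linarith
      then show ?thesis
      proof cases
        case 1
        then show ?thesis using h(2) xy d_sym[of "vertex h"] by (intro exI[of _ 0]) auto
      next
        case 2
        then show ?thesis using C by (intro exI[of _ "i' - 1"]) auto
      next
        case 3
        then show ?thesis using h'(2) xy d_sym[of "vertex h'"] by (intro exI[of _ m]) auto
      qed
    qed
    then obtain j' where j': "j' \<le> m" "tm (?y i') (y j') \<le> C" by blast
    have "tm (x i) (y j') \<le> D"
      using d_tri[of "x i" "y j'" "k j"] d_tri[of "k j" "y j'" "?y i'"] j(2) i'(2) j'(2) unfolding D_def by linarith
    moreover have "near D (x i) A" unfolding near_def using j D(2) A pH[OF j(1)] by (intro bexI[of _ "k j"]) (auto simp: k_def)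
    ultimately show "near D (x i) A \<and> (\<exists>j\<le>m. tm (x i) (y j) \<le> D)" using j'(1) by blast
  qed
qed

lemma geodesic_quasigeodesic:
  assumes "geodesic M pm I c" "is_interval J" "J \<noteq> {}" "J \<subseteq> I"
  shows "quasigeodesic 1 0 M pm J c"
proof -
  have "pm (c s) (c t) = \<bar>s - t\<bar>" "c s \<in> M" if "s \<in> J" "t \<in> J" for s t
    using assms that unfolding geodesic_def by blast+
  then show ?thesis using assms(2,3) unfolding quasigeodesic_def qi_embedding_def by (auto simp: dist_real_def)
qed

text \<open>A geodesic near \<open>A\<close> inherits stability from the fellow-travelling of
  quasigeodesics, with a function that depends on \<open>R\<close> but not on the geodesic. This is
  what produces points of the Morse boundary.\<close>

lemma geodesic_near_morse_stable:
  assumes mf: "morse_family {A}"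
  shows "\<exists>f\<in>stability_functions. \<forall>I c. geodesic M pm I c \<and> (\<forall>t\<in>I. near R (c t) A) \<longrightarrow> stable f M pm I c"
proof -
  obtain D where D: "\<And>C. 0 \<le> D C" and mb: "\<And>C. morse_bound C (D C) A"
    using mf unfolding morse_family_def by (metis singletonI)
  \<comment> \<open>\<open>K + e + 1\<close> is the constant of a sampled quasigeodesic,
    \<open>2\<close> that of a sampled geodesic, and \<open>R\<close> bounds the distance of the
    ends from \<open>A\<close>; the last summand undoes the sampling.\<close>
  define f where "f K e = D (max (K + e + 1) (max 2 R)) + (K + e)" for K e :: real
  have "f \<in> stability_functions" unfolding stability_functions_def f_def using D by (auto intro!: add_nonneg_nonneg)
  moreover have "stable f M pm I c" if c: "geodesic M pm I c" and nr: "\<And>t. t \<in> I \<Longrightarrow> near R (c t) A" for I c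
    unfolding stable_def
  proof (intro conjI allI impI ballI)
    have I: "is_interval I" "I \<noteq> {}" using c unfolding geodesic_def by blast+
    show "\<exists>K e. quasigeodesic K e M pm I c" using geodesic_quasigeodesic[OF c I] by blast
    fix K e s1 s2 :: real and \<sigma> t
    assume K: "1 \<le> K" and e: "0 \<le> e" and t: "t \<in> {s1..s2}"
      and \<sigma>: "s1 \<le> s2 \<and> quasigeodesic K e M pm {s1..s2} \<sigma> \<and> \<sigma> s1 \<in> c ` I \<and> \<sigma> s2 \<in> c ` I"
    define C where "C = max (K + e + 1) (max 2 R)"
    obtain u where u: "u \<in> I" "\<sigma> s1 = c u" using \<sigma> by blast
    obtain v where v: "v \<in> I" "\<sigma> s2 = c v" using \<sigma> by blast
    have \<sigma>q: "quasigeodesic K e M pm {s1..s2} \<sigma>" and s12: "s1 \<le> s2" using \<sigma> by blast+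
    obtain n x where x: "x 0 = \<sigma> s1" "x n = \<sigma> s2" "qg (K + e + 1) n x"
      "\<forall>t\<in>{s1..s2}. \<exists>i\<le>n. tm (\<sigma> t) (x i) \<le> K + e"
      using quasigeodesic_sample[OF \<sigma>q s12] by blast
    have path: "\<exists>m y. y 0 = c u \<and> y m = c v \<and> qg 2 m y \<and> (\<forall>i\<le>m. y i \<in> c ` I)"
      if uv: "u \<in> I" "v \<in> I" "u \<le> v" for u v
    proof -
      have sub: "{u..v} \<subseteq> I" using mem_is_interval_1_I[OF I(1) uv(1,2)] by auto
      have "quasigeodesic 1 0 M pm {u..v} c" using sub uv by (intro geodesic_quasigeodesic[OF c]) (auto simp: is_interval_cc)
      from quasigeodesic_sample[OF this uv(3)] obtain m y where y: "y 0 = c u" "y m = c v" "qg (1 + 0 + 1) m y"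
        "\<forall>i\<le>m. y i \<in> c ` {u..v}" by blast
      then show ?thesis using sub by (intro exI[of _ m] exI[of _ y]) auto
    qed
    \<comment> \<open>The ends of \<open>\<sigma>\<close> may occur on \<open>c\<close> in either
      order.\<close>
    have "\<exists>m y. y 0 = c u \<and> y m = c v \<and> qg 2 m y \<and> (\<forall>i\<le>m. y i \<in> c ` I)"
    proof (cases "u \<le> v")
      case True
      then show ?thesis using path u v by blast
    next
      case False
      then obtain m y where y: "y 0 = c v" "y m = c u" "qg 2 m y" "\<forall>i\<le>m. y i \<in> c ` I"
        using path[OF v(1) u(1)] by auto
      then show ?thesis using qg_rev[OF y(3)] by (intro exI[of _ m] exI[of _ "\<lambda>i. y (m - i)"]) simp
    qed
    then obtain m y where y: "y 0 = c u" "y m = c v" "qg 2 m y" "\<forall>i\<le>m. y i \<in> c ` I" by blast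
    obtain i where i: "i \<le> n" "tm (\<sigma> t) (x i) \<le> K + e" using x(4) t by blast
    have nRC: "near C (c u) A" "near C (c v) A" using near_mono[OF nr] u(1) v(1) by (simp_all add: C_def)
    have "\<exists>j\<le>m. tm (x i) (y j) \<le> D C"
    proof (rule morse_bound_travel[OF mb])
      show "qg C n x" by (rule qg_mono[OF x(3)]) (simp add: C_def)
      show "qg C m y" by (rule qg_mono[OF y(3)]) (simp add: C_def)
    qed (use x y u v i nRC in simp_all)
    then obtain j where j: "j \<le> m" "tm (x i) (y j) \<le> D C" by blast
    obtain s where s: "s \<in> I" "y j = c s" using y(4) j by blast
    have "tm (\<sigma> t) (c s) \<le> f K e"
      using d_tri[of "\<sigma> t" "c s" "x i"] i j s(2) by (simp add: f_def C_def[symmetric])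
    moreover have "\<sigma> t \<in> M" using \<sigma>q t unfolding quasigeodesic_def qi_embedding_def by blast
    moreover have "c s \<in> M" using c s(1) unfolding geodesic_def by blast
    ultimately show "\<exists>s\<in>I. pm (\<sigma> t) (c s) \<le> f K e" using s(1) tm_eq by auto
  qed
  ultimately show ?thesis by blast
qed

end

section \<open>Limit sets and weak hulls\<close>

locale morse_subset = connected_graph +
  fixes H :: "'a set"
  assumes base_H: "b \<in> H" and HV: "H \<subseteq> V"
    and locally_finite: "v \<in> V \<Longrightarrow> finite {w. (v, w) \<in> E}"
    and morse: "morse_family {vertex ` H}"
begin

abbreviation "A \<equiv> vertex ` H"
abbreviation "\<Lambda> \<equiv> limit_set M pm (vertex b) A"
abbreviation "FHD \<equiv> finite_Hausdorff_distance pm"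

abbreviation "asymptotic \<equiv> {(\<alpha>, \<beta>). \<alpha> \<in> morse_rays M pm (vertex b) \<and> \<beta> \<in> morse_rays M pm (vertex b) \<and>
   FHD (\<alpha> ` {0..}) (\<beta> ` {0..})}"

lemma A_M: "A \<subseteq> M"
  using HV by auto

lemma morseE:
  obtains D where "0 \<le> D"
    "\<And>n x i. qg C n x \<Longrightarrow> near C (x 0) A \<Longrightarrow> near C (x n) A \<Longrightarrow> i \<le> n \<Longrightarrow> near D (x i) A"
proof -
  obtain D where D: "0 \<le> D" and mb: "morse_bound C D A"
    using morse unfolding morse_family_def by blast
  show ?thesis
    by (rule that[OF D]) (rule morse_bound_near[OF mb])
qed

section \<open>Hausdorff distance, and rays representing limit points\<close>

lemma FHD_iff:
  assumes P: "P \<subseteq> M" and Q: "Q \<subseteq> M"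
  shows "FHD P Q \<longleftrightarrow> (\<exists>D. (\<forall>x\<in>P. near D x Q) \<and> (\<forall>y\<in>Q. near D y P))"
proof -
  have "pm x y = tm x y" if "x \<in> P" "y \<in> Q" for x y
    using tm_eq[OF subsetD[OF P that(1)] subsetD[OF Q that(2)]] by simp
  then show ?thesis unfolding finite_Hausdorff_distance_def near_def
    by (intro ex_cong1 arg_cong2[where f = conj] ball_cong bex_cong refl) (simp_all add: d_sym)
qed

lemma FHD_refl: "P \<subseteq> M \<Longrightarrow> FHD P P"
  unfolding FHD_iff using near_self[of _ P 0] by blast

lemma FHD_sym: "P \<subseteq> M \<Longrightarrow> Q \<subseteq> M \<Longrightarrow> FHD P Q \<Longrightarrow> FHD Q P"
  unfolding FHD_iff by blast

lemma FHD_trans: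
  assumes M: "P \<subseteq> M" "Q \<subseteq> M" "S \<subseteq> M" and "FHD P Q" "FHD Q S" shows "FHD P S"
proof -
  obtain D where D: "\<forall>x\<in>P. near D x Q" "\<forall>y\<in>Q. near D y P" using assms(4) unfolding FHD_iff[OF M(1,2)] by blast
  obtain D' where D': "\<forall>x\<in>Q. near D' x S" "\<forall>y\<in>S. near D' y Q" using assms(5) unfolding FHD_iff[OF M(2,3)] by blast
  have "near (D + D') x S" if "x \<in> P" for x using near_subset_dist D(1) D'(1) that by blast
  moreover have "near (D + D') y P" if "y \<in> S" for y
    using near_subset_dist[of D' y Q D P] D(2) D'(2) that by (simp add: add.commute)
  ultimately show ?thesis unfolding FHD_iff[OF M(1,3)] by blast
qed

lemma geodesic_image: "geodesic M pm I c \<Longrightarrow> t \<in> I \<Longrightarrow> c t \<in> M"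
  unfolding geodesic_def by blast

lemma geodesic_tm: "geodesic M pm I c \<Longrightarrow> s \<in> I \<Longrightarrow> t \<in> I \<Longrightarrow> tm (c s) (c t) = \<bar>s - t\<bar>"
  using tm_eq[OF geodesic_image geodesic_image] unfolding geodesic_def by simp

lemma morse_ray_image: "\<alpha> \<in> morse_rays M pm (vertex b) \<Longrightarrow> \<alpha> ` {0..} \<subseteq> M"
  unfolding morse_rays_def using geodesic_image by blast

lemma equiv_asymptotic: "equiv (morse_rays M pm (vertex b)) asymptotic"
proof (rule equivI)
  show "refl_on (morse_rays M pm (vertex b)) asymptotic"
    unfolding refl_on_def using FHD_refl morse_ray_image by blast
  show "sym asymptotic" unfolding sym_def using FHD_sym morse_ray_image by blast
  show "trans asymptotic" unfolding trans_def using FHD_trans morse_ray_image by blast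
qed auto

lemma near_FHD:
  assumes "P \<subseteq> M" "Q \<subseteq> M" "FHD P Q" and nr: "\<And>y. y \<in> Q \<Longrightarrow> near R y A"
  shows "\<exists>R'. \<forall>x\<in>P. near R' x A"
proof -
  obtain D where "\<forall>x\<in>P. near D x Q" using assms(3) unfolding FHD_iff[OF assms(1,2)] by blast
  then show ?thesis using near_subset_dist[OF _ nr] by blast
qed

lemma interp_near:
  assumes p: "vgeo n p" and nr: "\<And>i. i \<le> n \<Longrightarrow> near D (vertex (p i)) A" and t: "0 \<le> t" "t \<le> real n"
  shows "near (D + 1) (interp p t) A"
proof -
  define j where "j = nat \<lfloor>t\<rfloor>"
  have js: "real j \<le> t" "t \<le> real j + 1"
    using nat_floor_bounds[of t] t(1) by (auto simp: j_def)
  then have jl: "j \<le> n" using t(2) by simp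
  have "tm (interp p t) (interp p (real j)) \<le> 1"
    using geodesic_tm[OF geodesic_interp[OF p], of t "real j"] t jl js by simp
  then show ?thesis using near_trans[OF nr[OF jl]] by simp
qed

text \<open>The triangle with vertices \<open>b\<close>, \<open>x n\<close>, \<open>\<alpha> m\<close>: the projection of \<open>b\<close> to the side \<open>[x n, \<alpha> m]\<close> is at
  distance about the Gromov product, and the geodesic to it is near both other sides.\<close>

lemma limit_point_near:
  assumes \<xi>: "\<xi> \<in> \<Lambda>" and \<alpha>': "\<alpha>' \<in> \<xi>"
  shows "\<exists>R. \<forall>x\<in>\<alpha>' ` {0..}. near R x A"
proof -
  have mb: "\<xi> \<in> morse_rays M pm (vertex b) // asymptotic"
    using \<xi> unfolding limit_set_def morse_boundary_def by blast
  obtain x where x: "range x \<subseteq> A" "represents M pm (vertex b) x \<xi>" using \<xi> unfolding limit_set_def by blast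
  then obtain \<alpha> where \<alpha>: "\<alpha> \<in> \<xi>" "filterlim (\<lambda>(n, m). gromov_product pm (vertex b) (x n) (\<alpha> (real m))) at_top
       (sequentially \<times>\<^sub>F sequentially)" unfolding represents_def by blast
  \<comment> \<open>The Gromov products are controlled for one representative
    \<open>\<alpha>\<close> only; the given \<open>\<alpha>'\<close> is asymptotic to it.\<close>
  have rel: "(\<alpha>', \<alpha>) \<in> asymptotic" using in_quotient_imp_in_rel[OF equiv_asymptotic mb] \<alpha>' \<alpha>(1) by blast
  then have g: "geodesic M pm {0..} \<alpha>" and \<alpha>0: "\<alpha> 0 = vertex b" unfolding morse_rays_def by blast+
  from rel obtain f where f: "stable f M pm {0..} \<alpha>" unfolding morse_rays_def by blast
  obtain D where D: "0 \<le> D" "\<And>n x i. qg 9 n x \<Longrightarrow> near 9 (x 0) A \<Longrightarrow> near 9 (x n) A \<Longrightarrow> i \<le> n \<Longrightarrow> near D (x i) A"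
    using morseE[of 9] by blast
  \<comment> \<open>By \<open>qg_quasigeodesic\<close>, a sequence with constant \<open>9\<close>
    becomes a quasigeodesic with constants \<open>9\<close> and \<open>18\<close>.\<close>
  define D' where "D' = f 9 18"
  have oA: "vertex b \<in> A" using base_H by blast
  have near: "near (D + (2 * D' + 4)) (\<alpha> t) A" if t: "0 \<le> t" for t
  proof -
    \<comment> \<open>The margin \<open>10\<close> absorbs a loss of \<open>9 / 2\<close> from the
      roughness of \<open>\<gamma>\<close> and of \<open>3\<close> from the length of
      \<open>w\<close>.\<close>
    have "eventually (\<lambda>(n, m). t + 10 \<le> gromov_product pm (vertex b) (x n) (\<alpha> (real m))) (sequentially \<times>\<^sub>F sequentially)"
      using \<alpha>(2) unfolding filterlim_at_top by (simp add: case_prod_unfold)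
    then obtain n m where nm: "t + 10 \<le> gromov_product pm (vertex b) (x n) (\<alpha> (real m))"
      unfolding eventually_prod_sequentially by auto
    have xM: "x n \<in> M" and \<alpha>M: "\<alpha> (real m) \<in> M" and oM: "vertex b \<in> M"
      using x(1) A_M geodesic_image[OF g] by auto
    have gp: "2 * (t + 10) \<le> tm (x n) (vertex b) + tm (\<alpha> (real m)) (vertex b) - tm (x n) (\<alpha> (real m))"
      using nm xM \<alpha>M oM unfolding gromov_product_def by (simp add: tm_eq)
    obtain N \<gamma> where \<gamma>: "\<gamma> 0 = x n" "\<gamma> N = \<alpha> (real m)" "rgeo N \<gamma>" by (rule roughE)
    obtain i0 where i0: "i0 \<le> N" "\<forall>i\<le>N. tm (vertex b) (\<gamma> i0) \<le> tm (vertex b) (\<gamma> i)" using ex_nearest_index by blast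
    obtain L w where w: "w 0 = \<gamma> i0" "w L = vertex b" "rgeo L w" "\<bar>tm (\<gamma> i0) (vertex b) - real L\<bar> \<le> 3" by (rule roughE)
    have "tm (x n) (\<gamma> i0) + tm (\<gamma> i0) (\<alpha> (real m)) \<le> tm (x n) (\<alpha> (real m)) + 9"
      using rgeoD[OF \<gamma>(3), of 0 i0] rgeoD[OF \<gamma>(3), of i0 N] rgeoD[OF \<gamma>(3), of 0 N] i0(1) \<gamma>(1,2) by simp
    moreover have "tm (x n) (vertex b) \<le> tm (x n) (\<gamma> i0) + tm (\<gamma> i0) (vertex b)" by (rule d_tri)
    moreover have "tm (\<alpha> (real m)) (vertex b) \<le> tm (\<gamma> i0) (\<alpha> (real m)) + tm (\<gamma> i0) (vertex b)"
      using d_tri[of "\<alpha> (real m)" "vertex b" "\<gamma> i0"] d_sym[of "\<alpha> (real m)" "\<gamma> i0"] by simp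
    ultimately have "2 * (t + 10) \<le> 2 * tm (\<gamma> i0) (vertex b) + 9" using gp by argo
    then have "t + 5 \<le> tm (\<gamma> i0) (vertex b)" by simp
    then have Lt: "t \<le> real L" using w(4) by linarith
    define k where "k = nat \<lfloor>t\<rfloor>"
    have k: "real k \<le> t" "t \<le> real k + 1"
      using nat_floor_bounds[of t] t by (auto simp: k_def)
    then have kL: "k \<le> L" using Lt by simp
    \<comment> \<open>\<open>w\<close> runs towards \<open>b\<close>, so the point at distance about
      \<open>t\<close> from \<open>b\<close> has index \<open>L - k\<close>.\<close>
    define j where "j = L - k"
    have jL: "j \<le> L" "real j = real L - real k" using kL by (auto simp: j_def of_nat_diff)
    have wk: "\<bar>tm (w j) (vertex b) - real k\<bar> \<le> 3" using rgeoD[OF w(3), of j L] w(2) jL by simp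
    \<comment> \<open>This path from \<open>x n\<close> through \<open>\<gamma> i0\<close> to
      \<open>b\<close> has its ends in \<open>A\<close>, and \<open>?z2\<close> from
      \<open>\<alpha> (real m)\<close> to \<open>b\<close> has its ends on \<open>\<alpha>\<close>.
      Both pass \<open>w j\<close>, which is thus near \<open>A\<close> by the Morse property and
      near \<open>\<alpha>\<close> by stability.\<close>
    let ?z1 = "\<lambda>i. if i \<le> i0 then \<gamma> i else w (i - i0)"
    have "qg (3 * 3) (i0 + L) ?z1" using i0 w by (intro qg_append_nearest[OF rgeo_qg[OF \<gamma>(3)] _ _ _ w(3)]) auto
    then have q1: "qg 9 (i0 + L) ?z1" by simp
    have "near 9 (?z1 0) A" using \<gamma>(1) x(1) near_self[of "x n" A 9] by auto
    moreover have "near 9 (?z1 (i0 + L)) A" using w(1,2) near_self[OF oA, of 9] by (cases L) auto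
    ultimately have "near D (?z1 (i0 + j)) A" using jL by (intro D(2)[OF q1]) auto
    then have nw: "near D (w j) A" using w(1) by (cases j) auto
    let ?z2 = "\<lambda>i. if i \<le> N - i0 then \<gamma> (N - i) else w (i - (N - i0))"
    have "qg (3 * 3) (N - i0 + L) ?z2"
    proof (intro qg_append_nearest[OF qg_rev[OF rgeo_qg[OF \<gamma>(3)]] _ _ _ w(3)])
      show "tm (vertex b) (\<gamma> (N - (N - i0))) \<le> tm (vertex b) (\<gamma> (N - i)) + 3" for i
        using i0(2)[rule_format, of "N - i"] i0(1) by simp
    qed (use i0 w in auto)
    then have q2: "qg 9 (N - i0 + L) ?z2" by simp
    define \<sigma> where "\<sigma> t = retr (?z2 (nat \<lfloor>t\<rfloor>))" for t :: real
    have qs: "quasigeodesic 9 (2 * 9) M pm {0..real (N - i0 + L)} \<sigma>"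
      unfolding \<sigma>_def using qg_quasigeodesic[OF qg_retr[OF q2]] by simp
    have "\<sigma> 0 = \<alpha> (real m)" using \<gamma>(2) \<alpha>M by (simp add: \<sigma>_def retr_def)
    moreover have "?z2 (N - i0 + L) = vertex b" using w(1,2) i0(1) by (cases L) auto
    then have "\<sigma> (real (N - i0 + L)) = \<alpha> 0" using oM \<alpha>0 unfolding \<sigma>_def floor_of_nat nat_int retr_def by simp
    ultimately have "\<sigma> 0 \<in> \<alpha> ` {0..}" "\<sigma> (real (N - i0 + L)) \<in> \<alpha> ` {0..}" by auto
    then have "\<exists>s\<in>{0..}. pm (\<sigma> (real (N - i0 + j))) (\<alpha> s) \<le> f 9 (2 * 9)"
      using jL by (intro stableD[OF f _ _ _ qs]) auto
    then obtain s where s: "0 \<le> s" "pm (\<sigma> (real (N - i0 + j))) (\<alpha> s) \<le> D'" by (auto simp: D'_def)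
    have "\<sigma> (real (N - i0 + j)) = retr (w j)"
      using w(1) i0(1) unfolding \<sigma>_def floor_of_nat nat_int by (cases j) auto
    then have ws: "tm (w j) (\<alpha> s) \<le> D'" using s tm_eq[of "retr (w j)" "\<alpha> s"] geodesic_image[OF g] by simp
    have "tm (\<alpha> s) (vertex b) = s" using geodesic_tm[OF g, of s 0] s(1) \<alpha>0 by simp
    then have "\<bar>s - real k\<bar> \<le> D' + 3"
      using ws wk d_tri[of "\<alpha> s" "vertex b" "w j"] d_tri[of "w j" "vertex b" "\<alpha> s"] d_sym[of "w j" "\<alpha> s"] by linarith
    then have "tm (\<alpha> t) (\<alpha> s) \<le> D' + 4" using geodesic_tm[OF g, of t s] s(1) t k by simp
    then have "tm (\<alpha> t) (w j) \<le> 2 * D' + 4" using ws d_tri[of "\<alpha> t" "w j" "\<alpha> s"] d_sym[of "w j" "\<alpha> s"] by linarith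
    then show ?thesis using near_trans[OF nw] by blast
  qed
  have sub: "\<alpha>' ` {0..} \<subseteq> M" "\<alpha> ` {0..} \<subseteq> M" using rel morse_ray_image by blast+
  have "FHD (\<alpha>' ` {0..}) (\<alpha> ` {0..})" using rel by blast
  from near_FHD[OF sub this, of "D + (2 * D' + 4)"] near show ?thesis by auto
qed

text \<open>Geodesics from \<open>b\<close> to points of \<open>H\<close> stay near \<open>A\<close>
  by the Morse property, so a single stratum contains all of \<open>A\<close>, as
  \<open>represents\<close> demands of a sequence.\<close>

lemma stratum_H:
  assumes "\<And>n x i. qg 3 n x \<Longrightarrow> near 3 (x 0) A \<Longrightarrow> near 3 (x n) A \<Longrightarrow> i \<le> n \<Longrightarrow> near D (x i) A"
    and f: "\<And>I c. geodesic M pm I c \<Longrightarrow> (\<And>t. t \<in> I \<Longrightarrow> near (D + 1) (c t) A) \<Longrightarrow> stable f M pm I c"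
    and h: "h \<in> H"
  shows "vertex h \<in> stable_stratum f M pm (vertex b)"
proof -
  have hV: "h \<in> V" using HV h by blast
  obtain p where p: "p 0 = b" "p (ed b h) = h" "vgeo (ed b h) p" using ex_vgeo[OF base hV] by blast
  have nr: "near D (vertex (p i)) A" if "i \<le> ed b h" for i
    using assms(1)[OF rgeo_qg[OF vgeo_rgeo[OF p(3)]] _ _ that] p base_H h near_self[of _ A 3] by simp
  have "near (D + 1) (interp p t) A" if "t \<in> {0..real (ed b h)}" for t
    using interp_near[OF p(3) nr] that by simp
  from f[OF geodesic_interp[OF p(3)] this] have "stable f M pm {0..real (ed b h)} (interp p)" .
  moreover have "interp p 0 = vertex b" using interp_nat[of p 0] p(1) by simp
  ultimately show ?thesis unfolding stable_stratum_def using geodesic_interp[OF p(3)] p(2) hV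
    by (intro CollectI conjI exI[of _ "real (ed b h)"] exI[of _ "interp p"]) auto
qed

text \<open>Boundary points are classes of rays from \<open>b\<close>, but \<open>c\<close> may
  start elsewhere. A ray \<open>\<alpha>\<close> from \<open>b\<close> arises as a limit of
  geodesics to points \<open>y n\<close> of \<open>H\<close> near \<open>c (real n)\<close>. It
  stays near \<open>A\<close> by the Morse property, and near \<open>c\<close> because
  \<open>c\<close> is stable.\<close>

lemma ray_has_limit_point:
  assumes c: "geodesic M pm {0..} c" and nr: "\<And>t. 0 \<le> t \<Longrightarrow> near R (c t) A"
  shows "\<exists>\<xi>\<in>\<Lambda>. \<exists>\<alpha>\<in>\<xi>. FHD (c ` {0..}) (\<alpha> ` {0..})"
proof -
  have cM: "c t \<in> M" if "0 \<le> t" for t using geodesic_image[OF c] that by simp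
  have ctm: "tm (c s) (c t) = \<bar>s - t\<bar>" if "0 \<le> s" "0 \<le> t" for s t using geodesic_tm[OF c] that by simp
  have "\<forall>n. \<exists>h. h \<in> H \<and> tm (c (real n)) (vertex h) \<le> R" using nr[of "real _"] unfolding near_def by fastforce
  from choice[OF this] obtain y where y: "\<And>n. y n \<in> H" "\<And>n. tm (c (real n)) (vertex (y n)) \<le> R" by blast
  have yV: "y n \<in> V" for n using y(1) HV by blast
  define \<delta> where "\<delta> = tm (c 0) (vertex b)"
  have far: "real n \<le> \<delta> + real (ed b (y n)) + R" for n
    using ctm[of 0 "real n"] d_tri[of "c 0" "c (real n)" "vertex b"] d_tri[of "vertex b" "c (real n)" "vertex (y n)"]
      y(2)[of n] d_sym[of "vertex (y n)" "c (real n)"] tm_vertex[OF base yV[of n]] by (simp add: \<delta>_def)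
  have "finite {n. ed b (y n) \<le> k}" for k
  proof (rule finite_subset)
    show "{n. ed b (y n) \<le> k} \<subseteq> {..nat \<lceil>\<delta> + real k + R\<rceil>}"
    proof
      fix n assume "n \<in> {n. ed b (y n) \<le> k}"
      then have "real n \<le> \<delta> + real k + R" using far[of n] by simp
      then show "n \<in> {..nat \<lceil>\<delta> + real k + R\<rceil>}" by (simp add: le_nat_iff) linarith
    qed
  qed simp
  from ex_limit_ray[OF locally_finite yV this] obtain w where w: "w 0 = b" "\<And>n. vgeo n w"
    and wy: "\<And>k. infinite {n. k + ed (w k) (y n) = ed b (y n)}" by blast
  have wV: "w k \<in> V" for k using w(2)[of k] by (simp add: vgeo_def)
  obtain D where D: "0 \<le> D" and ND: "\<And>n x i. qg 3 n x \<Longrightarrow> near 3 (x 0) A \<Longrightarrow> near 3 (x n) A \<Longrightarrow> i \<le> n \<Longrightarrow> near D (x i) A"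
    using morseE[of 3] by blast
  obtain f1 where f1: "\<And>I c. geodesic M pm I c \<Longrightarrow> (\<And>t. t \<in> I \<Longrightarrow> near R (c t) A) \<Longrightarrow> stable f1 M pm I c"
    using geodesic_near_morse_stable[OF morse, of R] by blast
  obtain f2 where f2: "f2 \<in> stability_functions"
    "\<And>I c. geodesic M pm I c \<Longrightarrow> (\<And>t. t \<in> I \<Longrightarrow> near (D + 1) (c t) A) \<Longrightarrow> stable f2 M pm I c"
    using geodesic_near_morse_stable[OF morse, of "D + 1"] by blast
  have st: "stable f1 M pm {0..} c" using nr by (intro f1[OF c]) simp
  \<comment> \<open>\<open>R\<close> bounds the distance from \<open>y n\<close> to
    \<open>c (real n)\<close>, and \<open>\<delta>\<close> is that from \<open>b\<close> to
    \<open>c 0\<close>: the geodesic from \<open>b\<close> to \<open>y n\<close> will be extended to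
    end on \<open>c\<close>.\<close>
  define C where "C = max 3 (max R \<delta>)"
  define C1 where "C1 = 3 * C + 2"
  define D1 where "D1 = max 0 (f1 C1 (2 * C1))"
  have D1: "0 \<le> D1" by (simp add: D1_def)
  have key: "near D (vertex (w k)) A \<and> (\<exists>s. 0 \<le> s \<and> tm (vertex (w k)) (c s) \<le> D1)" for k
  proof -
    obtain n where n: "k + ed (w k) (y n) = ed b (y n)" using infinite_imp_nonempty[OF wy[of k]] by blast
    obtain q where q: "q 0 = w k" "q (ed (w k) (y n)) = y n" "vgeo (ed (w k) (y n)) q" using ex_vgeo[OF wV yV] by blast
    define N where "N = ed b (y n)"
    have kN: "k \<le> N" using n by (simp add: N_def)
    \<comment> \<open>By the choice of \<open>n\<close>, the first \<open>k\<close> steps of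
      \<open>w\<close> followed by a geodesic to \<open>y n\<close> are again a geodesic.\<close>
    define z where "z i = (if i \<le> k then w i else q (i - k))" for i
    have zN: "z N = y n"
    proof (cases "N = k")
      case True
      then have "q 0 = y n" using n q(2) by (simp add: N_def)
      then show ?thesis using True q(1) by (simp add: z_def)
    next
      case False
      then have "\<not> N \<le> k" "N - k = ed (w k) (y n)" using n kN by (simp_all add: N_def)
      then show ?thesis using q(2) by (simp add: z_def)
    qed
    have vz: "vgeo N z"
    proof (rule vgeoI)
      fix i assume i: "i < N"
      show "(z i, z (Suc i)) \<in> E"
      proof (cases "i < k")
        case True
        then show ?thesis using vgeo_edge[OF w(2)[of k] True] by (simp add: z_def)
      next
        case False
        then have "z i = q (i - k)" "z (Suc i) = q (Suc (i - k))" using q(1) by (auto simp: z_def Suc_diff_le)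
        then show ?thesis using vgeo_edge[OF q(3), of "i - k"] False i n by (simp add: N_def)
      qed
    qed (use w(1) zN N_def in \<open>auto simp: z_def\<close>)
    have zV: "z i \<in> V" if "i \<le> N" for i using vz that by (simp add: vgeo_def)
    have qz: "qg 3 N (\<lambda>i. vertex (z i))" by (rule rgeo_qg[OF vgeo_rgeo[OF vz]])
    have zk: "z k = w k" and z0: "z 0 = b" using w(1) by (simp_all add: z_def)
    have "near D (vertex (z k)) A"
      using ND[OF qz _ _ kN] near_self[of _ A 3] z0 zN base_H y(1) by simp
    moreover have "\<exists>s. 0 \<le> s \<and> tm (vertex (w k)) (c s) \<le> D1"
    proof -
      let ?z = "\<lambda>i. if i = 0 then c 0 else if i \<le> N + 1 then vertex (z (i - 1)) else c (real n)"
      have qz': "qg C1 (N + 2) ?z" unfolding C1_def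
      proof (rule qg_extend[OF qg_mono[OF qz]])
        show "tm (vertex (z N)) (c (real n)) \<le> C" using y(2)[of n] zN d_sym[of "c (real n)"] by (simp add: C_def)
      qed (use z0 in \<open>simp_all add: C_def \<delta>_def\<close>)
      have C1: "1 \<le> C1" using qg_ge1[OF qz'] .
      define \<sigma> where "\<sigma> t = ?z (nat \<lfloor>t\<rfloor>)" for t :: real
      have qs: "quasigeodesic C1 (2 * C1) M pm {0..real (N + 2)} \<sigma>"
        unfolding \<sigma>_def using cM zV by (intro qg_quasigeodesic[OF qz']) auto
      have "\<sigma> 0 = c 0" by (simp add: \<sigma>_def)
      moreover have "\<sigma> (real (N + 2)) = c (real n)" unfolding \<sigma>_def floor_of_nat nat_int by simp
      ultimately have "\<sigma> 0 \<in> c ` {0..}" "\<sigma> (real (N + 2)) \<in> c ` {0..}" by auto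
      then have "\<exists>s\<in>{0..}. pm (\<sigma> (real (Suc k))) (c s) \<le> f1 C1 (2 * C1)"
        using kN C1 by (intro stableD[OF st _ _ _ qs]) auto
      then obtain s where s: "0 \<le> s" "pm (\<sigma> (real (Suc k))) (c s) \<le> D1" by (auto simp: D1_def)
      have "\<sigma> (real (Suc k)) = vertex (w k)" unfolding \<sigma>_def floor_of_nat nat_int using zk kN by simp
      then show ?thesis using s tm_eq[of "vertex (w k)" "c s"] wV cM by auto
    qed
    ultimately show ?thesis using zk by simp
  qed
  define \<alpha> where "\<alpha> = interp w"
  have \<alpha>g: "geodesic M pm {0..} \<alpha>" unfolding \<alpha>_def by (rule geodesic_interp_ray[OF w(2)])
  have \<alpha>k: "\<alpha> (real k) = vertex (w k)" for k by (simp add: \<alpha>_def)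
  have \<alpha>M: "\<alpha> t \<in> M" if "0 \<le> t" for t using geodesic_image[OF \<alpha>g] that by simp
  have \<alpha>tm: "tm (\<alpha> s) (\<alpha> t) = \<bar>s - t\<bar>" if "0 \<le> s" "0 \<le> t" for s t using geodesic_tm[OF \<alpha>g] that by simp
  have \<alpha>nr: "near (D + 1) (\<alpha> t) A" if t: "0 \<le> t" for t
  proof -
    obtain n where "t \<le> real n" using real_arch_simple by blast
    then show ?thesis unfolding \<alpha>_def using interp_near[OF w(2)[of n], of D t] key t by blast
  qed
  have \<alpha>0: "\<alpha> 0 = vertex b" using \<alpha>k[of 0] w(1) by simp
  have "stable f2 M pm {0..} \<alpha>" using \<alpha>nr by (intro f2(2)[OF \<alpha>g]) simp
  then have ray: "\<alpha> \<in> morse_rays M pm (vertex b)" unfolding morse_rays_def using \<alpha>g \<alpha>0 f2(1) by blast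
  define \<xi> where "\<xi> = asymptotic `` {\<alpha>}"
  have "\<xi> \<in> morse_boundary M pm (vertex b)" unfolding morse_boundary_def \<xi>_def using ray by (rule quotientI)
  moreover have \<alpha>\<xi>: "\<alpha> \<in> \<xi>" unfolding \<xi>_def by (rule equiv_class_self[OF equiv_asymptotic ray])
  moreover have "\<exists>x. range x \<subseteq> A \<and> represents M pm (vertex b) x \<xi>"
  proof -
    have "\<forall>m. \<exists>x. x \<in> A \<and> tm (vertex (w m)) x \<le> D" using key unfolding near_def by blast
    from choice[OF this] obtain x where x: "\<And>m. x m \<in> A" "\<And>m. tm (vertex (w m)) (x m) \<le> D" by blast
    have xM: "x m \<in> M" for m using x(1) A_M by blast
    have "range x \<subseteq> stable_stratum f2 M pm (vertex b)"
    proof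
      fix p assume "p \<in> range x"
      then obtain h where h: "h \<in> H" "p = vertex h" using x(1) by auto
      show "p \<in> stable_stratum f2 M pm (vertex b)" unfolding h(2)
      proof (rule stratum_H[of D])
        show "near D (x i) A" if "qg 3 n x" "near 3 (x 0) A" "near 3 (x n) A" "i \<le> n" for n x i
          using that by (rule ND)
        show "stable f2 M pm I c" if "geodesic M pm I c" "\<And>t. t \<in> I \<Longrightarrow> near (D + 1) (c t) A" for I c
          using that by (rule f2(2))
      qed (rule h(1))
    qed
    moreover have "filterlim (\<lambda>(n, m). gromov_product pm (vertex b) (x n) (\<alpha> (real m))) at_top
       (sequentially \<times>\<^sub>F sequentially)"
      unfolding filterlim_at_top
    proof
      fix Z :: real
      obtain N where N: "Z + D \<le> real N" using real_arch_simple by blast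
      have "Z \<le> gromov_product pm (vertex b) (x n) (\<alpha> (real m))" if "N \<le> n" "N \<le> m" for n m
      proof -
        have "gromov_product pm (vertex b) (x n) (\<alpha> (real m)) =
          (tm (x n) (vertex b) + tm (\<alpha> (real m)) (vertex b) - tm (x n) (\<alpha> (real m))) / 2"
          unfolding gromov_product_def using xM \<alpha>M by (simp add: tm_eq)
        moreover have "tm (\<alpha> (real m)) (vertex b) = real m" using \<alpha>tm[of "real m" 0] \<alpha>0 by simp
        moreover have "real n - D \<le> tm (x n) (vertex b)"
          using \<alpha>tm[of "real n" 0] \<alpha>0 \<alpha>k[of n] x(2)[of n] d_tri[of "vertex (w n)" "vertex b" "x n"] by simp
        moreover have "tm (x n) (\<alpha> (real m)) \<le> D + \<bar>real n - real m\<bar>"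
          using \<alpha>tm[of "real n" "real m"] \<alpha>k[of n] x(2)[of n] d_tri[of "x n" "\<alpha> (real m)" "vertex (w n)"]
            d_sym[of "x n" "vertex (w n)"] by simp
        moreover have "real N \<le> real n" "real N \<le> real m" using that by simp_all
        ultimately show ?thesis using N by (simp add: field_simps abs_if split: if_splits)
      qed
      then show "\<forall>\<^sub>F z in sequentially \<times>\<^sub>F sequentially. Z \<le> (case z of (n, m) \<Rightarrow> gromov_product pm (vertex b) (x n) (\<alpha> (real m)))"
        unfolding eventually_prod_sequentially by (intro exI[of _ N]) simp
    qed
    ultimately have "represents M pm (vertex b) x \<xi>" unfolding represents_def using f2(1) \<alpha>\<xi> by blast
    then show ?thesis using x(1) by blast
  qed
  ultimately have "\<xi> \<in> \<Lambda>" unfolding limit_set_def by blast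
  moreover have "FHD (c ` {0..}) (\<alpha> ` {0..})"
  proof -
    \<comment> \<open>The parameters \<open>s k\<close> of points of \<open>c\<close> near
      \<open>w k\<close> tend to infinity with bounded steps, so they leave no large gap on the
      half-line; hence \<open>c\<close> is near \<open>\<alpha>\<close>, too.\<close>
    have "\<forall>k. \<exists>s. 0 \<le> s \<and> tm (vertex (w k)) (c s) \<le> D1" using key by blast
    from choice[OF this] obtain s where s: "\<And>k. 0 \<le> s k" "\<And>k. tm (vertex (w k)) (c (s k)) \<le> D1" by blast
    have \<delta>0: "0 \<le> \<delta>" by (simp add: \<delta>_def)
    have grow: "real k \<le> s k + D1 + \<delta>" for k
      using \<alpha>tm[of 0 "real k"] \<alpha>0 \<alpha>k[of k] s(2)[of k] ctm[of 0 "s k"] s(1)[of k] d_tri[of "vertex b" "vertex (w k)" "c 0"]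
        d_tri[of "c 0" "vertex (w k)" "c (s k)"] d_sym[of "vertex b" "c 0"] d_sym[of "vertex (w k)" "c (s k)"]
      by (simp add: \<delta>_def)
    have step: "\<bar>s (Suc k) - s k\<bar> \<le> 2 * D1 + 1" for k
    proof -
      have "tm (vertex (w (Suc k))) (vertex (w k)) = 1"
        using \<alpha>tm[of "real (Suc k)" "real k"] \<alpha>k[of k] \<alpha>k[of "Suc k"] by simp
      then show ?thesis
        using s(2)[of k] s(2)[of "Suc k"] ctm[OF s(1) s(1), of "Suc k" k] d_sym[of "c (s (Suc k))" "vertex (w (Suc k))"]
          d_tri[of "c (s (Suc k))" "c (s k)" "vertex (w (Suc k))"] d_tri[of "vertex (w (Suc k))" "c (s k)" "vertex (w k)"] by linarith
    qed
    have s0: "s 0 \<le> D1 + \<delta>"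
      using ctm[of 0 "s 0"] s(1)[of 0] s(2)[of 0] w(1) d_tri[of "c 0" "c (s 0)" "vertex b"] by (simp add: \<delta>_def)
    \<comment> \<open>An overshoot of \<open>2 * D1 + \<delta> + 1\<close> along \<open>c\<close>,
      then \<open>D1\<close> to the vertex.\<close>
    define B where "B = 3 * D1 + \<delta> + 1"
    have 1: "near B (c t) (\<alpha> ` {0..})" if t: "0 \<le> t" for t
    proof -
      obtain k where "t + D1 + \<delta> \<le> real k" using real_arch_simple by blast
      then have ex: "t \<le> s k" using grow[of k] by simp
      define k0 where "k0 = (LEAST k. t \<le> s k)"
      have k0: "t \<le> s k0" unfolding k0_def using ex by (rule LeastI)
      have "s k0 - t \<le> 2 * D1 + \<delta> + 1"
      proof (cases k0)
        case 0
        then show ?thesis using s0 t D1 by simp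
      next
        case (Suc k')
        then have "\<not> t \<le> s k'" using not_less_Least[of k' "\<lambda>k. t \<le> s k"] k0_def by simp
        then show ?thesis using step[of k'] Suc \<delta>0 by simp
      qed
      then have "tm (c t) (vertex (w k0)) \<le> B"
        using ctm[OF t s(1), of k0] k0 s(2)[of k0] d_tri[of "c t" "vertex (w k0)" "c (s k0)"]
          d_sym[of "c (s k0)" "vertex (w k0)"] by (simp add: B_def)
      then show ?thesis unfolding near_def using \<alpha>k[of k0] by (intro bexI[of _ "\<alpha> (real k0)"] imageI) auto
    qed
    have 2: "near B (\<alpha> t) (c ` {0..})" if t: "0 \<le> t" for t
    proof -
      define k where "k = nat \<lfloor>t\<rfloor>"
      have k: "real k \<le> t" "t \<le> real k + 1"
        using nat_floor_bounds[of t] t by (auto simp: k_def)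
      then have "tm (vertex (w k)) (\<alpha> t) \<le> 1" using \<alpha>tm[of "real k" t] t \<alpha>k[of k] by simp
      then have "tm (\<alpha> t) (c (s k)) \<le> B"
        using s(2)[of k] d_tri[of "\<alpha> t" "c (s k)" "vertex (w k)"] d_sym[of "\<alpha> t" "vertex (w k)"] D1 \<delta>0 by (simp add: B_def)
      then show ?thesis unfolding near_def using s(1)[of k] by (intro bexI[of _ "c (s k)"] imageI) auto
    qed
    have "c ` {0..} \<subseteq> M" "\<alpha> ` {0..} \<subseteq> M" using cM \<alpha>M by auto
    then show ?thesis using 1 2 by (intro iffD2[OF FHD_iff] exI[of _ B]) auto
  qed
  ultimately show ?thesis using \<alpha>\<xi> by blast
qed

section \<open>Bi-infinite geodesics in the weak hull\<close>

lemma geodesic_half: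
  assumes c: "geodesic M pm UNIV c"
  shows "geodesic M pm {0..} c" "geodesic M pm {0..} (\<lambda>t. c (- t))"
  using c unfolding geodesic_def by (auto simp: is_interval_ci)

lemma neg_half: "(\<lambda>t. c (- t)) ` {0..} = c ` {..0::real}"
proof -
  have "uminus ` {0..} = {..0::real}" by (simp add: image_uminus_atLeast)
  then show ?thesis using image_image[of c uminus "{0..}"] by simp
qed

text \<open>One half of \<open>c\<close> cannot be asymptotic to two distinct boundary points, so
  each half is asymptotic to a ray near \<open>A\<close>. Conversely, each half near
  \<open>A\<close> has a limit point, and these two differ because the halves of a geodesic
  diverge.\<close>

lemma hull_line_iff:
  assumes c: "geodesic M pm UNIV c"
  shows "(\<exists>\<xi>\<in>\<Lambda>. \<exists>\<eta>\<in>\<Lambda>. \<xi> \<noteq> \<eta> \<and> has_endpoint pm c \<xi> \<and> has_endpoint pm c \<eta>) \<longleftrightarrow> (\<exists>R. \<forall>t. near R (c t) A)"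
proof
  have sub: "c ` S \<subseteq> M" for S using geodesic_image[OF c] by blast
  have mb: "\<xi> \<in> morse_rays M pm (vertex b) // asymptotic" if "\<xi> \<in> \<Lambda>" for \<xi>
    using that unfolding limit_set_def morse_boundary_def by blast
  have raysub: "\<alpha> ` {0..} \<subseteq> M" and ray: "\<alpha> \<in> morse_rays M pm (vertex b)" if "\<xi> \<in> \<Lambda>" "\<alpha> \<in> \<xi>" for \<xi> \<alpha>
    using in_quotient_imp_subset[OF equiv_asymptotic mb[OF that(1)]] that(2) morse_ray_image by blast+
  have eqI: "\<xi> = \<eta>" if "\<xi> \<in> \<Lambda>" "\<eta> \<in> \<Lambda>" "\<alpha> \<in> \<xi>" "\<beta> \<in> \<eta>" "FHD (\<alpha> ` {0..}) (\<beta> ` {0..})" for \<xi> \<eta> \<alpha> \<beta>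
    using quotient_eqI[OF equiv_asymptotic mb[OF that(1)] mb[OF that(2)] that(3,4)] ray that by blast
  {
    assume "\<exists>\<xi>\<in>\<Lambda>. \<exists>\<eta>\<in>\<Lambda>. \<xi> \<noteq> \<eta> \<and> has_endpoint pm c \<xi> \<and> has_endpoint pm c \<eta>"
    then obtain \<xi> \<eta> where \<xi>\<eta>: "\<xi> \<in> \<Lambda>" "\<eta> \<in> \<Lambda>" "\<xi> \<noteq> \<eta>" "has_endpoint pm c \<xi>" "has_endpoint pm c \<eta>" by blast
    obtain \<alpha> where \<alpha>: "\<alpha> \<in> \<xi>" "FHD (c ` {0..}) (\<alpha> ` {0..}) \<or> FHD (c ` {..0}) (\<alpha> ` {0..})"
      using \<xi>\<eta>(4) unfolding has_endpoint_def by blast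
    obtain \<beta> where \<beta>: "\<beta> \<in> \<eta>" "FHD (c ` {0..}) (\<beta> ` {0..}) \<or> FHD (c ` {..0}) (\<beta> ` {0..})"
      using \<xi>\<eta>(5) unfolding has_endpoint_def by blast
    have not_both: "\<not> (FHD (c ` S) (\<alpha> ` {0..}) \<and> FHD (c ` S) (\<beta> ` {0..}))" for S
      using FHD_trans[OF raysub[OF \<xi>\<eta>(1) \<alpha>(1)] sub[of S] raysub[OF \<xi>\<eta>(2) \<beta>(1)]]
        FHD_sym[OF sub[of S] raysub[OF \<xi>\<eta>(1) \<alpha>(1)]] eqI[OF \<xi>\<eta>(1,2) \<alpha>(1) \<beta>(1)] \<xi>\<eta>(3) by blast
    have nS: "\<exists>R. \<forall>x\<in>c ` S. near R x A" if "FHD (c ` S) (\<alpha> ` {0..}) \<or> FHD (c ` S) (\<beta> ` {0..})" for S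
    proof -
      obtain R where "\<forall>x\<in>\<alpha> ` {0..}. near R x A" using limit_point_near[OF \<xi>\<eta>(1) \<alpha>(1)] by blast
      moreover obtain R' where "\<forall>x\<in>\<beta> ` {0..}. near R' x A" using limit_point_near[OF \<xi>\<eta>(2) \<beta>(1)] by blast
      ultimately show ?thesis
        using that near_FHD[OF sub raysub[OF \<xi>\<eta>(1) \<alpha>(1)], of S R] near_FHD[OF sub raysub[OF \<xi>\<eta>(2) \<beta>(1)], of S R'] by blast
    qed
    obtain R1 where R1: "\<forall>x\<in>c ` {0..}. near R1 x A" using nS[of "{0..}"] not_both[of "{..0}"] \<alpha>(2) \<beta>(2) by blast
    obtain R2 where R2: "\<forall>x\<in>c ` {..0}. near R2 x A" using nS[of "{..0}"] not_both[of "{0..}"] \<alpha>(2) \<beta>(2) by blast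
    have "near (max R1 R2) (c t) A" for t
    proof (cases "0 \<le> t")
      case True
      then have "near R1 (c t) A" using R1 by simp
      then show ?thesis by (rule near_mono) simp
    next
      case False
      then have "near R2 (c t) A" using R2 by simp
      then show ?thesis by (rule near_mono) simp
    qed
    then show "\<exists>R. \<forall>t. near R (c t) A" by blast
  }
  assume "\<exists>R. \<forall>t. near R (c t) A"
  then obtain R where R: "\<And>t. near R (c t) A" by blast
  obtain \<xi> \<alpha> where \<xi>: "\<xi> \<in> \<Lambda>" "\<alpha> \<in> \<xi>" "FHD (c ` {0..}) (\<alpha> ` {0..})"
    using ray_has_limit_point[OF geodesic_half(1)[OF c] R] by blast
  obtain \<eta> \<beta> where \<eta>: "\<eta> \<in> \<Lambda>" "\<beta> \<in> \<eta>" "FHD (c ` {..0}) (\<beta> ` {0..})"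
    using ray_has_limit_point[OF geodesic_half(2)[OF c] R] unfolding neg_half by blast
  have "\<xi> \<noteq> \<eta>"
  proof
    assume "\<xi> = \<eta>"
    then have "(\<alpha>, \<beta>) \<in> asymptotic" using in_quotient_imp_in_rel[OF equiv_asymptotic mb[OF \<xi>(1)]] \<xi>(2) \<eta>(2) by blast
    then have "FHD (\<alpha> ` {0..}) (\<beta> ` {0..})" by blast
    then have "FHD (c ` {0..}) (c ` {..0})"
      using FHD_trans[OF sub raysub[OF \<xi>(1,2)] raysub[OF \<eta>(1,2)] \<xi>(3)] FHD_sym[OF sub raysub[OF \<eta>(1,2)] \<eta>(3)]
        FHD_trans[OF sub raysub[OF \<eta>(1,2)] sub] by blast
    then obtain D where D: "\<forall>x\<in>c ` {0..}. \<exists>y\<in>c ` {..0}. pm x y \<le> D" unfolding finite_Hausdorff_distance_def by blast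
    have "c (\<bar>D\<bar> + 1) \<in> c ` {0..}" by (rule imageI) simp
    then obtain s where s: "s \<le> 0" "pm (c (\<bar>D\<bar> + 1)) (c s) \<le> D" using D by blast
    moreover have "pm (c (\<bar>D\<bar> + 1)) (c s) = \<bar>\<bar>D\<bar> + 1 - s\<bar>" using c unfolding geodesic_def by blast
    ultimately show False by linarith
  qed
  moreover have "has_endpoint pm c \<xi>" "has_endpoint pm c \<eta>" unfolding has_endpoint_def using \<xi> \<eta> by blast+
  ultimately show "\<exists>\<xi>\<in>\<Lambda>. \<exists>\<eta>\<in>\<Lambda>. \<xi> \<noteq> \<eta> \<and> has_endpoint pm c \<xi> \<and> has_endpoint pm c \<eta>" using \<xi>(1) \<eta>(1) by blast
qed

text \<open>This eliminates the Morse boundary: the hull is now described by distances to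
  \<open>A\<close> alone.\<close>

lemma weak_hull_eq:
  "weak_hull M pm \<Lambda> = \<Union> {range c | c. geodesic M pm UNIV c \<and> (\<exists>R. \<forall>t. near R (c t) A)}"
proof -
  have "(\<exists>c. X = range c \<and> geodesic M pm UNIV c \<and> (\<exists>\<xi>\<in>\<Lambda>. \<exists>\<eta>\<in>\<Lambda>. \<xi> \<noteq> \<eta> \<and> has_endpoint pm c \<xi> \<and> has_endpoint pm c \<eta>)) \<longleftrightarrow>
      (\<exists>c. X = range c \<and> geodesic M pm UNIV c \<and> (\<exists>R. \<forall>t. near R (c t) A))" for X
    by (rule ex_cong1) (simp cong: conj_cong add: hull_line_iff)
  then show ?thesis unfolding weak_hull_def by simp
qed

text \<open>Every point of a bi-infinite geodesic is the middle of arbitrarily long segments, and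
  the bound of \<open>morse_middle\<close> does not depend on how far their ends are from
  \<open>A\<close>.\<close>

lemma hull_near:
  "\<exists>R\<ge>0. \<forall>c. geodesic M pm UNIV c \<and> (\<exists>R. \<forall>t. near R (c t) A) \<longrightarrow> (\<forall>t. near R (c t) A)"
proof -
  obtain R where R: "0 \<le> R" and mid: "\<forall>D\<ge>0. \<exists>L. \<forall>A'\<in>{A}. \<forall>n \<gamma> i. rgeo n \<gamma> \<and> near D (\<gamma> 0) A' \<and> near D (\<gamma> n) A' \<and>
     L \<le> i \<and> i + L \<le> n \<longrightarrow> near R (\<gamma> i) A'" using morse_middle[OF morse] by blast
  have "near R (c t) A" if c: "geodesic M pm UNIV c" and D: "\<And>t. near D (c t) A" for c D t
  proof -
    have "0 \<le> max 0 D" by simp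
    from mid[rule_format, OF this] obtain L where L': "\<forall>A'\<in>{A}. \<forall>n \<gamma> i. rgeo n \<gamma> \<and> near (max 0 D) (\<gamma> 0) A' \<and>
      near (max 0 D) (\<gamma> n) A' \<and> L \<le> i \<and> i + L \<le> n \<longrightarrow> near R (\<gamma> i) A'" ..
    then have L: "\<And>n \<gamma> i. rgeo n \<gamma> \<Longrightarrow> near (max 0 D) (\<gamma> 0) A \<Longrightarrow> near (max 0 D) (\<gamma> n) A \<Longrightarrow>
       L \<le> i \<Longrightarrow> i + L \<le> n \<Longrightarrow> near R (\<gamma> i) A" by simp
    define \<gamma> where "\<gamma> i = c (t - real L + real i)" for i :: nat
    have "rgeo (2 * L) \<gamma>" unfolding rgeo_def \<gamma>_def using geodesic_tm[OF c] by simp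
    moreover have "near (max 0 D) (\<gamma> i) A" for i unfolding \<gamma>_def using near_mono[OF D] by simp
    ultimately have "near R (\<gamma> L) A" by (intro L[of "2 * L"]) auto
    then show ?thesis by (simp add: \<gamma>_def)
  qed
  then show ?thesis using R by blast
qed

end

section \<open>Cayley graphs\<close>

context connected_graph
begin

lemma M_cases:
  assumes "x \<in> M"
  obtains v where "v \<in> V" "x = vertex v"
  | u v t where "(u, v) \<in> E" "0 \<le> t" "t \<le> 1" "x = edge_point u v t"
  using assms
proof (cases rule: supp_cases)
  case (1 v)
  then have "x = vertex v" by (auto simp: vertex_def)
  then show ?thesis using 1(1) that(1) by blast
next
  case (2 u v)
  have "x w = edge_point u v (x v) w" for w
  proof -
    have "w \<noteq> u \<Longrightarrow> w \<noteq> v \<Longrightarrow> x w = 0" using 2(3) unfolding supp_def by blast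
    moreover have "x u = 1 - x v" using 2(4) by simp
    ultimately show ?thesis using 2(2) by (auto simp: edge_point_def vertex_def)
  qed
  then have "x = edge_point u v (x v)" by blast
  then show ?thesis using 2 that(2)[of u v "x v"] by simp
qed

lemma finite_ball:
  assumes "\<And>v. v \<in> V \<Longrightarrow> finite {w. (v, w) \<in> E}"
  shows "finite {v \<in> V. ed b v \<le> n}"
proof -
  have fin: "finite {v \<in> V. (b, v) \<in> E ^^ k}" for k
  proof (induction k)
    case (Suc k)
    have "{v \<in> V. (b, v) \<in> E ^^ Suc k} \<subseteq> (\<Union>u\<in>{v \<in> V. (b, v) \<in> E ^^ k}. {w. (u, w) \<in> E})"
    proof
      fix v assume "v \<in> {v \<in> V. (b, v) \<in> E ^^ Suc k}"
      then obtain u where "(b, u) \<in> E ^^ k" "(u, v) \<in> E" by (auto elim: relpow_Suc_E)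
      then show "v \<in> (\<Union>u\<in>{v \<in> V. (b, v) \<in> E ^^ k}. {w. (u, w) \<in> E})" using edge_vertices by blast
    qed
    moreover have "finite (\<Union>u\<in>{v \<in> V. (b, v) \<in> E ^^ k}. {w. (u, w) \<in> E})" using Suc assms by blast
    ultimately show ?case by (rule finite_subset)
  qed (auto intro: finite_subset[of _ "{b}"])
  have "{v \<in> V. ed b v \<le> n} \<subseteq> (\<Union>k\<in>{..n}. {v \<in> V. (b, v) \<in> E ^^ k})"
    using ed_relpow[OF base] by blast
  then show ?thesis by (rule finite_subset) (use fin in blast)
qed

lemma close_set_distance:
  assumes "J \<subseteq> M" "K \<subseteq> M" "close r J K" shows "set_distance pm J K \<le> r"
proof -
  obtain x y where xy: "x \<in> J" "y \<in> K" "tm x y \<le> r" using assms(3) unfolding close_def by blast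
  have "0 \<le> pm x y" if "x \<in> J" "y \<in> K" for x y using d_nonneg[of x y] tm_eq assms(1,2) that by (metis subsetD)
  then have "bdd_below {pm x y | x y. x \<in> J \<and> y \<in> K}" by (intro bdd_belowI[of _ 0]) auto
  moreover have "pm x y \<in> {pm x y | x y. x \<in> J \<and> y \<in> K}" using xy by blast
  ultimately have "set_distance pm J K \<le> pm x y" unfolding set_distance_def by (rule cInf_lower[rotated])
  also have "pm x y = tm x y" using tm_eq assms(1,2) xy by (metis subsetD)
  finally show ?thesis using xy(3) by simp
qed

text \<open>The infimum in \<open>set_distance\<close> need not be attained by arbitrary sets, hence
  the \<open>1\<close>.\<close>

lemma set_distance_close:
  assumes J: "J \<subseteq> M" "J \<noteq> {}" and K: "K \<subseteq> M" "K \<noteq> {}" and r: "set_distance pm J K \<le> r"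
  shows "close (r + 1) J K"
proof -
  have "Inf {pm x y | x y. x \<in> J \<and> y \<in> K} < r + 1" using r unfolding set_distance_def by simp
  moreover have "{pm x y | x y. x \<in> J \<and> y \<in> K} \<noteq> {}" using J(2) K(2) by blast
  ultimately have "\<exists>z\<in>{pm x y | x y. x \<in> J \<and> y \<in> K}. z < r + 1" by (intro cInf_lessD)
  then obtain x y where xy: "x \<in> J" "y \<in> K" "pm x y < r + 1" by blast
  have "x \<in> M" "y \<in> M" using xy J(1) K(1) by blast+
  then have "tm x y \<le> r + 1" using tm_eq[of x y] xy(3) by simp
  then show ?thesis unfolding close_def using xy by blast
qed

lemma near_iff_close: "near r x A \<longleftrightarrow> close r {x} A"
  unfolding near_def close_def by blast

end

lemma cayley_edges_translate:
  fixes G (structure)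
  assumes "group G" "S \<subseteq> carrier G" "g \<in> carrier G" "(u, v) \<in> cayley_edges G S"
  shows "(g \<otimes> u, g \<otimes> v) \<in> cayley_edges G S"
proof -
  interpret group G by fact
  obtain s where s: "s \<in> S" "v = u \<otimes> s \<or> u = v \<otimes> s" and uv: "u \<in> carrier G" "v \<in> carrier G" "u \<noteq> v"
    using assms(4) unfolding cayley_edges_def by blast
  have "s \<in> carrier G" using s(1) assms(2) by blast
  then have "g \<otimes> v = (g \<otimes> u) \<otimes> s \<or> g \<otimes> u = (g \<otimes> v) \<otimes> s"
    using s(2) uv assms(3) by (auto simp: m_assoc)
  then show ?thesis unfolding cayley_edges_def using uv assms(3) s(1) by auto
qed

lemma connected_graph_cayley:
  fixes G (structure)
  assumes "group G" "finite_generating_set G S"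
  shows "connected_graph (carrier G) (cayley_edges G S) \<one>"
proof -
  interpret group G by fact
  have S: "S \<subseteq> carrier G" "generate G S = carrier G" using assms(2) unfolding finite_generating_set_def by auto
  let ?E = "cayley_edges G S"
  have tr: "(g \<otimes> u, g \<otimes> v) \<in> ?E\<^sup>*" if "(u, v) \<in> ?E\<^sup>*" "g \<in> carrier G" for g u v
    using that(1)
  proof induction
    case (step v w)
    then show ?case using cayley_edges_translate[OF assms(1) S(1) that(2) step(2)] by (meson rtrancl.rtrancl_into_rtrancl)
  qed simp
  have gen: "(\<one>, g) \<in> ?E\<^sup>*" if "g \<in> generate G S" for g
    using that
  proof (induction g rule: generate.induct)
    case one
    then show ?case by simp
  next
    case (incl h)
    have hc: "h \<in> carrier G" using incl S by blast
    show ?case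
    proof (cases "h = \<one>")
      case False
      have "h = \<one> \<otimes> h" using hc by simp
      then have "(\<one>, h) \<in> ?E" unfolding cayley_edges_def using False incl hc by (auto intro!: bexI[of _ h])
      then show ?thesis by blast
    qed simp
  next
    case (inv h)
    have hc: "h \<in> carrier G" using inv S by blast
    show ?case
    proof (cases "inv h = \<one>")
      case False
      have "\<one> = inv h \<otimes> h" "\<one> \<in> carrier G" "inv h \<in> carrier G" using hc by simp_all
      then have "(\<one>, inv h) \<in> ?E" unfolding cayley_edges_def mem_Collect_eq prod.case using False[symmetric] inv by blast
      then show ?thesis by blast
    qed simp
  next
    \<comment> \<open>A path to \<open>h1\<close>, followed by the translate by \<open>h1\<close> of
      a path to \<open>h2\<close>.\<close>
    case (eng h1 h2)
    have "h1 \<in> carrier G" using eng(1) S by blast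
    then have "(h1, h1 \<otimes> h2) \<in> ?E\<^sup>*" using tr[OF eng(4)] by fastforce
    then show ?case using eng(3) by simp
  qed
  show ?thesis
  proof
    show "\<one> \<in> carrier G" by simp
    show "u \<in> carrier G \<and> v \<in> carrier G" if "(u, v) \<in> ?E" for u v using that unfolding cayley_edges_def by blast
    show "(v, u) \<in> ?E" if "(u, v) \<in> ?E" for u v using that unfolding cayley_edges_def by blast
    show "(u, u) \<notin> ?E" for u unfolding cayley_edges_def by blast
    show "\<exists>n. (u, v) \<in> ?E ^^ n" if "u \<in> carrier G" "v \<in> carrier G" for u v
    proof -
      have "(\<one>, inv u \<otimes> v) \<in> ?E\<^sup>*" using gen S that by simp
      from tr[OF this that(1)] have "(u, v) \<in> ?E\<^sup>*" using that by (simp add: m_assoc[symmetric])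
      then show ?thesis by (simp add: rtrancl_is_UN_relpow)
    qed
  qed
qed

locale cayley =
  fixes G :: "('a, 'm) monoid_scheme" (structure) and S
  assumes group: "group G" and generating: "finite_generating_set G S"

sublocale cayley \<subseteq> group G by (rule group)
sublocale cayley \<subseteq> connected_graph "carrier G" "cayley_edges G S" "\<one>"
  by (rule connected_graph_cayley[OF group generating])

context cayley
begin

abbreviation "E \<equiv> cayley_edges G S"
abbreviation "tr \<equiv> translate G"

lemma S_carrier: "S \<subseteq> carrier G" and finite_S: "finite S"
  using generating unfolding finite_generating_set_def by auto

lemma finite_neighbours: assumes "v \<in> carrier G" shows "finite {w. (v, w) \<in> E}"
proof (rule finite_subset)
  show "{w. (v, w) \<in> E} \<subseteq> (\<lambda>s. v \<otimes> s) ` S \<union> (\<lambda>s. v \<otimes> inv s) ` S"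
  proof
    fix w assume "w \<in> {w. (v, w) \<in> E}"
    then obtain s where s: "s \<in> S" "w = v \<otimes> s \<or> v = w \<otimes> s" "w \<in> carrier G" unfolding cayley_edges_def by blast
    then have "w = v \<otimes> s \<or> w = v \<otimes> inv s" using S_carrier assms inv_solve_right[of w v s] by auto
    then show "w \<in> (\<lambda>s. v \<otimes> s) ` S \<union> (\<lambda>s. v \<otimes> inv s) ` S" using s(1) by blast
  qed
qed (use finite_S in simp)

section \<open>Translations as isometries of the Cayley graph\<close>

lemma tr_edge_point:
  assumes "g \<in> carrier G" "u \<in> carrier G" "v \<in> carrier G"
  shows "tr g (edge_point u v t) = edge_point (g \<otimes> u) (g \<otimes> v) t"
proof
  fix w
  have "inv g \<otimes> w = u \<longleftrightarrow> w = g \<otimes> u" if "w \<in> carrier G" "u \<in> carrier G" for u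
    using inv_solve_left[of u g w] that assms(1) by auto
  then show "tr g (edge_point u v t) w = edge_point (g \<otimes> u) (g \<otimes> v) t w"
    using assms by (auto simp: translate_def edge_point_def vertex_def)
qed

lemma tr_vertex: "g \<in> carrier G \<Longrightarrow> u \<in> carrier G \<Longrightarrow> tr g (vertex u) = vertex (g \<otimes> u)"
  using tr_edge_point[of g u u 0] by simp

lemma tr_in_M: assumes g: "g \<in> carrier G" and x: "x \<in> M" shows "tr g x \<in> M"
  using x
proof (cases rule: M_cases)
  case (1 v)
  then show ?thesis using tr_vertex g by simp
next
  case (2 u v t)
  then show ?thesis
    using tr_edge_point[OF g] edge_vertices[OF 2(1)] edge_point_in_M(1)[OF cayley_edges_translate[OF group S_carrier g 2(1)]] by simp
qed

lemma tr_apply: "g \<in> carrier G \<Longrightarrow> v \<in> carrier G \<Longrightarrow> tr g x (g \<otimes> v) = x v"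
  by (simp add: translate_def m_assoc[symmetric])

lemma supp_tr: assumes g: "g \<in> carrier G" and x: "x \<in> M" shows "supp (tr g x) = (\<lambda>v. g \<otimes> v) ` supp x"
proof
  show "supp (tr g x) \<subseteq> (\<lambda>v. g \<otimes> v) ` supp x"
  proof
    fix w assume "w \<in> supp (tr g x)"
    then have "w \<in> carrier G" "inv g \<otimes> w \<in> supp x" unfolding supp_def translate_def by (auto split: if_splits)
    moreover have "g \<otimes> (inv g \<otimes> w) = w" using g \<open>w \<in> carrier G\<close> by (simp add: m_assoc[symmetric])
    ultimately show "w \<in> (\<lambda>v. g \<otimes> v) ` supp x" by (metis imageI)
  qed
  show "(\<lambda>v. g \<otimes> v) ` supp x \<subseteq> supp (tr g x)"
    using tr_apply[OF g] supp_props(3)[OF x] unfolding supp_def by auto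
qed

lemma tr_tr: "g \<in> carrier G \<Longrightarrow> h \<in> carrier G \<Longrightarrow> tr g (tr h x) = tr (g \<otimes> h) x"
  unfolding translate_def by (auto simp: inv_mult_group m_assoc)

lemma tr_one: assumes "x \<in> M" shows "tr \<one> x = x"
proof
  fix v show "tr \<one> x v = x v" using supp_props(3)[OF assms] unfolding translate_def supp_def by auto
qed

lemma ed_tr_le: assumes g: "g \<in> carrier G" and uv: "u \<in> carrier G" "v \<in> carrier G"
  shows "ed (g \<otimes> u) (g \<otimes> v) \<le> ed u v"
proof (rule ed_le)
  have "(g \<otimes> u, g \<otimes> v) \<in> E ^^ n" if "(u, v) \<in> E ^^ n" for n v
    using that
  proof (induction n arbitrary: v)
    case (Suc n)
    from Suc.prems obtain w where "(u, w) \<in> E ^^ n" "(w, v) \<in> E" by (rule relpow_Suc_E)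
    then show ?case using Suc.IH cayley_edges_translate[OF group S_carrier g] by (blast intro: relpow_Suc_I)
  qed simp
  then show "(g \<otimes> u, g \<otimes> v) \<in> E ^^ ed u v" using ed_relpow[OF uv] by blast
qed

text \<open>Translations do not increase the path metric; the same for \<open>inv g\<close> gives
  equality.\<close>

lemma tm_tr:
  assumes g: "g \<in> carrier G" and x: "x \<in> M" and y: "y \<in> M" shows "tm (tr g x) (tr g y) = tm x y"
proof -
  have le: "pm (tr g x) (tr g y) \<le> pm x y" if g: "g \<in> carrier G" and x: "x \<in> M" and y: "y \<in> M" for g x y
  proof (cases "same x y")
    case True
    with x y show ?thesis
    proof (cases rule: same_cases)
      case 1
      then show ?thesis using pm_refl y tr_in_M g by simp
    next
      case (2 u v)
      have V: "u \<in> carrier G" "v \<in> carrier G" using edge_vertices[OF 2(1)] by blast+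
      have "supp (tr g x) \<union> supp (tr g y) = {g \<otimes> u, g \<otimes> v}"
        unfolding supp_tr[OF g x] supp_tr[OF g y] image_Un[symmetric] 2(2) by simp
      then have "pm (tr g x) (tr g y) = \<bar>tr g x (g \<otimes> u) - tr g y (g \<otimes> u)\<bar>"
        using pm_edge[OF tr_in_M[OF g x] tr_in_M[OF g y] cayley_edges_translate[OF group S_carrier g 2(1)]] by simp
      then show ?thesis using pm_edge[OF x y 2(1)] 2(2) tr_apply[OF g V(1)] by simp
    qed
  next
    case False
    with x y obtain u v where uv: "u \<in> supp x" "v \<in> supp y" "pm x y = cost x y u v" by (rule pm_eq_cost)
    have V: "u \<in> carrier G" "v \<in> carrier G" using uv supp_props(3) x y by blast+
    have "pm (tr g x) (tr g y) \<le> cost (tr g x) (tr g y) (g \<otimes> u) (g \<otimes> v)"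
      using uv supp_tr g x y by (intro pm_le_cost tr_in_M) auto
    then show ?thesis using uv(3) tr_apply[OF g] V ed_tr_le[OF g V] by simp
  qed
  have ig: "inv g \<in> carrier G" using g by simp
  have inv: "tr (inv g) (tr g x) = x" if "x \<in> M" for x using tr_tr[OF ig g] tr_one[OF that] g by simp
  have "pm x y \<le> pm (tr g x) (tr g y)"
    using le[OF ig tr_in_M[OF g x] tr_in_M[OF g y]] inv x y by simp
  then show ?thesis using le[OF g x y] tm_eq tr_in_M g x y by simp
qed

lemma geodesic_tr:
  assumes g: "g \<in> carrier G" and c: "geodesic M pm I c" shows "geodesic M pm I (\<lambda>t. tr g (c t))"
proof -
  have "pm (tr g (c s)) (tr g (c t)) = pm (c s) (c t)" if "s \<in> I" "t \<in> I" for s t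
  proof -
    have "c s \<in> M" "c t \<in> M" using c that unfolding geodesic_def by blast+
    then show ?thesis using tm_tr[OF g, of "c s" "c t"] tm_eq tr_in_M[OF g] by simp
  qed
  then show ?thesis using c tr_in_M[OF g] unfolding geodesic_def by (simp add: Pi_iff)
qed

lemma near_tr:
  assumes g: "g \<in> carrier G" and x: "x \<in> M" and A: "A \<subseteq> M" and n: "near r x A" shows "near r (tr g x) (tr g ` A)"
proof -
  obtain y where y: "y \<in> A" "tm x y \<le> r" using n unfolding near_def by blast
  then have "tm (tr g x) (tr g y) \<le> r" using tm_tr[OF g x, of y] A by auto
  then show ?thesis using y(1) unfolding near_def by blast
qed

end

locale cayley_morse = cayley +
  fixes H
  assumes sub: "subgroup H G"
    and morse_H: "morse_family {vertex ` H}"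

sublocale cayley_morse \<subseteq> morse_subset "carrier G" "cayley_edges G S" "\<one>" H
  by unfold_locales (use subgroup.one_closed[OF sub] subgroup.subset[OF sub] finite_neighbours morse_H in auto)

context cayley_morse
begin

definition line :: "(real \<Rightarrow> 'a \<Rightarrow> real) \<Rightarrow> bool"
  where "line c \<longleftrightarrow> geodesic M pm UNIV c \<and> (\<exists>R. \<forall>t. near R (c t) A)"

text \<open>The weak hull, by \<open>weak_hull_eq\<close>, in a form that is easy to translate:
  limit sets refer to rays from a fixed basepoint, which translations move.\<close>

definition lhull :: "('a \<Rightarrow> real) set"
  where "lhull = \<Union> {range c | c. line c}"

abbreviation "\<J> \<equiv> (\<lambda>g. tr g ` lhull) ` carrier G"

lemma hull_translates_eq: "hull_translates G S H = \<J>"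
proof -
  have "(\<lambda>h. tr h (vertex \<one>)) ` H = A" using tr_vertex HV by (intro image_cong) auto
  then have "weak_hull (cayley_graph G S) (cayley_dist G S) (subgroup_limit_set G S H) = lhull"
    unfolding subgroup_limit_set_def cayley_graph_def cayley_dist_def lhull_def line_def weak_hull_eq[symmetric] by simp
  then show ?thesis unfolding hull_translates_def by simp
qed

lemma hull_M: "lhull \<subseteq> M"
  unfolding lhull_def line_def using geodesic_image by blast

lemma \<J>_M: "J \<in> \<J> \<Longrightarrow> J \<subseteq> M"
  using hull_M tr_in_M by blast

lemma ex_hull_near: "\<exists>R\<ge>0. \<forall>x\<in>lhull. near R x A"
proof -
  obtain R where R: "0 \<le> R" "\<forall>c. geodesic M pm UNIV c \<and> (\<exists>R. \<forall>t. near R (c t) A) \<longrightarrow> (\<forall>t. near R (c t) A)"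
    using hull_near by blast
  then have "near R x A" if "x \<in> lhull" for x using that unfolding lhull_def line_def by blast
  then show ?thesis using R(1) by blast
qed

lemma tr_A: assumes h: "h \<in> H" shows "tr h ` A \<subseteq> A"
  using tr_vertex HV h subgroup.m_closed[OF sub h] by (auto simp: subset_iff)

text \<open>Translations preserve geodesics, so only the bounded distance to \<open>A\<close> is in
  question. It is preserved by elements of \<open>H\<close>, and by all elements if \<open>A\<close>
  is coarsely dense.\<close>

lemma tr_hull_subset:
  assumes g: "g \<in> carrier G" and l: "\<And>c. line c \<Longrightarrow> \<exists>R. \<forall>t. near R (tr g (c t)) A"
  shows "tr g ` lhull \<subseteq> lhull"
proof
  fix y assume "y \<in> tr g ` lhull"
  then obtain c t where c: "line c" "y = tr g (c t)" unfolding lhull_def by blast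
  have "line (\<lambda>t. tr g (c t))" unfolding line_def using geodesic_tr[OF g] c(1) l[OF c(1)] unfolding line_def by blast
  then show "y \<in> lhull" unfolding lhull_def using c(2) by blast
qed

lemma tr_image_tr: "g \<in> carrier G \<Longrightarrow> h \<in> carrier G \<Longrightarrow> tr g ` tr h ` X = tr (g \<otimes> h) ` X"
  by (simp add: image_image tr_tr)

lemma tr_image_one: "X \<subseteq> M \<Longrightarrow> tr \<one> ` X = X"
  using tr_one by (force simp: subset_iff)

lemma tr_hull_eq:
  assumes g: "g \<in> carrier G" and "tr g ` lhull \<subseteq> lhull" "tr (inv g) ` lhull \<subseteq> lhull"
  shows "tr g ` lhull = lhull"
proof
  have "lhull = tr g ` tr (inv g) ` lhull" using tr_image_tr tr_image_one[OF hull_M] g by simp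
  then show "lhull \<subseteq> tr g ` lhull" using assms(3) by blast
qed (rule assms(2))

lemma tr_H_hull: assumes h: "h \<in> H" shows "tr h ` lhull = lhull"
proof -
  have "tr h ` lhull \<subseteq> lhull" if h: "h \<in> H" for h
  proof (rule tr_hull_subset)
    show hc: "h \<in> carrier G" using h HV by blast
    fix c assume c: "line c"
    then obtain R where R: "\<And>t. near R (c t) A" unfolding line_def by blast
    have "near R (tr h (c t)) A" for t
    proof -
      have "c t \<in> M" using c geodesic_image unfolding line_def by blast
      from near_tr[OF hc this A_M R] show ?thesis using tr_A[OF h] unfolding near_def by blast
    qed
    then show "\<exists>R. \<forall>t. near R (tr h (c t)) A" by blast
  qed
  moreover have "inv h \<in> H" using subgroup.m_inv_closed[OF sub h] .
  ultimately show ?thesis using tr_hull_eq h HV by blast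
qed

text \<open>\<open>H\<close> acts transitively on \<open>A\<close> and preserves the hull, so one
  point of the hull, being near \<open>A\<close>, suffices.\<close>

lemma A_near_hull: assumes "lhull \<noteq> {}" shows "\<exists>R\<ge>0. \<forall>x\<in>A. near R x lhull"
proof -
  obtain R where R: "0 \<le> R" "\<And>x. x \<in> lhull \<Longrightarrow> near R x A" using ex_hull_near by blast
  obtain x where x: "x \<in> lhull" using assms by blast
  then have xM: "x \<in> M" using hull_M by blast
  obtain k where k: "k \<in> H" "tm x (vertex k) \<le> R" using R(2)[OF x] unfolding near_def by blast
  have "near R (vertex h) lhull" if h: "h \<in> H" for h
  proof -
    define g where "g = h \<otimes> inv k"
    have c: "h \<in> carrier G" "k \<in> carrier G" using h k HV by blast+
    have gH: "g \<in> H" unfolding g_def using h k subgroup.m_closed[OF sub] subgroup.m_inv_closed[OF sub] by blast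
    then have gc: "g \<in> carrier G" using HV by blast
    have "g \<otimes> k = h" using c by (simp add: g_def m_assoc)
    then have "tm (tr g x) (vertex h) = tm x (vertex k)" using tm_tr[OF gc xM, of "vertex k"] tr_vertex[OF gc c(2)] c(2) by simp
    moreover have "tr g x \<in> lhull" using tr_H_hull[OF gH] x by blast
    ultimately show ?thesis unfolding near_def using k(2) d_sym[of "vertex h" "tr g x"] by (intro bexI[of _ "tr g x"]) auto
  qed
  then show ?thesis using R(1) by blast
qed

end

locale cayley_pattern = cayley_morse +
  assumes nondegenerate: "\<exists>J\<in>(\<lambda>g. translate G g ` lhull) ` carrier G. \<exists>K\<in>(\<lambda>g. translate G g ` lhull) ` carrier G. J \<noteq> K"
begin

lemma hull_nonempty: "lhull \<noteq> {}"
  using nondegenerate by auto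

lemma \<J>_nonempty: "J \<in> \<J> \<Longrightarrow> J \<noteq> {}"
  using hull_nonempty by blast

text \<open>If \<open>\<J>\<close> were finite, the stabilizer of the hull, hence \<open>H\<close>, would be coarsely dense; then every
  bi-infinite geodesic would lie in the hull, which would be invariant under translations.\<close>

lemma infinite_\<J>: "infinite \<J>"
proof
  assume fin: "finite \<J>"
  obtain x where x: "x \<in> lhull" using hull_nonempty by blast
  have xM: "x \<in> M" using x hull_M by blast
  obtain R where R: "0 \<le> R" "\<And>x. x \<in> lhull \<Longrightarrow> near R x A" using ex_hull_near by blast
  have "\<forall>J\<in>\<J>. \<exists>k. k \<in> carrier G \<and> J = tr k ` lhull" by blast
  from bchoice[OF this] obtain k where kk: "\<forall>J\<in>\<J>. k J \<in> carrier G \<and> J = tr (k J) ` lhull" ..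
  have k: "k J \<in> carrier G" "J = tr (k J) ` lhull" if "J \<in> \<J>" for J
    using bspec[OF kk that] by (rule conjunct1, rule conjunct2)
  define C where "C = Max ((\<lambda>J. tm (vertex \<one>) (tr (k J) x)) ` \<J>)"
  have C: "tm (vertex \<one>) (tr (k J) x) \<le> C" if "J \<in> \<J>" for J
    unfolding C_def using fin that by (intro Max_ge) auto
  \<comment> \<open>For \<open>J\<close> the translate by \<open>inv g\<close>, the element
    \<open>g \<otimes> k J\<close> stabilizes the hull and moves \<open>x\<close> to within
    \<open>C\<close> of \<open>g\<close>; finitely many \<open>k J\<close> make \<open>C\<close>
    uniform.\<close>
  have vn: "near (R + C) (vertex g) A" if g: "g \<in> carrier G" for g
  proof -
    define J where "J = tr (inv g) ` lhull"
    have J: "J \<in> \<J>" using g by (auto simp: J_def)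
    have kc: "k J \<in> carrier G" using k(1)[OF J] .
    have "tr g ` J = lhull" using tr_image_tr[OF g, of "inv g"] tr_image_one[OF hull_M] g by (simp add: J_def)
    then have "tr (g \<otimes> k J) ` lhull = lhull" using k(2)[OF J] tr_image_tr[OF g kc, of lhull] by simp
    then have "tr g (tr (k J) x) \<in> lhull" using x tr_tr[OF g kc] by auto
    then have n: "near R (tr g (tr (k J) x)) A" by (rule R(2))
    have "tm (vertex g) (tr g (tr (k J) x)) = tm (vertex \<one>) (tr (k J) x)"
      using tm_tr[OF g, of "vertex \<one>" "tr (k J) x"] tr_vertex[OF g one_closed] tr_in_M[OF kc xM] g by simp
    then show ?thesis using near_trans[OF n, of "vertex g" C] C[OF J] by simp
  qed
  have dense: "near (R + C + 1) y A" for y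
  proof -
    obtain u where "u \<in> carrier G" "tm y (vertex u) \<le> 1" using ex_near_vertex by blast
    then show ?thesis using near_trans[OF vn] by blast
  qed
  have "tr g ` lhull \<subseteq> lhull" if "g \<in> carrier G" for g using tr_hull_subset[OF that] dense by blast
  then have "tr g ` lhull = lhull" if "g \<in> carrier G" for g using tr_hull_eq[OF that] that by blast
  then show False using nondegenerate by blast
qed

text \<open>Any element of its coset determines a translate, because \<open>H\<close> stabilizes the
  hull. A translate near \<open>x\<close> has such an element near \<open>x\<close>, and balls are
  finite with a size that does not depend on the vertex at their centre.\<close>

lemma locally_finite_\<J>: "\<exists>m. \<forall>x. finite {J\<in>\<J>. near R x J} \<and> card {J\<in>\<J>. near R x J} \<le> m"
proof -
  obtain R0 where R0: "0 \<le> R0" "\<And>x. x \<in> lhull \<Longrightarrow> near R0 x A" using ex_hull_near by blast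
  \<comment> \<open>\<open>R\<close> from \<open>x\<close> to the translate, \<open>R0\<close> from
    there to the coset, \<open>1\<close> from \<open>x\<close> to a vertex.\<close>
  define n where "n = nat \<lceil>R + R0 + 1\<rceil>"
  define B where "B = {v \<in> carrier G. ed \<one> v \<le> n}"
  have fB: "finite B" unfolding B_def by (rule finite_ball[OF finite_neighbours])
  have "{J\<in>\<J>. near R x J} \<subseteq> (\<lambda>v. tr (u \<otimes> v) ` lhull) ` B" if u: "u \<in> carrier G" "tm x (vertex u) \<le> 1" for x u
  proof
    fix J assume "J \<in> {J\<in>\<J>. near R x J}"
    then obtain g y where g: "g \<in> carrier G" "J = tr g ` lhull" and y: "y \<in> lhull" "tm x (tr g y) \<le> R"
      unfolding near_def by blast
    obtain h where h: "h \<in> H" "tm y (vertex h) \<le> R0" using R0(2)[OF y(1)] unfolding near_def by blast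
    have hc: "h \<in> carrier G" using h(1) HV by blast
    have yM: "y \<in> M" using y(1) hull_M by blast
    define v where "v = inv u \<otimes> (g \<otimes> h)"
    have vc: "v \<in> carrier G" using u g hc by (simp add: v_def)
    have uv: "u \<otimes> v = g \<otimes> h" using u g hc by (simp add: v_def m_assoc[symmetric])
    have "tm (tr g y) (vertex (g \<otimes> h)) \<le> R0" using tm_tr[OF g(1) yM, of "vertex h"] tr_vertex[OF g(1) hc] h(2) hc by simp
    then have "tm (vertex u) (vertex (g \<otimes> h)) \<le> R + R0 + 1"
      using d_tri[of "vertex u" "vertex (g \<otimes> h)" x] d_tri[of x "vertex (g \<otimes> h)" "tr g y"] u(2) y(2) d_sym[of "vertex u" x] by simp
    moreover have "tm (vertex \<one>) (vertex v) = tm (vertex u) (vertex (u \<otimes> v))"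
      using tm_tr[OF u(1), of "vertex \<one>" "vertex v"] tr_vertex[OF u(1)] vc u(1) by simp
    ultimately have "real (ed \<one> v) \<le> R + R0 + 1" using tm_vertex[OF one_closed vc] uv by simp
    then have "v \<in> B" using vc unfolding B_def n_def by (simp add: le_nat_iff) linarith
    moreover have "J = tr (u \<otimes> v) ` lhull" unfolding uv using g(2) tr_image_tr[OF g(1) hc, of lhull] tr_H_hull[OF h(1)] by simp
    ultimately show "J \<in> (\<lambda>v. tr (u \<otimes> v) ` lhull) ` B" by blast
  qed
  note * = this
  have "finite {J\<in>\<J>. near R x J} \<and> card {J\<in>\<J>. near R x J} \<le> card B" for x
  proof -
    obtain u where "u \<in> carrier G" "tm x (vertex u) \<le> 1" using ex_near_vertex by blast
    then have u: "{J\<in>\<J>. near R x J} \<subseteq> (\<lambda>v. tr (u \<otimes> v) ` lhull) ` B" by (rule *)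
    have "finite ((\<lambda>v. tr (u \<otimes> v) ` lhull) ` B)" using fB by (rule finite_imageI)
    then show ?thesis using u card_mono[OF _ u] card_image_le[OF fB] finite_subset[OF u] by (meson order_trans)
  qed
  then show ?thesis by blast
qed

text \<open>Infinitely many translates provide \<open>m\<close> of them within some distance of the
  identity; a translation carries these injectively to members near any other point.\<close>

lemma rich_\<J>: "\<exists>N. \<forall>x. m \<le> card {J\<in>\<J>. near N x J}"
proof -
  obtain F where F: "finite F" "card F = m" "F \<subseteq> \<J>" using infinite_arbitrarily_large[OF infinite_\<J>, of m] by (elim exE conjE)
  have "\<forall>J\<in>F. \<exists>r. near r (vertex \<one>) J"
  proof
    fix J assume "J \<in> F"
    then obtain y where "y \<in> J" using F(3) \<J>_nonempty by blast
    then have "near (tm (vertex \<one>) y) (vertex \<one>) J" unfolding near_def by blast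
    then show "\<exists>r. near r (vertex \<one>) J" by blast
  qed
  from bchoice[OF this] obtain r where r: "\<And>J. J \<in> F \<Longrightarrow> near (r J) (vertex \<one>) J" by blast
  define N where "N = Max (r ` F)"
  have N: "near N (vertex \<one>) J" if "J \<in> F" for J
    using r[OF that] F(1) that by (rule_tac near_mono) (auto simp: N_def)
  have "m \<le> card {J\<in>\<J>. near (N + 1) x J}" for x
  proof -
    obtain u where u: "u \<in> carrier G" "tm x (vertex u) \<le> 1" using ex_near_vertex by blast
    have inj: "inj_on (\<lambda>J. tr u ` J) F"
    proof (rule inj_on_inverseI)
      fix J assume "J \<in> F"
      then have "J \<subseteq> M" using F(3) \<J>_M by blast
      then show "tr (inv u) ` tr u ` J = J" using tr_image_tr[of "inv u" u J] tr_image_one u(1) by simp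
    qed
    have "(\<lambda>J. tr u ` J) ` F \<subseteq> {J\<in>\<J>. near (N + 1) x J}"
    proof
      fix K assume "K \<in> (\<lambda>J. tr u ` J) ` F"
      then obtain J where J: "J \<in> F" "K = tr u ` J" by blast
      then obtain g where g: "g \<in> carrier G" "J = tr g ` lhull" using F(3) by blast
      have "K = tr (u \<otimes> g) ` lhull" using J(2) g tr_image_tr[OF u(1) g(1)] by simp
      then have "K \<in> \<J>" using u(1) g(1) by blast
      moreover have "near N (tr u (vertex \<one>)) K" unfolding J(2)
        using \<J>_M[OF subsetD[OF F(3) J(1)]] by (intro near_tr[OF u(1) _ _ N[OF J(1)]]) auto
      then have "near (N + 1) x K" using near_trans u(2) tr_vertex[OF u(1) one_closed] u(1) by simp
      ultimately show "K \<in> {J\<in>\<J>. near (N + 1) x J}" by blast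
    qed
    moreover have "finite {J\<in>\<J>. near (N + 1) x J}" using locally_finite_\<J>[of "N + 1"] by blast
    ultimately have "card ((\<lambda>J. tr u ` J) ` F) \<le> card {J\<in>\<J>. near (N + 1) x J}" by (rule card_mono[rotated])
    then show ?thesis using card_image[OF inj] F(2) by simp
  qed
  then show ?thesis by blast
qed

text \<open>The Morse property passes from \<open>A\<close> to the hull, which is at finite
  Hausdorff distance, and to its translates by isometries, with constants independent of the
  translate.\<close>

lemma morse_\<J>: "morse_family \<J>"
  unfolding morse_family_def
proof
  fix C :: real
  obtain R0 where R0: "0 \<le> R0" "\<And>x. x \<in> lhull \<Longrightarrow> near R0 x A" using ex_hull_near by blast
  obtain R1 where R1: "0 \<le> R1" "\<And>x. x \<in> A \<Longrightarrow> near R1 x lhull" using A_near_hull[OF hull_nonempty] by blast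
  define C' where "C' = C + R0"
  obtain D where D: "0 \<le> D" and mb: "morse_bound C' D A"
    using morse_H unfolding morse_family_def by blast
  show "\<exists>D\<ge>0. \<forall>J\<in>\<J>. morse_bound C D J"
    unfolding morse_bound_def
  proof (rule exI[of _ "D + R1"], rule conjI, use D R1(1) in simp, intro ballI allI impI)
    fix J n x m y i assume J: "J \<in> \<J>" and i: "i \<le> n"
      and h: "qg C n x" "qg C m y" "x 0 = y 0" "x n = y m" "near C (x 0) J" "near C (x n) J"
    obtain g where g: "g \<in> carrier G" "J = tr g ` lhull" using J by blast
    have ig: "inv g \<in> carrier G" using g(1) by simp
    have JM: "J \<subseteq> M" using \<J>_M[OF J] .
    have Jh: "tr (inv g) ` J = lhull" using g tr_image_tr[OF ig g(1)] tr_image_one[OF hull_M] by simp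
    \<comment> \<open>The paths range over the whole type, but \<open>tm_tr\<close> speaks of points
      of the realization; hence \<open>retr\<close>.\<close>
    define T where "T p = tr (inv g) (retr p)" for p
    have TM: "T p \<in> M" for p unfolding T_def using tr_in_M[OF ig] by simp
    have Ttm: "tm (T p) (T q) = tm p q" for p q unfolding T_def using tm_tr[OF ig] by simp
    have Tq: "qg C' N (\<lambda>i. T (z i))" if "qg C N z" for N z
    proof (rule qg_mono[of C])
      show "qg C N (\<lambda>i. T (z i))" using that unfolding qg_def by (simp add: Ttm)
    qed (use R0(1) in \<open>simp add: C'_def\<close>)
    have Tn: "near C' (T p) A" if "near C p J" for p
    proof -
      have "near C (retr p) J" using that by simp
      from near_tr[OF ig _ JM this] have "near C (T p) lhull" by (simp add: T_def Jh)
      from near_subset_dist[OF this R0(2)] show ?thesis by (simp add: C'_def)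
    qed
    have "near D (T (x i)) A" using h i Tq Tn by (intro morse_bound_near[OF mb, of n "\<lambda>i. T (x i)" i]) auto
    from near_subset_dist[OF this R1(2)] have "near (D + R1) (T (x i)) lhull" .
    from near_tr[OF g(1) TM hull_M this] have "near (D + R1) (tr g (T (x i))) J" unfolding g(2) .
    moreover have "tr g (T (x i)) = retr (x i)" unfolding T_def using tr_tr[OF g(1) ig] tr_one g(1) by simp
    ultimately have "near (D + R1) (x i) J" by simp
    moreover have "\<exists>j\<le>m. tm (T (x i)) (T (y j)) \<le> D"
      using h i Tq Tn by (intro morse_bound_travel[OF mb, of n "\<lambda>i. T (x i)" m "\<lambda>j. T (y j)" i]) auto
    then have "\<exists>j\<le>m. tm (x i) (y j) \<le> D + R1" using Ttm R1(1) by force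
    ultimately show "near (D + R1) (x i) J \<and> (\<exists>j\<le>m. tm (x i) (y j) \<le> D + R1)" ..
  qed
qed

sublocale pattern_space tm \<J>
  by unfold_locales (rule morse_\<J>, rule \<J>_nonempty, assumption, rule locally_finite_\<J>, rule rich_\<J>)

end

lemma stable_subgroup_cayley_pattern:
  assumes G: "group G" and S: "finite_generating_set G S" and H: "stable_subgroup G S H"
    and nd: "\<exists>J \<in> hull_translates G S H. \<exists>K \<in> hull_translates G S H. J \<noteq> K"
  shows "cayley_pattern G S H"
proof -
  interpret cayley G S by (rule cayley.intro[OF G S])
  have sub: "subgroup H G" using H unfolding stable_subgroup_def by blast
  let ?K = "G\<lparr>carrier := H\<rparr>"
  let ?E = "cayley_edges ?K"
  obtain T \<iota> K e f where T: "finite_generating_set ?K T"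
    and \<iota>: "\<forall>h\<in>H. \<iota> (vertex h) = vertex h"
    and qi: "qi_embedding K e (cayley_graph ?K T) (cayley_dist ?K T) (cayley_graph G S) (cayley_dist G S) \<iota>"
    and st: "\<forall>I c. geodesic (cayley_graph ?K T) (cayley_dist ?K T) I c \<longrightarrow>
        stable f (cayley_graph G S) (cayley_dist G S) I (\<iota> \<circ> c)"
    using H unfolding stable_subgroup_def Let_def by blast
  have "group ?K" using subgroup.subgroup_is_group[OF sub G] .
  from connected_graph_cayley[OF this T]
  have Y: "connected_graph H (?E T) \<one>\<^bsub>G\<^esub>" by simp
  have mo: "morse_family {vertex ` H}"
  proof (rule morse_vertex_set[OF Y subgroup.subset[OF sub]])
    show "\<iota> (vertex h) = vertex h" if "h \<in> H" for h using \<iota> that by blast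
    show "qi_embedding K e (realization H (?E T)) (path_metric H (?E T)) M pm \<iota>"
      using qi unfolding cayley_graph_def cayley_dist_def by simp
    show "stable f M pm I (\<iota> \<circ> c)"
      if "geodesic (realization H (?E T)) (path_metric H (?E T)) I c" for I c
      using st that unfolding cayley_graph_def cayley_dist_def by simp
  qed
  interpret cayley_morse G S H
    by (rule cayley_morse.intro[OF cayley_axioms cayley_morse_axioms.intro[OF sub mo]])
  show ?thesis by unfold_locales (use nd hull_translates_eq in simp)
qed

text \<open>Without \<open>nondegenerate\<close> there are counterexamples: for hyperbolic groups
  that are not quasi-isometric, each taken as its own stable subgroup, both families have a single
  member and \<open>\<phi>\<close> is uniformly proper. The hypothesis passes to the second family
  by injectivity of \<open>\<phi>\<close>.\<close>

theorem proposition1p4: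
  fixes G1 :: "('a, 'm) monoid_scheme" and G2 :: "('b, 'n) monoid_scheme"
    and S1 H1 :: "'a set" and S2 H2 :: "'b set"
    and \<phi> :: "('a \<Rightarrow> real) set \<Rightarrow> ('b \<Rightarrow> real) set"
  assumes "group G1" and "group G2"
    and "finite_generating_set G1 S1" and "finite_generating_set G2 S2"
    and "stable_subgroup G1 S1 H1" and "stable_subgroup G2 S2 H2"
    and "uniformly_proper (cayley_dist G1 S1) (hull_translates G1 S1 H1)
           (cayley_dist G2 S2) (hull_translates G2 S2 H2) \<phi>"
    and nondegenerate:
      "\<exists>J \<in> hull_translates G1 S1 H1. \<exists>K \<in> hull_translates G1 S1 H1. J \<noteq> K"
  shows "\<exists>q. quasi_isometry (cayley_graph G1 S1) (cayley_dist G1 S1)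
               (cayley_graph G2 S2) (cayley_dist G2 S2) q \<and>
             pairs_as (cayley_graph G1 S1) (cayley_dist G1 S1) (hull_translates G1 S1 H1)
               (cayley_dist G2 S2) \<phi> q"
proof -
  let ?T1 = "hull_translates G1 S1 H1" and ?T2 = "hull_translates G2 S2 H2"
  let ?d1 = "cayley_dist G1 S1" and ?d2 = "cayley_dist G2 S2"
  have bij: "bij_betw \<phi> ?T1 ?T2"
    using assms(7) unfolding uniformly_proper_def by blast
  obtain f :: "nat \<Rightarrow> nat" where f: "\<And>n J K. J \<in> ?T1 \<Longrightarrow> K \<in> ?T1 \<Longrightarrow>
      set_distance ?d1 J K \<le> real n \<Longrightarrow> set_distance ?d2 (\<phi> J) (\<phi> K) \<le> real (f n)"
    and f': "\<And>n J K. J \<in> ?T2 \<Longrightarrow> K \<in> ?T2 \<Longrightarrow>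
      set_distance ?d2 J K \<le> real n \<Longrightarrow>
      set_distance ?d1 (inv_into ?T1 \<phi> J) (inv_into ?T1 \<phi> K) \<le> real (f n)"
    using assms(7) unfolding uniformly_proper_def by blast
  have nd2: "\<exists>J \<in> ?T2. \<exists>K \<in> ?T2. J \<noteq> K"
  proof -
    obtain J K where JK: "J \<in> ?T1" "K \<in> ?T1" "J \<noteq> K"
      using nondegenerate by blast
    then have "\<phi> J \<noteq> \<phi> K" using inj_onD[OF bij_betw_imp_inj_on[OF bij], of J K] by blast
    then show ?thesis using bij_betwE[OF bij] JK(1,2) by blast
  qed
  interpret X1: cayley_pattern G1 S1 H1
    using stable_subgroup_cayley_pattern[OF assms(1,3,5) nondegenerate] .
  interpret X2: cayley_pattern G2 S2 H2
    using stable_subgroup_cayley_pattern[OF assms(2,4,6) nd2] .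
  note eqs = X1.hull_translates_eq X2.hull_translates_eq
  have d1: "cayley_dist G1 S1 = X1.pm" and M1: "cayley_graph G1 S1 = X1.M"
    and d2: "cayley_dist G2 S2 = X2.pm" and M2: "cayley_graph G2 S2 = X2.M"
    by (simp_all add: cayley_dist_def cayley_graph_def)
  note bij' = bij[unfolded eqs]
  note f1 = f[unfolded eqs d1 d2] and f2 = f'[unfolded eqs d1 d2]
  have \<phi>J: "\<phi> J \<in> X2.\<J>" "inv_into X1.\<J> \<phi> (\<phi> J) = J" if "J \<in> X1.\<J>" for J
    using bij_betw_apply[OF bij' that] bij_betw_inv_into_left[OF bij' that] by simp_all
  interpret P: pattern_pair X1.tm X1.\<J> X2.tm X2.\<J> \<phi>
  proof
    show "bij_betw \<phi> X1.\<J> X2.\<J>" by (rule bij')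
    fix n :: real
    define N where "N = nat \<lceil>n\<rceil>"
    have N: "n \<le> real N" unfolding N_def by (rule real_nat_ceiling_ge)
    show "\<exists>m. \<forall>J\<in>X1.\<J>. \<forall>K\<in>X1.\<J>. X1.close n J K \<longrightarrow> X2.close m (\<phi> J) (\<phi> K)"
    proof (intro exI[of _ "real (f N) + 1"] ballI impI)
      fix J K assume J: "J \<in> X1.\<J>" and K: "K \<in> X1.\<J>" and c: "X1.close n J K"
      have "set_distance X1.pm J K \<le> real N"
        using X1.close_set_distance[OF X1.\<J>_M[OF J] X1.\<J>_M[OF K] c] N by simp
      from f1[OF J K this] show "X2.close (real (f N) + 1) (\<phi> J) (\<phi> K)"
        using X2.\<J>_M X2.\<J>_nonempty \<phi>J(1) J K by (intro X2.set_distance_close) auto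
    qed
    show "\<exists>m. \<forall>J\<in>X1.\<J>. \<forall>K\<in>X1.\<J>. X2.close n (\<phi> J) (\<phi> K) \<longrightarrow> X1.close m J K"
    proof (intro exI[of _ "real (f N) + 1"] ballI impI)
      fix J K assume J: "J \<in> X1.\<J>" and K: "K \<in> X1.\<J>" and c: "X2.close n (\<phi> J) (\<phi> K)"
      have "set_distance X2.pm (\<phi> J) (\<phi> K) \<le> real N"
        using X2.close_set_distance[OF X2.\<J>_M[OF \<phi>J(1)[OF J]] X2.\<J>_M[OF \<phi>J(1)[OF K]] c] N by simp
      from f2[OF \<phi>J(1)[OF J] \<phi>J(1)[OF K] this] show "X1.close (real (f N) + 1) J K"
        using X1.\<J>_M X1.\<J>_nonempty J K by (intro X1.set_distance_close) (auto simp: \<phi>J(2)[OF J] \<phi>J(2)[OF K])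
    qed
  qed
  obtain q K e C where q: "P.pairing q" and K: "1 \<le> K" and e: "0 \<le> e"
    and qi: "\<And>x y. X1.tm x y / K - e \<le> X2.tm (q x) (q y) \<and> X2.tm (q x) (q y) \<le> K * X1.tm x y + e"
    and sur: "\<And>y. \<exists>x. X2.tm (q x) y \<le> C"
    using P.ex_pairing_quasi_isometry by blast
  \<comment> \<open>\<open>q\<close> may take values outside the realization; \<open>retr\<close>
    moves them into it without changing distances in \<open>X2.tm\<close>.\<close>
  define q' where "q' x = X2.retr (q x)" for x
  have "qi_embedding K e X1.M X1.pm X2.M X2.pm q'"
  proof -
    have "X2.pm (q' x) (q' y) = X2.tm (q x) (q y)" for x y by (simp add: q'_def X2.tm_def)
    then have "X1.pm x y / K - e \<le> X2.pm (q' x) (q' y) \<and> X2.pm (q' x) (q' y) \<le> K * X1.pm x y + e"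
      if "x \<in> X1.M" "y \<in> X1.M" for x y
      using qi[of x y] X1.tm_eq[OF that] by simp
    moreover have "q' x \<in> X2.M" for x by (simp add: q'_def)
    ultimately show ?thesis unfolding qi_embedding_def using K e by simp
  qed
  \<comment> \<open>The preimage \<open>x\<close> need not lie in the realization; passing to
    \<open>X1.retr x\<close>, at distance zero, moves the image by at most \<open>e\<close>.\<close>
  moreover have "\<exists>x\<in>X1.M. X2.pm (q' x) y \<le> C + e" if y: "y \<in> X2.M" for y
  proof -
    obtain x where x: "X2.tm (q x) y \<le> C" using sur by blast
    have "X2.tm (q (X1.retr x)) (q x) \<le> e" using qi[of "X1.retr x" x] by simp
    then have "X2.tm (q (X1.retr x)) y \<le> C + e" using x X2.d_tri[of "q (X1.retr x)" y "q x"] by simp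
    then have "X2.pm (q' (X1.retr x)) y \<le> C + e" using y X2.tm_eq[of "q' (X1.retr x)" y] by (simp add: q'_def)
    then show ?thesis by (intro bexI[of _ "X1.retr x"]) auto
  qed
  ultimately have "quasi_isometry X1.M X1.pm X2.M X2.pm q'" unfolding quasi_isometry_def by blast
  moreover have "pairs_as X1.M X1.pm X1.\<J> X2.pm \<phi> q'"
  proof -
    \<comment> \<open>The pairing is used at \<open>real n + 1\<close>, because a
      \<open>set_distance\<close> of at most \<open>n\<close> yields a point within
      \<open>n + 1\<close> only.\<close>
    have "\<forall>n::nat. \<exists>h. \<forall>p. \<forall>J\<in>X1.\<J>. X1.near (real n + 1) p J \<longrightarrow> X2.near h (q p) (\<phi> J)"
      using q unfolding P.pairing_def by blast
    from choice[OF this] obtain h where h: "\<And>n p J. J \<in> X1.\<J> \<Longrightarrow> X1.near (real n + 1) p J \<Longrightarrow> X2.near (h n) (q p) (\<phi> J)"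
      by blast
    show ?thesis unfolding pairs_as_def
    proof (intro exI[of _ "\<lambda>n. nat \<lceil>h n\<rceil>"] allI ballI impI)
      fix n p J assume p: "p \<in> X1.M" and J: "J \<in> X1.\<J>" and d: "set_distance X1.pm {p} J \<le> real n"
      have "X1.near (real n + 1) p J"
        unfolding X1.near_iff_close using p X1.\<J>_M[OF J] X1.\<J>_nonempty[OF J] d by (intro X1.set_distance_close) auto
      from h[OF J this] have "X2.near (h n) (q' p) (\<phi> J)" by (simp add: q'_def)
      then have "set_distance X2.pm {q' p} (\<phi> J) \<le> h n"
        using X2.\<J>_M[OF \<phi>J(1)[OF J]] unfolding X2.near_iff_close by (intro X2.close_set_distance) (auto simp: q'_def)
      then show "set_distance X2.pm {q' p} (\<phi> J) \<le> real (nat \<lceil>h n\<rceil>)" by linarith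
    qed
  qed
  ultimately show ?thesis unfolding eqs d1 d2 M1 M2 by blast
qed

end
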